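(* The cubic orbit is linearly stable. That is: let $E=-1$; there exist real numbers $\alpha,\beta$ and $\tau>0$, with numerical values (rounded to six decimal places) $\alpha=3.100685$, $\beta=0.668162$, $12\tau=0.124736$, such that the solution $\gamma$ of the Hamiltonian system with Hamiltonian $\Gamma$ with $$\gamma(0)=(0,\alpha,\alpha,\sqrt2,-\beta,\beta)^T$$ satisfies $$\gamma(2\tau)=(\alpha,0,\alpha,\beta,-\sqrt2,-\beta)^T$$ and is $12\tau$-periodic, and this periodic orbit is linearly stable.
   Context: For a fixed real parameter $E$ (the energy), the regularized Hamiltonian $\Gamma=\Gamma(Q_1,Q_2,Q_3,P_1,P_2,P_3)$ is $$\begin{aligned}\Gamma={}&P_1^2Q_2^2Q_3^2+Q_1^2P_2^2Q_3^2+Q_1^2Q_2^2P_3^2\\&-\frac{2Q_1^2Q_2^2Q_3^2}{\sqrt{Q_1^4+Q_2^4+Q_3^4}}-\frac{2Q_1^2Q_2^2Q_3^2}{\sqrt{Q_1^4+Q_2^4}}-\frac{2Q_1^2Q_2^2Q_3^2}{\sqrt{Q_1^4+Q_3^4}}-\frac{2Q_1^2Q_2^2Q_3^2}{\sqrt{Q_2^4+Q_3^4}}\\&-2Q_2^2Q_3^2-2Q_1^2Q_3^2-2Q_1^2Q_2^2-E\,Q_1^2Q_2^2Q_3^2,\end{aligned}$$ on the set of $(Q,P)\in\mathbb{R}^6$ for which at most one of $Q_1,Q_2,Q_3$ is zero. The associated Hamiltonian system is $\frac{dQ_i}{ds}=\frac{\partial\Gamma}{\partial P_i}$, $\frac{dP_i}{ds}=-\frac{\partial\Gamma}{\partial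 Q_i}$, $i=1,2,3$; solutions are written $\gamma(s)=(Q_1,Q_2,Q_3,P_1,P_2,P_3)^T(s)$. (It is the Levi-Civita regularization, via $q_i=Q_i^2$, $p_i=P_i/(2Q_i)$, $dt/ds=Q_1^2Q_2^2Q_3^2$, of the Newtonian problem of eight unit masses at $(\pm q_1,\pm q_2,\pm q_3)$.) Linear stability: let $\gamma$ be a periodic solution with period $T$ (here $T=12\tau$), let $J=\begin{bmatrix}0&I\\-I&0\end{bmatrix}$ with $3\times3$ blocks, and let $X(s)$ be the $6\times 6$ matrix solution of $X'=J\,D^2\Gamma(\gamma(s))\,X$, $X(0)=I$, where $D^2\Gamma$ is the Hessian of $\Gamma$. The monodromy matrix is $X(T)$. The orbit is linearly stable if all eigenvalues of $X(T)$ have complex modulus $1$ and all have multiplicity one, apart from pairs of eigenvalues equal to $1$ corresponding to first integrals of the system. In the present setting there is exactly one such exceptional pair of eigenvalues $1$, coming from the first integral $\Gamma$ itself; thus linear stability means that, apart from this one pair of eigenvalues $1$, the remaining four eigenvalues of $X(T)$ are of modulus $1$ and of multiplicity one.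
   Formalization: The six-decimal values are not attained (the orbit has α≈3.100882, β≈0.667923, 12τ≈0.124734); instead α and β are shown to lie within 5·10⁻⁴, and 12τ within 5·10⁻⁶, of the stated numbers. *)

theory Defs
  imports
    "HOL-Analysis.Analysis"
    "HOL-Computational_Algebra.Polynomial"
begin

text \<open>
  Phase space is \<open>real ^ (3 + 3)\<close>: for \<open>i :: 3\<close>, the coordinate \<open>x $ Inl i\<close> is \<open>Q\<^sub>i\<close> and
  \<open>x $ Inr i\<close> is \<open>P\<^sub>i\<close>. Matrices over this index type carry the \<open>3 \<times> 3\<close> block structure directly.
\<close>

type_synonym phase = "real ^ (3 + 3)"

definition state :: "real ^ 3 \<Rightarrow> real ^ 3 \<Rightarrow> phase" where
  "state q p = (\<chi> k. case k of Inl i \<Rightarrow> q $ i | Inr i \<Rightarrow> p $ i)"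

definition Gam :: "real \<Rightarrow> phase \<Rightarrow> real" where
  "Gam E x =
    (let Q1 = x $ Inl 1; Q2 = x $ Inl 2; Q3 = x $ Inl 3;
         P1 = x $ Inr 1; P2 = x $ Inr 2; P3 = x $ Inr 3
     in P1^2 * Q2^2 * Q3^2 + Q1^2 * P2^2 * Q3^2 + Q1^2 * Q2^2 * P3^2
        - 2 * Q1^2 * Q2^2 * Q3^2 / sqrt (Q1^4 + Q2^4 + Q3^4)
        - 2 * Q1^2 * Q2^2 * Q3^2 / sqrt (Q1^4 + Q2^4)
        - 2 * Q1^2 * Q2^2 * Q3^2 / sqrt (Q1^4 + Q3^4)
        - 2 * Q1^2 * Q2^2 * Q3^2 / sqrt (Q2^4 + Q3^4)
        - 2 * Q2^2 * Q3^2 - 2 * Q1^2 * Q3^2 - 2 * Q1^2 * Q2^2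
        - E * Q1^2 * Q2^2 * Q3^2)"

text \<open>
  \<^const>\<open>Gam\<close> is a total function, but it is only meaningful on the following open set, where all
  four radicands are positive and \<^const>\<open>Gam\<close> is smooth.
\<close>

definition Gam_domain :: "phase set" where
  "Gam_domain = {x. card {i :: 3. x $ Inl i = 0} \<le> 1}"

definition partial :: "'n::finite \<Rightarrow> (real ^ 'n \<Rightarrow> real) \<Rightarrow> real ^ 'n \<Rightarrow> real" where
  "partial k f x = deriv (\<lambda>t. f (x + t *\<^sub>R axis k 1)) 0"

definition hessian :: "(real ^ 'n::finite \<Rightarrow> real) \<Rightarrow> real ^ 'n \<Rightarrow> real ^ 'n ^ 'n" where
  "hessian f x = (\<chi> i j. partial i (partial j f) x)"

definition Gam_solution :: "real \<Rightarrow> (real \<Rightarrow> phase) \<Rightarrow> bool" where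
  "Gam_solution E \<gamma> \<longleftrightarrow>
    (\<forall>s. \<gamma> s \<in> Gam_domain \<and>
      (\<forall>i. ((\<lambda>u. \<gamma> u $ Inl i) has_real_derivative partial (Inr i) (Gam E) (\<gamma> s)) (at s) \<and>
           ((\<lambda>u. \<gamma> u $ Inr i) has_real_derivative - partial (Inl i) (Gam E) (\<gamma> s)) (at s)))"

definition J :: "real ^ (3 + 3) ^ (3 + 3)" where
  "J = (\<chi> k l. case (k, l) of
          (Inl i, Inr j) \<Rightarrow> if i = j then 1 else 0
        | (Inr i, Inl j) \<Rightarrow> if i = j then - 1 else 0
        | _ \<Rightarrow> 0)"

text \<open>
  The linear equation below has a unique solution, so for a given solution \<open>\<gamma>\<close> and \<open>T\<close> exactly one
  matrix \<open>M\<close> satisfies this predicate.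
\<close>

definition is_monodromy ::
  "real \<Rightarrow> (real \<Rightarrow> phase) \<Rightarrow> real \<Rightarrow> real ^ (3 + 3) ^ (3 + 3) \<Rightarrow> bool" where
  "is_monodromy E \<gamma> T M \<longleftrightarrow>
    (\<exists>X. X 0 = mat 1 \<and>
         (\<forall>s. (X has_vector_derivative (J ** hessian (Gam E) (\<gamma> s) ** X s)) (at s)) \<and>
         X T = M)"

definition complex_matrix :: "real ^ 'n ^ 'n \<Rightarrow> complex ^ 'n ^ 'n" where
  "complex_matrix A = (\<chi> i j. complex_of_real (A $ i $ j))"

definition char_poly :: "complex ^ 'n ^ 'n \<Rightarrow> complex poly" where
  "char_poly A = det (\<chi> i j. (if i = j then [:0, 1:] else 0) - [:A $ i $ j:])"

definition eigenvalue :: "complex ^ 'n ^ 'n \<Rightarrow> complex \<Rightarrow> bool" where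
  "eigenvalue A z \<longleftrightarrow> (\<exists>v. v \<noteq> 0 \<and> A *v v = z *s v)"

definition eigenvalue_multiplicity :: "complex ^ 'n ^ 'n \<Rightarrow> complex \<Rightarrow> nat" where
  "eigenvalue_multiplicity A z = order z (char_poly A)"

lemma poly_det:
  fixes A :: "complex poly ^ 'n ^ 'n"
  shows "poly (det A) z = det (\<chi> i j. poly (A $ i $ j) z)"
  by (simp add: det_def poly_sum poly_prod)

lemma eigenvalue_iff_root:
  "eigenvalue A z \<longleftrightarrow> poly (char_poly A) z = 0"
proof -
  let ?B = "\<chi> i j. (if i = j then z else 0) - A $ i $ j"
  have p: "poly (char_poly A) z = det ?B"
    unfolding char_poly_def poly_det by (intro arg_cong[where f = det]) (simp add: vec_eq_iff)
  have B: "?B *v v = z *s v - A *v v" for v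
  proof -
    have "(\<Sum>j\<in>UNIV. (if i = j then z else 0) * v $ j) = z * v $ i" for i
      by (simp add: if_distrib[of "\<lambda>x. x * _"] cong: if_cong)
    then show ?thesis
      by (simp add: vec_eq_iff matrix_vector_mult_def left_diff_distrib sum_subtractf)
  qed
  have "det ?B = 0 \<longleftrightarrow> \<not> invertible ?B"
    by (simp only: invertible_det_nz not_not)
  also have "\<dots> \<longleftrightarrow> (\<exists>v. v \<noteq> 0 \<and> ?B *v v = 0)"
    unfolding invertible_left_inverse matrix_left_invertible_ker by blast
  also have "\<dots> \<longleftrightarrow> eigenvalue A z"
    unfolding B eigenvalue_def by (metis right_minus_eq)
  finally show ?thesis
    using p by simp
qed

text \<open>
  Exactly one pair of eigenvalues \<open>1\<close> is exempt from simplicity, namely the one coming from the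
  first integral \<^const>\<open>Gam\<close>. Since the matrix is \<open>6 \<times> 6\<close>, four simple eigenvalues remain.
\<close>

definition linearly_stable :: "real \<Rightarrow> (real \<Rightarrow> phase) \<Rightarrow> real \<Rightarrow> bool" where
  "linearly_stable E \<gamma> T \<longleftrightarrow>
    (\<exists>M. is_monodromy E \<gamma> T M \<and>
         eigenvalue_multiplicity (complex_matrix M) 1 = 2 \<and>
         (\<forall>z. eigenvalue (complex_matrix M) z \<longrightarrow>
            cmod z = 1 \<and> (z \<noteq> 1 \<longrightarrow> eigenvalue_multiplicity (complex_matrix M) z = 1)))"

end

theory Submission imports Defs begin

text \<open>
  The field of \<open>\<Gamma>\<close> is reversed by \<open>sg\<close> (fixing the starting point) and by \<open>rh\<close> (exchanging the first
  two bodies). A solution on \<open>[0, \<tau>]\<close> that starts in the fixed space of \<open>sg\<close> and ends in that of \<open>rh\<close>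
  extends by reflections to a \<open>12\<tau>\<close>-periodic one whose continuation by \<open>2\<tau>\<close> is the order six map
  \<open>turn = rh \<circ> sg\<close>. Such a solution is found near a polynomial approximation: its defect and a weighted
  row-sum bound of the Jacobian, both computed with integer Chebyshev coefficients, give a Gronwall
  estimate, and Brouwer's fixed point theorem applied to a Newton map solves the three end conditions.

  The monodromy matrix is \<open>step\<^sup>6\<close> with \<open>step = sg \<circ> mirror\<close> a product of two involutions. The average of
  \<open>step\<close> and its inverse preserves the \<open>-1\<close>-space of \<open>sg\<close>; besides the direction of the flow, it acts
  there by a \<open>2 \<times> 2\<close> matrix that is determined by the symplectic pairings of four solutions of the
  linearised equation at time \<open>\<tau>\<close>. Enclosing these yields two eigenvalues \<open>cos t\<close>, hence four simple
  eigenvalues \<open>cis (\<plusminus> 6 t)\<close>; reversibility makes the remaining eigenvalue \<open>1\<close> a double one.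
\<close>

section \<open>Differential equations\<close>

text \<open>No enclosure of a monodromy matrix can show that eigenvalues lie exactly on the unit
  circle. Reversibility turns this into an open condition: the eigenvalues of \<open>step\<close>
  are governed by the real zeros of a quadratic, and sign changes bracket each zero
  \<open>cos t\<close> inside (-1, 1). Two or three digits are enough there, whereas the orbit
  itself is needed much more accurately. All estimates rest on one tube of radius 1/10^7 around the
  approximate orbit and one enclosure of the Jacobian on it. It yields existence for all nearby
  starting values, continuous dependence on them, and the errors of the linearised solutions,
  without any second derivative of the field. The weights hold the growth rate over [0, \<tau>] at
  4.911 and so the amplification of errors at 136. Two of the four linearised solutions, those in
  the directions \<alpha> and \<beta>, serve twice: as derivatives in the Newton map and in the
  pairings. The end time is an unknown slightly short of the computed interval, so that it can vary
  without extending any solution.\<close>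

lemma gronwall_weighted_sup:
  fixes y y' :: "'i::finite \<Rightarrow> real \<Rightarrow> real" and w :: "'i \<Rightarrow> real"
  assumes w: "\<And>i. w i > 0"
    and cont: "\<And>i. continuous_on {0..S} (y i)"
    and der: "\<And>i t. 0 < t \<Longrightarrow> t < S \<Longrightarrow> (y i has_real_derivative y' i t) (at t)"
    and bd: "\<And>i t m. 0 < t \<Longrightarrow> t < S \<Longrightarrow> (\<And>j. \<bar>y j t\<bar> \<le> m * w j) \<Longrightarrow> \<bar>y' i t\<bar> \<le> (l * m + d) * w i"
    and init: "\<And>i. \<bar>y i 0\<bar> \<le> e * w i"
    and l: "l > 0" and t: "t \<in> {0..S}"
  shows "\<bar>y i t\<bar> \<le> ((e + d / l) * exp (l * t) - d / l) * w i"
proof -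
  \<comment> \<open>The comparison function starts \<open>k\<close> above \<open>e\<close>, so that
    no component violates the bound at 0 and a first violation has to occur at a positive time;
    \<open>k\<close> tends to 0 at the end.\<close>
  have strict: "\<bar>y i t\<bar> < ((e + k + d / l) * exp (l * t) - d / l) * w i"
    if k: "k > 0" and t: "t \<in> {0..S}" for k i t
  proof -
    \<comment> \<open>The solution of \<open>B' = l * B + d\<close> with
      \<open>B 0 = e + k\<close>.\<close>
    define B where "B = (\<lambda>t. (e + k + d / l) * exp (l * t) - d / l)"
    have B0: "\<bar>y i 0\<bar> < B 0 * w i" for i
    proof -
      have "e * w i < B 0 * w i" using k w by (simp add: B_def)
      then show ?thesis using init[of i] by linarith
    qed
    have B': "(B has_real_derivative l * B t + d) (at t)" for t
      unfolding B_def using l by (auto intro!: derivative_eq_intros simp: field_simps)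
    have contB: "continuous_on A B" for A
      by (rule DERIV_continuous_on) (rule has_field_derivative_at_within[OF B'])
    define bad where "bad = (\<Union>i. {0..S} \<inter> (\<lambda>t. \<bar>y i t\<bar> - B t * w i) -` {0..})"
    have closed_bad: "closed bad"
      unfolding bad_def
      by (intro closed_UN finite_UNIV continuous_closed_preimage continuous_intros cont contB ballI) auto
    have "bad = {}"
    proof (rule ccontr)
      assume ne: "bad \<noteq> {}"
      have bdd: "bdd_below bad" by (rule bdd_belowI[of _ 0]) (auto simp: bad_def)
      define s where "s = Inf bad"
      have sb: "s \<in> bad" unfolding s_def by (rule closed_contains_Inf[OF ne bdd closed_bad])
      then obtain i where s: "0 \<le> s" "s \<le> S" and yi: "B s * w i \<le> \<bar>y i s\<bar>"
        by (auto simp: bad_def)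
      have "s \<noteq> 0" using yi B0[of i] by auto
      then have s0: "0 < s" using s by simp
      have before: "\<bar>y j u\<bar> \<le> B u * w j" if "0 < u" "u < s" for j u
      proof (rule ccontr)
        assume "\<not> ?thesis"
        then have "u \<in> bad" using that s by (auto simp: bad_def intro!: exI[of _ j])
        then have "s \<le> u" unfolding s_def by (rule cInf_lower) (rule bdd)
        then show False using that by simp
      qed
      \<comment> \<open>Before \<open>s\<close> all components obey the bound, so \<open>bd\<close>
        applies with \<open>m = B u\<close>: neither \<open>y i\<close> nor \<open>- y i\<close>
        grows faster than \<open>B * w i\<close>, and the gap present at 0 cannot close.\<close>
      have mono: "c * y i s - B s * w i \<le> c * y i 0 - B 0 * w i" if c: "\<bar>c\<bar> = 1" for c
      proof -
        define g where g: "g = (\<lambda>u. c * y i u - B u * w i)"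
        have cg: "continuous_on {0..s} g" unfolding g
          by (intro continuous_intros contB continuous_on_subset[OF cont]) (use s in auto)
        have dg: "(g has_real_derivative (c * y' i u - (l * B u + d) * w i)) (at u)" if "0 < u" "u < s" for u
          unfolding g using that s
          by (auto intro!: derivative_eq_intros der B')
        have le: "c * y' i u - (l * B u + d) * w i \<le> 0" if u: "0 < u" "u < s" for u
        proof -
          have "\<bar>y' i u\<bar> \<le> (l * B u + d) * w i" using u s by (intro bd before) auto
          moreover have "c * y' i u \<le> \<bar>y' i u\<bar>" using c by (metis abs_le_self_iff abs_ge_self abs_mult mult_1)
          ultimately show ?thesis by linarith
        qed
        have "g s \<le> g 0"
        proof (rule DERIV_nonpos_imp_decreasing_open[of 0 s g])
          show "0 \<le> s" using s0 by simp
          show "\<exists>y. (g has_real_derivative y) (at u) \<and> y \<le> 0" if "0 < u" "u < s" for u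
            using dg[OF that] le[OF that] by blast
        qed (rule cg)
        then show ?thesis by (simp add: g)
      qed
      have "y i s - B s * w i \<le> y i 0 - B 0 * w i" using mono[of 1] by simp
      moreover have "- y i s - B s * w i \<le> - y i 0 - B 0 * w i" using mono[of "-1"] by simp
      ultimately show False using yi B0[of i] by linarith
    qed
    then have "t \<notin> {0..S} \<inter> (\<lambda>t. \<bar>y i t\<bar> - B t * w i) -` {0..}"
      unfolding bad_def by blast
    then show ?thesis using t by (simp add: B_def)
  qed
  have lim: "((\<lambda>k. ((e + k + d / l) * exp (l * t) - d / l) * w i) \<longlongrightarrow>
      ((e + 0 + d / l) * exp (l * t) - d / l) * w i) (at_right 0)"
    by (intro tendsto_intros)
  have "eventually (\<lambda>k. \<bar>y i t\<bar> \<le> ((e + k + d / l) * exp (l * t) - d / l) * w i) (at_right 0)"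
    using eventually_at_right_less[of 0] by eventually_elim (rule less_imp_le[OF strict[OF _ t]], simp)
  from tendsto_lowerbound[OF lim this] show ?thesis by simp
qed

text \<open>Bielecki's weight: the unknown is \<open>x t / exp (2 * L * t)\<close>, for which the
  integral operator contracts bounded continuous functions by the factor 1/2 on the whole half line
  at once, so that no continuation from short intervals occurs. The bound on \<open>F t 0\<close>
  puts the image of the zero function into that space.\<close>

lemma picard_half_line:
  fixes F :: "real \<Rightarrow> 'a::banach \<Rightarrow> 'a"
  assumes cont: "continuous_on UNIV (\<lambda>(t, x). F t x)"
    and lip: "\<And>t x y. norm (F t x - F t y) \<le> C * norm (x - y)"
    and bnd: "\<And>t. norm (F t 0) \<le> B"
  shows "\<exists>x. x 0 = x0 \<and> (\<forall>t\<ge>0. (x has_vector_derivative F t (x t)) (at t within {0..}))"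
proof -
  define L where "L = \<bar>C\<bar> + 1"
  have "C * norm z \<le> L * norm z" for z :: 'a
    by (intro mult_right_mono) (auto simp: L_def)
  then have L: "L > 0" "\<And>t x y. norm (F t x - F t y) \<le> L * norm (x - y)"
    using order_trans[OF lip] by (auto simp: L_def)
  have B: "B \<ge> 0" using bnd[of 0] norm_ge_zero order_trans by blast
  define D :: "real \<Rightarrow> real" where "D = (\<lambda>t. exp (2 * L * t))"
  have contF: "continuous_on S (\<lambda>u. F u (g u))" if "continuous_on S g" for S g
  proof -
    have "continuous_on S (\<lambda>u. (u, g u))" by (intro continuous_intros that)
    from continuous_on_compose2[OF cont this] show ?thesis by simp
  qed
  define I where "I = (\<lambda>(y :: real \<Rightarrow> 'a) t. integral {0..t} (\<lambda>u. F u (D u *\<^sub>R y u)))"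
  \<comment> \<open>\<open>max t 0\<close> freezes the functions at negative times, as the space
    \<open>bcontfun\<close> is taken over all reals.\<close>
  define P where "P = (\<lambda>(y :: real \<Rightarrow> 'a) t. (1 / D (max t 0)) *\<^sub>R (x0 + I y (max t 0)))"
  have Dpos: "D t > 0" for t by (simp add: D_def)
  have contD: "continuous_on S D" for S unfolding D_def by (intro continuous_intros)
  have cy: "continuous_on S (\<lambda>u. F u (D u *\<^sub>R y u))" if "continuous_on UNIV y" for y S
    by (intro contF continuous_intros contD continuous_on_subset[OF that]) auto
  have intD: "((\<lambda>u. D u) has_integral (D t - 1) / (2 * L)) {0..t}" if "t \<ge> 0" for t
  proof -
    have "((\<lambda>u. D u) has_integral (D t / (2 * L) - D 0 / (2 * L))) {0..t}"
      using L by (intro fundamental_theorem_of_calculus that)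
        (auto simp: D_def has_real_derivative_iff_has_vector_derivative[symmetric] intro!: derivative_eq_intros)
    then show ?thesis by (simp add: D_def diff_divide_distrib)
  qed
  have I_diff: "norm (I y t - I z t) \<le> D t * (K / 2)"
    if y: "continuous_on UNIV y" and z: "continuous_on UNIV z" and K: "\<And>u. norm (y u - z u) \<le> K" and t: "t \<ge> 0" for y z K t
  proof -
    have K0: "K \<ge> 0" using K[of 0] norm_ge_zero order_trans by blast
    have "norm (I y t - I z t) = norm (integral {0..t} (\<lambda>u. F u (D u *\<^sub>R y u) - F u (D u *\<^sub>R z u)))"
      unfolding I_def by (subst Henstock_Kurzweil_Integration.integral_diff) (auto intro!: integrable_continuous_interval cy y z)
    also have "\<dots> \<le> integral {0..t} (\<lambda>u. L * K * D u)"
    proof (rule integral_norm_bound_integral)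
      show "(\<lambda>u. F u (D u *\<^sub>R y u) - F u (D u *\<^sub>R z u)) integrable_on {0..t}"
        by (intro integrable_continuous_interval continuous_intros cy y z)
      show "(\<lambda>u. L * K * D u) integrable_on {0..t}"
        by (intro integrable_continuous_interval continuous_intros contD)
      fix u
      have "norm (F u (D u *\<^sub>R y u) - F u (D u *\<^sub>R z u)) \<le> L * norm (D u *\<^sub>R (y u - z u))"
        using L(2)[of u "D u *\<^sub>R y u" "D u *\<^sub>R z u"] by (simp add: scaleR_diff_right)
      also have "\<dots> = L * (D u * norm (y u - z u))" using Dpos[of u] by simp
      also have "\<dots> \<le> L * (D u * K)" using L Dpos[of u] K by (intro mult_left_mono) auto
      finally show "norm (F u (D u *\<^sub>R y u) - F u (D u *\<^sub>R z u)) \<le> L * K * D u" by (simp add: mult_ac)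
    qed
    also have "\<dots> = L * K * ((D t - 1) / (2 * L))" using intD[OF t] by (simp add: integral_unique)
    also have "\<dots> = (D t - 1) * (K / 2)" using L by simp
    also have "\<dots> \<le> D t * (K / 2)" using K0 by (intro mult_right_mono) auto
    finally show ?thesis .
  qed
  have contI: "continuous_on {0..} (I y)" if y: "continuous_on UNIV y" for y
  proof -
    have "\<forall>t\<in>{0..}. (I y has_vector_derivative F t (D t *\<^sub>R y t)) (at t within {0..})"
    proof
      fix t :: real assume t: "t \<in> {0..}"
      have "(I y has_vector_derivative F t (D t *\<^sub>R y t)) (at t within {0..t+1})"
        unfolding I_def using t by (intro integral_has_vector_derivative cy y) auto
      moreover have "at t within {0..} = at t within {0..t+1}"
        by (rule at_within_nhd[of _ "{..<t+1}"]) (use t in auto)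
      ultimately show "(I y has_vector_derivative F t (D t *\<^sub>R y t)) (at t within {0..})" by simp
    qed
    then show ?thesis by (auto simp: continuous_on_eq_continuous_within intro: has_vector_derivative_continuous)
  qed
  have contP: "continuous_on UNIV (P y)" if y: "continuous_on UNIV y" for y
  proof -
    have "continuous_on UNIV (\<lambda>t. I y (max t 0))"
      by (rule continuous_on_compose2[OF contI[OF y], of _ "\<lambda>t. max t 0"]) (auto intro!: continuous_intros)
    moreover have "continuous_on UNIV (\<lambda>t. D (max t 0))"
      by (rule continuous_on_compose2[OF contD[of UNIV], of _ "\<lambda>t. max t 0"]) (auto intro!: continuous_intros)
    ultimately show ?thesis unfolding P_def using Dpos less_imp_neq[OF Dpos, THEN not_sym]
      by (intro continuous_intros) auto
  qed
  have D1: "D t \<ge> 1" if "t \<ge> 0" for t using that L by (simp add: D_def)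
  have P_diff: "norm (P y t - P z t) \<le> K / 2"
    if "continuous_on UNIV y" "continuous_on UNIV z" "\<And>u. norm (y u - z u) \<le> K" for y z K t
  proof -
    let ?t = "max t 0"
    have "P y t - P z t = (1 / D ?t) *\<^sub>R (I y ?t - I z ?t)"
      by (simp add: P_def algebra_simps)
    then have "norm (P y t - P z t) = norm (I y ?t - I z ?t) / D ?t" using Dpos[of ?t] by simp
    also have "\<dots> \<le> D ?t * (K / 2) / D ?t"
      using I_diff[OF that, of ?t] Dpos[of ?t] by (intro divide_right_mono) auto
    finally show ?thesis using Dpos[of ?t] by simp
  qed
  have P0: "norm (P (\<lambda>_. 0) t) \<le> norm x0 + B / (2 * L)" for t
  proof -
    let ?t = "max t 0"
    have "norm (I (\<lambda>_. 0) ?t) \<le> integral {0..?t} (\<lambda>u. B * D u)"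
      unfolding I_def
    proof (rule integral_norm_bound_integral)
      show "(\<lambda>u. F u (D u *\<^sub>R 0)) integrable_on {0..?t}"
        using cy[of "\<lambda>_. 0"] by (intro integrable_continuous_interval) auto
      show "(\<lambda>u. B * D u) integrable_on {0..?t}"
        by (intro integrable_continuous_interval continuous_intros contD)
      fix u assume u: "u \<in> {0..?t}"
      have "B * 1 \<le> B * D u" using D1[of u] u B by (intro mult_left_mono) auto
      then show "norm (F u (D u *\<^sub>R 0)) \<le> B * D u" using bnd[of u] by simp
    qed
    also have "\<dots> = B * ((D ?t - 1) / (2 * L))" using intD[of ?t] by (simp add: integral_unique)
    also have "\<dots> \<le> D ?t * (B / (2 * L))" using B L Dpos[of ?t] by (simp add: field_simps)
    finally have I: "norm (I (\<lambda>_. 0) ?t) \<le> D ?t * (B / (2 * L))" .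
    have "norm (x0 + I (\<lambda>_. 0) ?t) \<le> norm x0 * 1 + D ?t * (B / (2 * L))"
      using I norm_triangle_ineq[of x0 "I (\<lambda>_. 0) ?t"] by linarith
    also have "\<dots> \<le> norm x0 * D ?t + D ?t * (B / (2 * L))"
      using D1[of ?t] by (intro add_right_mono mult_left_mono) auto
    finally have "norm (x0 + I (\<lambda>_. 0) ?t) / D ?t \<le> D ?t * (norm x0 + B / (2 * L)) / D ?t"
      using Dpos[of ?t] by (intro divide_right_mono) (auto simp: algebra_simps)
    then show ?thesis using Dpos[of ?t] by (simp add: P_def)
  qed
  have P_bcont: "P (apply_bcontfun y) \<in> bcontfun" for y :: "real \<Rightarrow>\<^sub>C 'a"
  proof (rule bcontfun_normI)
    show "continuous_on UNIV (P (apply_bcontfun y))" by (intro contP continuous_on_apply_bcontfun)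
    fix t
    have "norm (P (apply_bcontfun y) t - P (\<lambda>_. 0) t) \<le> norm y / 2"
      by (rule P_diff) (auto intro: norm_bounded continuous_on_apply_bcontfun)
    then show "norm (P (apply_bcontfun y) t) \<le> norm y / 2 + (norm x0 + B / (2 * L))"
      using P0[of t] norm_triangle_sub[of "P (apply_bcontfun y) t" "P (\<lambda>_. 0) t"] by linarith
  qed
  have app: "apply_bcontfun (Bcontfun (P (apply_bcontfun y))) = P (apply_bcontfun y)" for y
    by (rule Bcontfun_inverse[OF P_bcont])
  have "\<exists>!y. Bcontfun (P (apply_bcontfun y)) = y"
  proof (rule banach_fix_type[where c = "1/2"])
    show "\<forall>y z :: real \<Rightarrow>\<^sub>C 'a.
      dist (Bcontfun (P (apply_bcontfun y))) (Bcontfun (P (apply_bcontfun z))) \<le> 1/2 * dist y z"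
    proof (intro allI dist_bound)
      fix y z :: "real \<Rightarrow>\<^sub>C 'a" and t
      have "norm (P (apply_bcontfun y) t - P (apply_bcontfun z) t) \<le> dist y z / 2"
        by (rule P_diff) (auto simp: dist_norm[symmetric] intro: dist_bounded)
      then show "dist (apply_bcontfun (Bcontfun (P (apply_bcontfun y))) t)
          (apply_bcontfun (Bcontfun (P (apply_bcontfun z))) t) \<le> 1/2 * dist y z"
        by (simp add: app dist_norm)
    qed
  qed auto
  then obtain y where y: "P (apply_bcontfun y) = apply_bcontfun y" using app by metis
  have cy': "continuous_on UNIV (apply_bcontfun y)" by (rule continuous_on_apply_bcontfun)
  define x where "x = (\<lambda>t. x0 + I (apply_bcontfun y) t)"
  have Dy: "D t *\<^sub>R apply_bcontfun y t = x t" if "t \<ge> 0" for t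
    using y[THEN fun_cong, of t, symmetric] that Dpos[of t] unfolding P_def x_def
    by (simp add: max_def)
  have "(x has_vector_derivative F t (x t)) (at t within {0..})" if t: "t \<ge> 0" for t
  proof -
    have "(I (apply_bcontfun y) has_vector_derivative F t (D t *\<^sub>R apply_bcontfun y t)) (at t within {0..t+1})"
      unfolding I_def by (rule integral_has_vector_derivative[OF cy[OF cy']]) (use t in auto)
    then have "(x has_vector_derivative F t (D t *\<^sub>R apply_bcontfun y t)) (at t within {0..t+1})"
      unfolding x_def using has_vector_derivative_add[OF has_vector_derivative_const] by fastforce
    moreover have "at t within {0..} = at t within {0..t+1}"
      by (rule at_within_nhd[of _ "{..<t+1}"]) (use t in auto)
    ultimately show ?thesis using Dy[OF t] by simp
  qed
  moreover have "x 0 = x0" by (simp add: x_def I_def)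
  ultimately show ?thesis by (intro exI[of _ x]) simp
qed

lemma has_vector_derivative_glue:
  assumes "(f has_vector_derivative d) (at t within A)" "(f has_vector_derivative d) (at t within B)"
    and "open U" "t \<in> U" "U \<subseteq> A \<union> B"
  shows "(f has_vector_derivative d) (at t)"
proof -
  have "(f has_vector_derivative d) (at t within (A \<union> B))"
    using assms(1,2) unfolding has_vector_derivative_def has_derivative_within
    by (auto simp: at_within_union intro: filterlim_sup)
  then have "(f has_vector_derivative d) (at t within U)"
    using assms(5) by (rule has_vector_derivative_within_subset)
  then show ?thesis by (simp only: at_within_open[OF assms(4,3)])
qed

text \<open>Negative times are the half line for the reversed field \<open>- F (- t)\<close>; the
  two halves are glued at 0.\<close>

lemma picard_global:
  fixes F :: "real \<Rightarrow> 'a::banach \<Rightarrow> 'a"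
  assumes cont: "continuous_on UNIV (\<lambda>(t, x). F t x)"
    and lip: "\<And>t x y. norm (F t x - F t y) \<le> C * norm (x - y)"
    and bnd: "\<And>t. norm (F t 0) \<le> B"
  shows "\<exists>x. x 0 = x0 \<and> (\<forall>t. (x has_vector_derivative F t (x t)) (at t))"
proof -
  obtain a where a: "a 0 = x0" "\<And>t. t \<ge> 0 \<Longrightarrow> (a has_vector_derivative F t (a t)) (at t within {0..})"
    using picard_half_line[OF cont lip bnd] by blast
  have "\<exists>x. x 0 = x0 \<and> (\<forall>t\<ge>0. (x has_vector_derivative - F (- t) (x t)) (at t within {0..}))"
  proof (rule picard_half_line[where C = C and B = B])
    have "continuous_on UNIV (\<lambda>p. - (case (- fst p, snd p) of (t, x) \<Rightarrow> F t x))"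
      by (intro continuous_intros continuous_on_compose2[OF cont, of UNIV "\<lambda>p. (- fst p, snd p)"]) auto
    then show "continuous_on UNIV (\<lambda>(t, x). - F (- t) x)" by (simp add: case_prod_beta)
    show "norm (- F (- t) x - - F (- t) y) \<le> C * norm (x - y)" for t x y
      using lip[of "-t" x y] by (metis minus_diff_minus norm_minus_cancel)
    show "norm (- F (- t) 0) \<le> B" for t using bnd by simp
  qed
  then obtain b where b: "b 0 = x0" "\<And>t. t \<ge> 0 \<Longrightarrow> (b has_vector_derivative - F (- t) (b t)) (at t within {0..})"
    by blast
  define x where "x = (\<lambda>t. if t \<ge> 0 then a t else b (- t))"
  have "(x has_vector_derivative F t (x t)) (at t)" for t
  proof (rule has_vector_derivative_glue[where A = "{0..}" and B = "{..0}" and U = UNIV])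
    show "(x has_vector_derivative F t (x t)) (at t within {0..})"
    proof (cases "t \<ge> 0")
      case True
      have "(x has_vector_derivative F t (a t)) (at t within {0..})"
        by (rule has_vector_derivative_transform[OF _ _ a(2)]) (use True in \<open>auto simp: x_def\<close>)
      then show ?thesis using True by (simp add: x_def)
    next
      case False
      then have "at t within {0..} = bot" by (simp add: at_within_eq_bot_iff)
      then show ?thesis by (simp add: has_vector_derivative_def has_derivative_def bounded_linear_scaleR_left)
    qed
    show "(x has_vector_derivative F t (x t)) (at t within {..0})"
    proof (cases "t \<le> 0")
      case True
      have "((b \<circ> uminus) has_vector_derivative (-1) *\<^sub>R (- F (- (- t)) (b (- t)))) (at t within {..0})"
        by (rule vector_diff_chain_within) (use True b(2)[of "-t"] in \<open>auto intro!: derivative_eq_intros\<close>)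
      then have "((b \<circ> uminus) has_vector_derivative F t (b (- t))) (at t within {..0})" by simp
      then have "(x has_vector_derivative F t (b (- t))) (at t within {..0})"
        by (rule has_vector_derivative_transform[OF _ _, rotated 2]) (use True a(1) b(1) in \<open>auto simp: x_def\<close>)
      then show ?thesis using True a(1) b(1) by (cases "t = 0") (auto simp: x_def)
    next
      case False
      then have "at t within {..0} = bot" by (simp add: at_within_eq_bot_iff)
      then show ?thesis by (simp add: has_vector_derivative_def has_derivative_def bounded_linear_scaleR_left)
    qed
  qed auto
  moreover have "x 0 = x0" using a(1) by (simp add: x_def)
  ultimately show ?thesis by blast
qed

section \<open>Chebyshev series with integer coefficients\<close>

fun padd :: "int list \<Rightarrow> int list \<Rightarrow> int list" where
  "padd [] ys = ys"
| "padd (x # xs) [] = x # xs"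
| "padd (x # xs) (y # ys) = (x + y) # padd xs ys"

fun psmul :: "int \<Rightarrow> int list \<Rightarrow> int list" where
  "psmul c [] = []"
| "psmul c (x # xs) = (c * x) # psmul c xs"

text \<open>For \<open>X = x + z * X'\<close> and \<open>Y = y + z * Y'\<close> the product
  \<open>X * Y\<close> and the cosine series of \<open>X * cnj Y\<close> begin with the same terms
  \<open>r\<close>. What remains comes from \<open>X'\<close> and \<open>Y'\<close>, shifted by two
  degrees in the product and unshifted in the other series, so one recursion yields both.\<close>

fun pjoin :: "int list \<Rightarrow> int list \<times> int list \<Rightarrow> int list \<times> int list" where
  "pjoin r (a, b) = (padd r a, padd r (0 # 0 # b))"

fun pprod :: "int list \<Rightarrow> int list \<Rightarrow> int list \<times> int list" where
  "pprod [] ys = ([], [])"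
| "pprod (x # xs) [] = ([], [])"
| "pprod (x # xs) (y # ys) = pjoin ((x * y) # padd (psmul x ys) (psmul y xs)) (pprod xs ys)"

fun pcos :: "int list \<times> int list \<Rightarrow> int list" where
  "pcos (a, b) = padd a b"

fun pnorm :: "int list \<Rightarrow> int" where
  "pnorm [] = 0"
| "pnorm (x # xs) = \<bar>x\<bar> + pnorm xs"

text \<open>Division by \<open>2 ^ s\<close> with every loss charged to the radius: the tail beyond
  \<open>n\<close> coefficients by its norm, each rounding down by one unit.\<close>

fun pround :: "nat \<Rightarrow> nat \<Rightarrow> int \<Rightarrow> int list \<Rightarrow> int list \<times> int" where
  "pround 0 s e xs = ([], drop_bit s (e + pnorm xs) + 1)"
| "pround (Suc n) s e [] = ([], drop_bit s e + 1)"
| "pround (Suc n) s e (x # xs) = (case pround n s e xs of (ys, d) \<Rightarrow> (drop_bit s x # ys, d + 1))"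

text \<open>
  A pair \<open>(a, e)\<close> stands for the numbers within \<open>e\<close> units of \<open>\<Sum> a\<^sub>k cos (k \<theta>)\<close>, where the unit is a
  power of two, \<open>2 ^ - 46\<close> throughout the computation.
\<close>

type_synonym tm = "int list \<times> int"

text \<open>The shift is one larger than \<open>s\<close> because \<open>Re u * Re v\<close> is half
  of the sum represented by \<open>pprod\<close>; the propagated error is doubled for the same
  reason.\<close>

fun tmul :: "nat \<Rightarrow> nat \<Rightarrow> tm \<Rightarrow> tm \<Rightarrow> tm" where
  "tmul n s (a, e) (b, d) =
     pround n (Suc s) (2 * (e * (pnorm b + d) + pnorm a * d)) (pcos (pprod a b))"

fun tadd :: "tm \<Rightarrow> tm \<Rightarrow> tm" where
  "tadd (a, e) (b, d) = (padd a b, e + d)"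

fun tscale :: "int \<Rightarrow> tm \<Rightarrow> tm" where
  "tscale c (a, e) = (psmul c a, \<bar>c\<bar> * e)"

fun pev :: "complex \<Rightarrow> int list \<Rightarrow> complex" where
  "pev z [] = 0"
| "pev z (x # xs) = of_int x + z * pev z xs"

lemma pev_padd: "pev z (padd xs ys) = pev z xs + pev z ys"
  by (induction xs ys rule: padd.induct) (simp_all add: algebra_simps)

lemma pev_psmul: "pev z (psmul c xs) = of_int c * pev z xs"
  by (induction xs) (simp_all add: algebra_simps)

lemma norm_pev_le: "norm z = 1 \<Longrightarrow> norm (pev z xs) \<le> of_int (pnorm xs)"
proof (induction xs)
  case (Cons x xs)
  show ?case using Cons norm_triangle_ineq[of "of_int x" "z * pev z xs"] by (simp add: norm_mult)
qed simp

text \<open>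
  On the unit circle \<open>Re u * Re v = Re (u * v + u * cnj v) / 2\<close>; the two components of \<^const>\<open>pprod\<close>
  represent the two summands.
\<close>

lemma pev_pprod:
  assumes "norm z = 1"
  shows "pev z (snd (pprod xs ys)) = pev z xs * pev z ys \<and>
    Re (pev z (fst (pprod xs ys))) = Re (pev z xs * cnj (pev z ys))"
proof (induction xs ys rule: pprod.induct)
  case (3 x xs y ys)
  let ?X = "pev z xs" and ?Y = "pev z ys"
  obtain a b where ab: "pprod xs ys = (a, b)" by fastforce
  have zz: "z * cnj z = 1" using assms by (simp add: complex_norm_square[symmetric])
  have "cnj (z * ?X) = cnj z * cnj ?X" by simp
  have "(of_int x + z * ?X) * cnj (of_int y + z * ?Y) =
     of_int x * of_int y + of_int x * cnj (z * ?Y) + of_int y * (z * ?X) + (z * cnj z) * (?X * cnj ?Y)"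
    by (simp add: algebra_simps)
  then have e: "(of_int x + z * ?X) * cnj (of_int y + z * ?Y) =
     of_int x * of_int y + of_int x * cnj (z * ?Y) + of_int y * (z * ?X) + ?X * cnj ?Y"
    unfolding zz by simp
  have "Re ((of_int x + z * ?X) * cnj (of_int y + z * ?Y)) =
     of_int x * of_int y + of_int x * Re (z * ?Y) + of_int y * Re (z * ?X) + Re (?X * cnj ?Y)"
    unfolding e by simp
  with 3 ab show ?case
    by (simp add: pev_padd pev_psmul algebra_simps)
qed simp_all

lemma drop_bit_bounds: "of_int (drop_bit s x) \<le> real_of_int x / 2 ^ s" "real_of_int x / 2 ^ s < of_int (drop_bit s x) + 1"
proof -
  have "drop_bit s x = \<lfloor>real_of_int x / 2 ^ s\<rfloor>"
    using floor_divide_of_int_eq[of x "2 ^ s", where 'a = real] by (simp add: drop_bit_eq_div)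
  then show "of_int (drop_bit s x) \<le> real_of_int x / 2 ^ s" "real_of_int x / 2 ^ s < of_int (drop_bit s x) + 1"
    by linarith+
qed

lemma pround_bound:
  assumes "norm z = 1" "pround n s e xs = (ys, d)"
  shows "norm (pev z xs / 2 ^ s - pev z ys) + of_int e / 2 ^ s \<le> of_int d"
  using assms(2)
proof (induction n s e xs arbitrary: ys d rule: pround.induct)
  case (1 s e xs)
  have "norm (pev z xs / 2 ^ s) \<le> of_int (pnorm xs) / 2 ^ s"
    using norm_pev_le[OF assms(1), of xs] by (simp add: norm_divide norm_power divide_right_mono)
  moreover have "of_int (e + pnorm xs) / 2 ^ s \<le> real_of_int (drop_bit s (e + pnorm xs) + 1)"
    using drop_bit_bounds(2)[of "e + pnorm xs" s] by simp
  ultimately show ?case using 1 by (auto simp: add_divide_distrib)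
next
  case (2 n s e)
  then show ?case using drop_bit_bounds(2)[of e s] by auto
next
  case (3 n s e x xs)
  obtain us c where us: "pround n s e xs = (us, c)" by fastforce
  then have IH: "norm (pev z xs / 2 ^ s - pev z us) + of_int e / 2 ^ s \<le> of_int c"
    by (rule 3(1))
  have ys: "ys = drop_bit s x # us" "d = c + 1" using 3(2) us by auto
  have "norm (complex_of_real (real_of_int x / 2 ^ s - of_int (drop_bit s x))) \<le> 1"
    using drop_bit_bounds(1)[of s x] drop_bit_bounds(2)[of x s] unfolding norm_of_real by linarith
  moreover have "pev z (x # xs) / 2 ^ s - pev z ys =
      complex_of_real (real_of_int x / 2 ^ s - of_int (drop_bit s x)) + z * (pev z xs / 2 ^ s - pev z us)"
    by (simp add: ys add_divide_distrib algebra_simps)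
  ultimately have "norm (pev z (x # xs) / 2 ^ s - pev z ys) \<le> 1 + norm (pev z xs / 2 ^ s - pev z us)"
    using norm_triangle_ineq[of "complex_of_real (real_of_int x / 2 ^ s - of_int (drop_bit s x))" "z * (pev z xs / 2 ^ s - pev z us)"] assms(1)
    by (simp add: norm_mult)
  then show ?case using IH by (simp add: ys)
qed

lemma Re_divide_power2: "Re (w / 2 ^ k) = Re w / 2 ^ k"
  using Re_divide_of_real[of w "2 ^ k"] by simp

definition enc :: "real \<Rightarrow> tm \<Rightarrow> real \<Rightarrow> bool" where
  "enc \<theta> A v \<longleftrightarrow> \<bar>2 ^ 46 * v - Re (pev (cis \<theta>) (fst A))\<bar> \<le> of_int (snd A)"

text \<open>With \<open>s = 46\<close> the scale cancels and the product itself is enclosed;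
  \<open>s = 49\<close> divides by 8 in addition, which produces the scaled squares.\<close>

lemma enc_tmul:
  assumes "enc \<theta> A v" "enc \<theta> B w"
  shows "enc \<theta> (tmul n s A B) (v * w * 2 ^ 46 / 2 ^ s)"
proof -
  obtain a e b d where AB: "A = (a, e)" "B = (b, d)" by fastforce
  let ?z = "cis \<theta>"
  let ?V = "2 ^ 46 * v" and ?W = "2 ^ 46 * w"
  define x y where "x = Re (pev ?z a)" and "y = Re (pev ?z b)"
  obtain p q where pq: "pprod a b = (p, q)" by fastforce
  let ?E = "2 * (e * (pnorm b + d) + pnorm a * d)"
  obtain r c where rc: "pround n (Suc s) ?E (padd p q) = (r, c)" by fastforce
  have V: "\<bar>?V - x\<bar> \<le> of_int e" and W: "\<bar>?W - y\<bar> \<le> of_int d"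
    using assms by (simp_all add: enc_def AB x_def y_def)
  have x: "\<bar>x\<bar> \<le> of_int (pnorm a)" and y: "\<bar>y\<bar> \<le> of_int (pnorm b)"
    using norm_pev_le[of ?z a] norm_pev_le[of ?z b] abs_Re_le_cmod order_trans by (auto simp: x_def y_def)
  have "?V * ?W - x * y = (?V - x) * ?W + x * (?W - y)" by (simp add: algebra_simps)
  then have "\<bar>?V * ?W - x * y\<bar> \<le> \<bar>?V - x\<bar> * \<bar>?W\<bar> + \<bar>x\<bar> * \<bar>?W - y\<bar>"
    by (metis abs_mult abs_triangle_ineq)
  also have "\<dots> \<le> of_int e * of_int (pnorm b + d) + of_int (pnorm a) * of_int d"
    by (intro add_mono mult_mono) (use V W x y in auto)
  finally have 1: "\<bar>?V * ?W - x * y\<bar> \<le> of_int ?E / 2" by simp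
  have "x * y = Re (pev ?z q + pev ?z p) / 2"
    using pev_pprod[of ?z a b] pq by (simp add: x_def y_def)
  then have 2: "x * y / 2 ^ s = Re (pev ?z (padd p q) / 2 ^ Suc s)"
    by (simp only: pev_padd Re_divide_power2) (simp add: add.commute)
  have "\<bar>Re (pev ?z (padd p q) / 2 ^ Suc s) - Re (pev ?z r)\<bar> \<le> norm (pev ?z (padd p q) / 2 ^ Suc s - pev ?z r)"
    by (metis abs_Re_le_cmod minus_complex.simps(1))
  also have "\<dots> \<le> of_int c - of_int ?E / 2 ^ Suc s"
    using pround_bound[OF _ rc, of ?z] by simp
  finally have 3: "\<bar>x * y / 2 ^ s - Re (pev ?z r)\<bar> \<le> of_int c - of_int ?E / 2 ^ Suc s"
    unfolding 2 .
  have "\<bar>?V * ?W / 2 ^ s - x * y / 2 ^ s\<bar> = \<bar>?V * ?W - x * y\<bar> / 2 ^ s"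
    by (simp add: diff_divide_distrib[symmetric] abs_divide)
  also have "\<dots> \<le> of_int ?E / 2 / 2 ^ s"
    by (intro divide_right_mono 1) auto
  also have "\<dots> = of_int ?E / 2 ^ Suc s" by simp
  finally have "\<bar>?V * ?W / 2 ^ s - Re (pev ?z r)\<bar> \<le> of_int c"
    using 3 by linarith
  moreover have "tmul n s A B = (r, c)" by (simp only: AB tmul.simps pq pcos.simps rc)
  ultimately show ?thesis by (simp add: enc_def mult_ac)
qed

lemma enc_tadd: "enc \<theta> A v \<Longrightarrow> enc \<theta> B w \<Longrightarrow> enc \<theta> (tadd A B) (v + w)"
  by (cases A; cases B) (auto simp: enc_def pev_padd algebra_simps)

lemma enc_tscale:
  assumes "enc \<theta> A v" shows "enc \<theta> (tscale c A) (of_int c * v)"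
proof -
  obtain a e where A: "A = (a, e)" by fastforce
  have "\<bar>of_int c * (2 ^ 46 * v - Re (pev (cis \<theta>) a))\<bar> \<le> \<bar>of_int c\<bar> * of_int e"
    unfolding abs_mult using assms by (intro mult_left_mono) (auto simp: enc_def A)
  then show ?thesis by (simp add: enc_def A pev_psmul algebra_simps)
qed

lemma enc_const: "enc \<theta> ([c], 0) (of_int c / 2 ^ 46)"
  by (simp add: enc_def)

lemma enc_exact: "enc \<theta> (a, 0) (Re (pev (cis \<theta>) a) / 2 ^ 46)"
  by (simp add: enc_def)

fun tnorm :: "tm \<Rightarrow> int" where "tnorm (a, e) = pnorm a + e"

lemma enc_tnorm:
  assumes "enc \<theta> A v" shows "\<bar>v\<bar> \<le> of_int (tnorm A) / 2 ^ 46"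
proof -
  have "\<bar>Re (pev (cis \<theta>) (fst A))\<bar> \<le> of_int (pnorm (fst A))"
    using norm_pev_le[of "cis \<theta>" "fst A"] abs_Re_le_cmod order_trans by auto
  then show ?thesis using assms by (cases A) (auto simp: enc_def field_simps)
qed

lemma enc_norm_le: "enc \<theta> A v \<Longrightarrow> tnorm A \<le> c \<Longrightarrow> \<bar>v\<bar> \<le> of_int c / 2 ^ 46"
  by (rule order_trans[OF enc_tnorm divide_right_mono]) auto

section \<open>Derivatives of Chebyshev series and their behaviour at the end points\<close>

fun pwt :: "nat \<Rightarrow> int list \<Rightarrow> int list" where
  "pwt k [] = []"
| "pwt k (x # xs) = (int k * x) # pwt (Suc k) xs"

fun second :: "int list \<Rightarrow> int" where
  "second (x # y # xs) = y"
| "second xs = 0"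

fun pdcons :: "int \<Rightarrow> int list \<Rightarrow> int list" where
  "pdcons c xs = (c + second xs) # xs"

text \<open>\<open>sin (k \<theta>) / sin \<theta>\<close> is twice the sum of
  \<open>cos (j \<theta>)\<close> over \<open>j = k - 1, k - 3, ...\<close>, the term
  \<open>j = 0\<close> counted half. Hence the sums with stride two, accumulated from the top; the
  constant term is halved later, in \<open>pdhead\<close>.\<close>

fun pdrec :: "int \<Rightarrow> int list \<Rightarrow> int list" where
  "pdrec k [] = []"
| "pdrec k (x # xs) = pdcons (2 * k * x) (pdrec (k + 1) xs)"

fun pdhead :: "int list \<Rightarrow> int list" where
  "pdhead [] = []"
| "pdhead (x # xs) = (- x) # psmul (- 2) xs"

text \<open>Twice the derivative in \<open>t\<close>, that is, the derivative in
  \<open>t / 2\<close>, which runs from 0 to 1. In this normalisation it is compared directly with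
  \<open>Tr * field\<close>.\<close>

definition pder :: "int list \<Rightarrow> int list" where
  "pder xs = pdhead (pdrec 1 (tl xs))"

text \<open>\<open>k * k\<close> is the modulus of the slope of the \<open>k\<close>-th Chebyshev
  polynomial at the ends of \<open>[-1, 1]\<close>, the largest on the interval. The sum therefore
  serves as a Lipschitz constant at the end point.\<close>

fun pwnorm :: "int \<Rightarrow> int list \<Rightarrow> int" where
  "pwnorm k [] = 0"
| "pwnorm k (x # xs) = k * k * \<bar>x\<bar> + pwnorm (k + 1) xs"

text \<open>The map \<open>1 - t = cos \<theta>\<close> sends \<open>t = 0\<close> to
  \<open>\<theta> = 0\<close> and \<open>t = 2\<close> to \<open>\<theta> = pi\<close>, so initial
  values are plain sums of coefficients and end values alternating ones.\<close>

definition cheb :: "int list \<Rightarrow> real \<Rightarrow> real" where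
  "cheb a t = Re (pev (cis (arccos (1 - t))) a) / 2 ^ 46"

text \<open>Entries two places apart differ by \<open>2 * k * x\<close>, so multiplication by
  \<open>z ^ 2 - 1\<close> telescopes up to the two leading entries.\<close>

lemma pdrec_eq:
  "(z\<^sup>2 - 1) * pev z (pdrec (int k) xs) =
    2 * z\<^sup>2 * pev z (pwt k xs) - of_int (hd (pdrec (int k) xs @ [0])) - of_int (second (pdrec (int k) xs)) * z"
proof (induction k xs rule: pwt.induct)
  case (2 k x xs)
  have k: "int k + 1 = int (Suc k)" by simp
  show ?case
  proof (cases "pdrec (int (Suc k)) xs")
    case Nil
    with 2 show ?thesis unfolding pdrec.simps k by (simp add: algebra_simps)
  next
    case (Cons h t)
    define W where "W = pev z (pwt (Suc k) xs)"
    have IH: "(z\<^sup>2 - 1) * (of_int h + z * pev z t) = 2 * z\<^sup>2 * W - of_int h - of_int (second (h # t)) * z"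
      using 2 Cons by (simp add: W_def)
    have s2: "second (c # h # t) = h" for c by simp
    show ?thesis
      unfolding pdrec.simps k Cons pdcons.simps pev.simps pwt.simps s2 W_def[symmetric] append_Cons list.sel(1)
      using IH by simp algebra
  qed
qed simp

text \<open>Multiplying \<open>pdrec_eq\<close> by \<open>cnj z\<close> turns
  \<open>z ^ 2 - 1\<close> into \<open>z - cnj z\<close>, which is purely imaginary with imaginary
  part \<open>2 * sin t\<close>; taking imaginary parts then isolates a real part.\<close>

lemma pev_pder:
  "sin t * Re (pev (cis t) (pder a)) = - 2 * Im (cis t * pev (cis t) (pwt 1 (tl a)))"
proof -
  let ?z = "cis t" and ?r = "pdrec 1 (tl a)"
  define K W h g where "K = pev ?z ?r" and "W = pev ?z (pwt 1 (tl a))"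
    and "h = hd (?r @ [0])" and "g = second ?r"
  have z: "cnj ?z * ?z = 1" by (simp add: cis_cnj cis_mult)
  have "(?z\<^sup>2 - 1) * K = 2 * ?z\<^sup>2 * W - of_int h - of_int g * ?z"
    using pdrec_eq[of ?z 1 "tl a"] by (simp add: K_def W_def h_def g_def)
  then have "cnj ?z * ((?z\<^sup>2 - 1) * K) = cnj ?z * (2 * ?z\<^sup>2 * W - of_int h - of_int g * ?z)" by simp
  then have "(cnj ?z * ?z * ?z - cnj ?z) * K = 2 * (cnj ?z * ?z) * ?z * W - of_int h * cnj ?z - of_int g * (cnj ?z * ?z)"
    by (simp add: algebra_simps power2_eq_square)
  then have "(?z - cnj ?z) * K = 2 * ?z * W - of_int h * cnj ?z - of_int g"
    unfolding z by simp
  then have "Im ((?z - cnj ?z) * K) = Im (2 * ?z * W - of_int h * cnj ?z - of_int g)" by simp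
  moreover have "?z - cnj ?z = \<i> * of_real (2 * sin t)" by (simp add: complex_eq_iff)
  ultimately have A: "2 * sin t * Re K = 2 * Im (?z * W) + of_int h * sin t" by simp
  have "Re (pev ?z (pder a)) = of_int h - 2 * Re K"
    unfolding pder_def K_def h_def by (cases ?r) (simp_all add: pev_psmul)
  then have "sin t * Re (pev ?z (pder a)) = of_int h * sin t - 2 * sin t * Re K" by (simp add: right_diff_distrib)
  then show ?thesis using A unfolding W_def by linarith
qed

text \<open>The factor \<open>cis (k * t)\<close> records the degree at which the list starts, so
  that the induction can pass from \<open>k\<close> to \<open>Suc k\<close>.\<close>

lemma pev_cis_vector_derivative:
  "((\<lambda>t. cis (real k * t) * pev (cis t) xs) has_vector_derivative \<i> * cis (real k * t) * pev (cis t) (pwt k xs)) (at t)"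
proof (induction xs arbitrary: k)
  case (Cons x xs)
  have cis: "((\<lambda>t. cis (real k * t)) has_vector_derivative \<i> * of_nat k * cis (real k * t)) (at t)"
  proof -
    have "((\<lambda>t. \<i> * of_nat k * of_real t) has_vector_derivative \<i> * of_nat k * of_real 1) (at t)"
      by (intro has_vector_derivative_mult_right has_vector_derivative_of_real DERIV_ident)
    from field_vector_diff_chain_at[OF this DERIV_exp]
    show ?thesis by (simp add: cis_conv_exp o_def mult_ac)
  qed
  have eq: "cis (real k * t) * pev (cis t) (x # xs) =
      cis (real k * t) * of_int x + cis (real (Suc k) * t) * pev (cis t) xs" for t
    by (simp add: cis_mult algebra_simps)
  have "((\<lambda>t. cis (real k * t) * of_int x + cis (real (Suc k) * t) * pev (cis t) xs) has_vector_derivative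
      \<i> * of_nat k * cis (real k * t) * of_int x + \<i> * cis (real (Suc k) * t) * pev (cis t) (pwt (Suc k) xs)) (at t)"
    by (intro has_vector_derivative_add Cons has_vector_derivative_mult_left cis)
  moreover have "\<i> * of_nat k * cis (real k * t) * of_int x + \<i> * cis (real (Suc k) * t) * pev (cis t) (pwt (Suc k) xs)
      = \<i> * cis (real k * t) * pev (cis t) (pwt k (x # xs))"
    by (simp add: cis_mult[symmetric] algebra_simps)
  ultimately show ?case unfolding eq by simp
qed simp

lemma Re_pev_derivative:
  "((\<lambda>t. Re (pev (cis t) a)) has_real_derivative - Im (cis t * pev (cis t) (pwt 1 (tl a)))) (at t)"
proof (cases a)
  case (Cons x xs)
  have "((\<lambda>t. Re (of_int x + cis (real 1 * t) * pev (cis t) xs)) has_vector_derivative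
      Re (0 + \<i> * cis (real 1 * t) * pev (cis t) (pwt 1 xs))) (at t)"
    by (intro bounded_linear.has_vector_derivative[OF bounded_linear_Re] has_vector_derivative_add
        has_vector_derivative_const pev_cis_vector_derivative)
  then show ?thesis
    by (simp add: Cons has_real_derivative_iff_has_vector_derivative mult.assoc)
qed simp

lemma DERIV_cheb:
  assumes "0 < t" "t < 2"
  shows "(cheb a has_real_derivative cheb (pder a) t / 2) (at t)"
proof -
  let ?th = "arccos (1 - t)"
  have sin: "sin ?th > 0"
    using assms by (simp add: sin_arccos_nonzero sin_gt_zero arccos_lt_bounded)
  have s: "sin ?th = sqrt (1 - (1 - t)\<^sup>2)" using assms by (simp add: sin_arccos)
  have "((\<lambda>t. arccos (1 - t)) has_real_derivative inverse (- sqrt (1 - (1 - t)\<^sup>2)) * (- 1)) (at t)"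
    by (rule DERIV_chain2[OF DERIV_arccos]) (use assms in \<open>auto intro!: derivative_eq_intros\<close>)
  then have "((\<lambda>t. arccos (1 - t)) has_real_derivative 1 / sin ?th) (at t)"
    by (simp add: s inverse_eq_divide)
  from DERIV_cdivide[OF DERIV_chain2[OF Re_pev_derivative this], of a "2 ^ 46"]
  show ?thesis unfolding cheb_def
    by (rule DERIV_cong) (use pev_pder[of ?th a] sin in \<open>simp add: field_simps\<close>)
qed

lemma continuous_on_cheb: "continuous_on {0..2} (cheb a)"
proof -
  have "continuous_on UNIV (\<lambda>t. Re (pev (cis t) a))"
    by (intro continuous_at_imp_continuous_on ballI DERIV_isCont[OF Re_pev_derivative])
  from continuous_on_compose2[OF this, of "{0..2}" "\<lambda>t. arccos (1 - t)"]
  have "continuous_on {0..2} (\<lambda>t. arccos (1 - t)) \<Longrightarrow> continuous_on {0..2} (\<lambda>t. Re (pev (cis (arccos (1 - t))) a))"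
    by simp
  moreover have "continuous_on {0..2 :: real} (\<lambda>t. arccos (1 - t))" by (intro continuous_intros) auto
  ultimately show ?thesis unfolding cheb_def by (intro continuous_on_divide continuous_on_const) auto
qed

lemma cheb_0: "cheb a 0 = of_int (sum_list a) / 2 ^ 46"
proof -
  have "pev 1 a = of_int (sum_list a)" by (induction a) auto
  then show ?thesis by (simp add: cheb_def)
qed

fun altsum :: "int list \<Rightarrow> int" where
  "altsum [] = 0"
| "altsum (x # xs) = x - altsum xs"

lemma pev_minus_1: "pev (- 1) a = of_int (altsum a)"
  by (induction a) auto

lemma cheb_2: "cheb a 2 = of_int (altsum a) / 2 ^ 46"
  by (simp add: cheb_def pev_minus_1)

lemma abs_sin_multiple: "\<bar>sin (real k * x)\<bar> \<le> real k * \<bar>sin x\<bar>"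
proof (induction k)
  case (Suc k)
  have "\<bar>sin (real (Suc k) * x)\<bar> = \<bar>sin x * cos (real k * x) + cos x * sin (real k * x)\<bar>"
    by (simp add: distrib_right sin_add)
  also have "\<dots> \<le> \<bar>sin x\<bar> * \<bar>cos (real k * x)\<bar> + \<bar>cos x\<bar> * \<bar>sin (real k * x)\<bar>"
    by (metis abs_mult abs_triangle_ineq)
  also have "\<dots> \<le> \<bar>sin x\<bar> * 1 + 1 * \<bar>sin (real k * x)\<bar>"
    by (intro add_mono mult_left_mono mult_right_mono) auto
  finally show ?case using Suc by (simp add: algebra_simps)
qed simp

text \<open>With \<open>t = pi + 2 * u\<close> the difference is \<open>2 * sin (k * u) ^ 2\<close>
  up to sign, which is at most \<open>k ^ 2\<close> times its value for
  \<open>k = 1\<close>.\<close>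

lemma cos_multiple_near_pi: "\<bar>cos (real k * t) - (- 1) ^ k\<bar> \<le> (real k)\<^sup>2 * (1 + cos t)"
proof -
  define u where "u = (t - pi) / 2"
  have "real k * t = 2 * (real k * u) + real k * pi" by (simp add: u_def field_simps)
  then have "cos (real k * t) = (- 1) ^ k * cos (2 * (real k * u))"
    by (simp add: cos_add cos_npi)
  also have "\<dots> = (- 1) ^ k * (1 - 2 * (sin (real k * u))\<^sup>2)" by (simp only: cos_double_sin)
  finally have "\<bar>cos (real k * t) - (- 1) ^ k\<bar> = \<bar>(- 1) ^ k * (2 * (sin (real k * u))\<^sup>2)\<bar>"
    by (simp add: algebra_simps)
  also have "\<dots> = 2 * \<bar>sin (real k * u)\<bar>\<^sup>2" by (simp add: abs_mult)
  also have "\<dots> \<le> 2 * (real k * \<bar>sin u\<bar>)\<^sup>2"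
    by (intro mult_left_mono power_mono abs_sin_multiple) auto
  also have "\<dots> = (real k)\<^sup>2 * (2 * (sin u)\<^sup>2)" by (simp add: power_mult_distrib)
  also have "2 * (sin u)\<^sup>2 = 1 - cos (2 * u)" by (simp only: cos_double_sin)
  also have "2 * u = t - pi" by (simp add: u_def)
  also have "cos (t - pi) = - cos t" by simp
  finally show ?thesis by simp
qed

lemma Re_of_real_mult: "Re (of_real r * w) = r * Re w"
  by simp

lemma pev_near_pi:
  "\<bar>Re (cis (real k * t) * pev (cis t) xs) - Re ((- 1) ^ k * pev (- 1) xs)\<bar> \<le> (1 + cos t) * of_int (pwnorm (int k) xs)"
proof (induction xs arbitrary: k)
  case (Cons x xs)
  have e: "cis (real k * t) * pev (cis t) (x # xs) = of_real (of_int x) * cis (real k * t) + cis (real (Suc k) * t) * pev (cis t) xs"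
    by (simp add: cis_mult algebra_simps)
  have f: "(- 1) ^ k * pev (- 1) (x # xs) = of_real (of_int x * (- 1) ^ k) + (- 1) ^ Suc k * pev (- 1) xs"
    by (simp add: algebra_simps)
  have "\<bar>of_int x * cos (real k * t) - of_int x * (- 1) ^ k\<bar> = \<bar>of_int x\<bar> * \<bar>cos (real k * t) - (- 1) ^ k\<bar>"
    by (simp add: right_diff_distrib[symmetric] abs_mult)
  also have "\<dots> \<le> \<bar>of_int x\<bar> * ((real k)\<^sup>2 * (1 + cos t))"
    by (intro mult_left_mono cos_multiple_near_pi) auto
  finally have 1: "\<bar>of_int x * cos (real k * t) - of_int x * (- 1) ^ k\<bar> \<le> (1 + cos t) * (real k * real k * \<bar>of_int x\<bar>)"
    by (simp add: mult_ac power2_eq_square)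
  have "Re (cis (real k * t) * pev (cis t) (x # xs)) - Re ((- 1) ^ k * pev (- 1) (x # xs)) =
     (of_int x * cos (real k * t) - of_int x * (- 1) ^ k) +
     (Re (cis (real (Suc k) * t) * pev (cis t) xs) - Re ((- 1) ^ Suc k * pev (- 1) xs))"
    unfolding e f plus_complex.simps Re_complex_of_real Re_of_real_mult cis.sel by simp
  then show ?case using 1 Cons[of "Suc k"] by (simp add: algebra_simps)
qed simp

lemma cheb_near_2:
  assumes "0 \<le> t" "t \<le> 2" "pwnorm 0 a \<le> c"
  shows "\<bar>cheb a t - cheb a 2\<bar> \<le> (2 - t) * (of_int c / 2 ^ 46)"
proof -
  have c: "cos (arccos (1 - t)) = 1 - t" using assms by (simp add: cos_arccos)
  have "\<bar>Re (pev (cis (arccos (1 - t))) a) - Re (pev (- 1) a)\<bar> \<le> (2 - t) * of_int (pwnorm 0 a)"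
    using pev_near_pi[of 0 "arccos (1 - t)" a] unfolding c by simp
  also have "\<dots> \<le> (2 - t) * of_int c" using assms by (intro mult_left_mono) auto
  finally show ?thesis
    by (simp add: cheb_def diff_divide_distrib[symmetric] abs_divide divide_right_mono)
qed

section \<open>The vector field and its symmetries\<close>

definition isq :: "real \<Rightarrow> real" where "isq r = 1 / sqrt r"

lemma DERIV_isq [derivative_intros]:
  assumes "(f has_real_derivative d) (at t within S)" "f t > 0"
  shows "((\<lambda>t. isq (f t)) has_real_derivative (- (isq (f t) ^ 3 * d / 2))) (at t within S)"
  unfolding isq_def using assms
  by (auto intro!: derivative_eq_intros simp: field_simps power3_eq_cube)

definition r2 :: "real \<Rightarrow> real \<Rightarrow> real" where "r2 a b = isq (a^2 + b^2)"
definition r3 :: "real \<Rightarrow> real \<Rightarrow> real \<Rightarrow> real" where "r3 a b c = isq (a^2 + b^2 + c^2)"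

lemma r2_commute: "r2 a b = r2 b a"
  by (simp add: r2_def add.commute)

lemma r3_commute: "r3 a b c = r3 b a c" "r3 a b c = r3 a c b"
  by (simp_all add: r3_def add_ac)

lemma DERIV_r2:
  assumes "(a has_real_derivative a') (at t)" "(b has_real_derivative b') (at t)"
    "(a t)^2 + (b t)^2 > 0"
  shows "((\<lambda>t. r2 (a t) (b t)) has_real_derivative (- (r2 (a t) (b t) ^ 3 * (a t * a' + b t * b')))) (at t)"
  unfolding r2_def using assms by (auto intro!: derivative_eq_intros simp: field_simps)

lemma DERIV_r3:
  assumes "(a has_real_derivative a') (at t)" "(b has_real_derivative b') (at t)"
    "(c has_real_derivative c') (at t)" "(a t)^2 + (b t)^2 + (c t)^2 > 0"
  shows "((\<lambda>t. r3 (a t) (b t) (c t)) has_real_derivative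
      (- (r3 (a t) (b t) (c t) ^ 3 * (a t * a' + b t * b' + c t * c')))) (at t)"
  unfolding r3_def using assms by (auto intro!: derivative_eq_intros simp: field_simps)

text \<open>Derivatives of inverse distances: \<open>- a * cub a b c\<close> is the derivative of
  \<open>pot a b c\<close> in \<open>a\<close>, and \<open>- 3 * a * quin a b c\<close> is that of
  \<open>cub a b c\<close>.\<close>

definition cub :: "real \<Rightarrow> real \<Rightarrow> real \<Rightarrow> real" where
  "cub a b c = r3 a b c ^ 3 + r2 a b ^ 3 + r2 a c ^ 3"
definition quin :: "real \<Rightarrow> real \<Rightarrow> real \<Rightarrow> real" where
  "quin a b c = r3 a b c ^ 5 + r2 a b ^ 5 + r2 a c ^ 5"
text \<open>In the scaled squares each quotient of \<open>Gam\<close> is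
  \<open>Q1^2 * Q2^2 * Q3^2 / 4\<close> times an inverse distance \<open>r3\<close> or
  \<open>r2\<close>. The energy term for \<open>E = - 1\<close> is four of the same units with the
  opposite sign, hence the constant 4.\<close>

definition pot :: "real \<Rightarrow> real \<Rightarrow> real \<Rightarrow> real" where
  "pot a b c = r3 a b c + r2 a b + r2 a c + r2 b c - 4"
text \<open>The derivative in \<open>a\<close> of \<open>u * b * c + v * a * c + w * a * b - 2 * a *
  b * c * pot a b c\<close>, which is \<open>Gam (- 1)\<close> divided by 64.\<close>

definition slope :: "real \<Rightarrow> real \<Rightarrow> real \<Rightarrow> real \<Rightarrow> real \<Rightarrow> real" where
  "slope a b c v w = v * c + w * b - 2 * (b * c * (pot a b c - a^2 * cub a b c))"
text \<open>\<open>slope\<close> plus \<open>2 * a\<close> times its derivative in \<open>a\<close>.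
  This is the derivative of \<open>X * slope\<close> in \<open>X\<close> when
  \<open>a = X ^ 2 / 8\<close>.\<close>

definition curv :: "real \<Rightarrow> real \<Rightarrow> real \<Rightarrow> real \<Rightarrow> real \<Rightarrow> real" where
  "curv a b c v w = slope a b c v w + 12 * (a * (a * b * c) * (cub a b c - a^2 * quin a b c))"
text \<open>The derivative of \<open>slope\<close> in \<open>b\<close>, arranged so that the
  symmetry in \<open>a\<close> and \<open>b\<close> is visible.\<close>

definition mixed :: "real \<Rightarrow> real \<Rightarrow> real \<Rightarrow> real \<Rightarrow> real" where
  "mixed a b c w = w - 2 * (c * (pot a b c - a^2 * cub a b c - b^2 * cub b a c))
     - 6 * (a * b * c * (a * b) * (r3 a b c ^ 5 + r2 a b ^ 5))"

definition ph :: "real \<Rightarrow> real \<Rightarrow> real \<Rightarrow> real \<Rightarrow> real \<Rightarrow> real \<Rightarrow> phase" where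
  "ph a b c d e f = state (vector [a, b, c]) (vector [d, e, f])"

lemma ph_nth [simp]:
  "ph a b c d e f $ Inl 1 = a" "ph a b c d e f $ Inl 2 = b" "ph a b c d e f $ Inl 3 = c"
  "ph a b c d e f $ Inr 1 = d" "ph a b c d e f $ Inr 2 = e" "ph a b c d e f $ Inr 3 = f"
  by (simp_all add: ph_def state_def)

lemma all_phase: "(\<forall>k :: 3 + 3. R k) \<longleftrightarrow>
    R (Inl 1) \<and> R (Inl 2) \<and> R (Inl 3) \<and> R (Inr 1) \<and> R (Inr 2) \<and> R (Inr 3)"
  unfolding split_sum_all forall_3 by blast

lemma UNIV_phase: "(UNIV :: (3 + 3) set) = {Inl 1, Inl 2, Inl 3, Inr 1, Inr 2, Inr 3}"
  unfolding UNIV_sum UNIV_3 by auto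

lemma sum_phase: "(\<Sum>k \<in> UNIV. g (k :: 3 + 3)) =
    g (Inl 1) + g (Inl 2) + g (Inl 3) + g (Inr 1) + g (Inr 2) + (g (Inr 3) :: 'a :: comm_monoid_add)"
  unfolding UNIV_phase by (simp add: add_ac)

lemma phase_eq_iff: "x = (y :: phase) \<longleftrightarrow> x $ Inl 1 = y $ Inl 1 \<and> x $ Inl 2 = y $ Inl 2 \<and>
    x $ Inl 3 = y $ Inl 3 \<and> x $ Inr 1 = y $ Inr 1 \<and> x $ Inr 2 = y $ Inr 2 \<and> x $ Inr 3 = y $ Inr 3"
  unfolding vec_eq_iff all_phase ..

text \<open>The divisor 8 brings the squares to order one along the orbit and, being a power of two,
  is a mere shift in the integer arithmetic. The 2 in \<open>pp\<close> absorbs the terms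
  \<open>- 2 * Q2^2 * Q3^2\<close> and their permutations.\<close>

abbreviation (input) qq :: "phase \<Rightarrow> 3 \<Rightarrow> real" where "qq x i \<equiv> (x $ Inl i)^2 / 8"
abbreviation (input) pp :: "phase \<Rightarrow> 3 \<Rightarrow> real" where "pp x i \<equiv> (x $ Inr i)^2 - 2"

definition field :: "phase \<Rightarrow> phase" where
  "field x = ph
     (128 * (x $ Inr 1 * (qq x 2 * qq x 3)))
     (128 * (x $ Inr 2 * (qq x 1 * qq x 3)))
     (128 * (x $ Inr 3 * (qq x 1 * qq x 2)))
     (- (16 * (x $ Inl 1 * slope (qq x 1) (qq x 2) (qq x 3) (pp x 2) (pp x 3))))
     (- (16 * (x $ Inl 2 * slope (qq x 2) (qq x 1) (qq x 3) (pp x 1) (pp x 3))))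
     (- (16 * (x $ Inl 3 * slope (qq x 3) (qq x 1) (qq x 2) (pp x 1) (pp x 2))))"

text \<open>\<open>cP\<close>, \<open>cQ\<close>, \<open>cD\<close> and \<open>cM\<close> are the
  nonzero second derivatives of \<open>Gam (- 1)\<close>: \<open>cP x j k\<close> in the remaining
  momentum twice, \<open>cQ x i j k\<close> in \<open>P\<close> of index \<open>i\<close> and
  \<open>Q\<close> of index \<open>j\<close>, \<open>cD x i j k\<close> in \<open>Q\<close> of index
  \<open>i\<close> twice, \<open>cM x i j k\<close> in \<open>Q\<close> of indices \<open>i\<close>
  and \<open>j\<close>.\<close>

definition cP :: "phase \<Rightarrow> 3 \<Rightarrow> 3 \<Rightarrow> real" where "cP x j k = 128 * (qq x j * qq x k)"
definition cQ :: "phase \<Rightarrow> 3 \<Rightarrow> 3 \<Rightarrow> 3 \<Rightarrow> real" where "cQ x i j k = 32 * (x $ Inr i * (x $ Inl j * qq x k))"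
definition cD :: "phase \<Rightarrow> 3 \<Rightarrow> 3 \<Rightarrow> 3 \<Rightarrow> real" where
  "cD x i j k = 16 * curv (qq x i) (qq x j) (qq x k) (pp x j) (pp x k)"
definition cM :: "phase \<Rightarrow> 3 \<Rightarrow> 3 \<Rightarrow> 3 \<Rightarrow> real" where
  "cM x i j k = 4 * (x $ Inl i * x $ Inl j * mixed (qq x i) (qq x j) (qq x k) (pp x k))"

definition dfield :: "phase \<Rightarrow> phase \<Rightarrow> phase" where
  "dfield x v = ph
     (cQ x 1 2 3 * v $ Inl 2 + cQ x 1 3 2 * v $ Inl 3 + cP x 2 3 * v $ Inr 1)
     (cQ x 2 1 3 * v $ Inl 1 + cQ x 2 3 1 * v $ Inl 3 + cP x 1 3 * v $ Inr 2)
     (cQ x 3 1 2 * v $ Inl 1 + cQ x 3 2 1 * v $ Inl 2 + cP x 1 2 * v $ Inr 3)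
     (- (cD x 1 2 3 * v $ Inl 1 + cM x 1 2 3 * v $ Inl 2 + cM x 1 3 2 * v $ Inl 3
         + cQ x 2 1 3 * v $ Inr 2 + cQ x 3 1 2 * v $ Inr 3))
     (- (cM x 1 2 3 * v $ Inl 1 + cD x 2 1 3 * v $ Inl 2 + cM x 2 3 1 * v $ Inl 3
         + cQ x 1 2 3 * v $ Inr 1 + cQ x 3 2 1 * v $ Inr 3))
     (- (cM x 1 3 2 * v $ Inl 1 + cM x 2 3 1 * v $ Inl 2 + cD x 3 1 2 * v $ Inl 3
         + cQ x 1 3 2 * v $ Inr 1 + cQ x 2 3 1 * v $ Inr 2))"

lemma Gam_domain_iff: "x \<in> Gam_domain \<longleftrightarrow>
    (x $ Inl 1 \<noteq> 0 \<or> x $ Inl 2 \<noteq> 0) \<and> (x $ Inl 1 \<noteq> 0 \<or> x $ Inl 3 \<noteq> 0) \<and> (x $ Inl 2 \<noteq> 0 \<or> x $ Inl 3 \<noteq> 0)"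
proof -
  have "{i :: 3. x $ Inl i = 0} = (if x $ Inl 1 = 0 then {1} else {}) \<union>
      (if x $ Inl 2 = 0 then {2} else {}) \<union> (if x $ Inl 3 = 0 then {3} else {})"
    unfolding set_eq_iff forall_3 by auto
  then show ?thesis unfolding Gam_domain_def by (auto simp: card_insert_if)
qed

lemma DERIV_cub:
  assumes "(a has_real_derivative a') (at t)" "(b has_real_derivative b') (at t)"
    "(c has_real_derivative c') (at t)" "(a t)^2 + (b t)^2 > 0" "(a t)^2 + (c t)^2 > 0"
  shows "((\<lambda>t. cub (a t) (b t) (c t)) has_real_derivative
      (- (3 * (r3 (a t) (b t) (c t) ^ 5 * (a t * a' + b t * b' + c t * c')
        + r2 (a t) (b t) ^ 5 * (a t * a' + b t * b') + r2 (a t) (c t) ^ 5 * (a t * a' + c t * c'))))) (at t)"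
proof -
  have "(a t)^2 + (b t)^2 + (c t)^2 > 0" using assms(4) by (smt (verit) zero_le_power2)
  then show ?thesis unfolding cub_def using assms
    by (auto intro!: derivative_eq_intros DERIV_r2 DERIV_r3 simp: field_simps power_numeral_reduce)
qed

lemma DERIV_slope:
  assumes "(a has_real_derivative a') (at t)" "(b has_real_derivative b') (at t)"
    "(c has_real_derivative c') (at t)" "(v has_real_derivative v') (at t)" "(w has_real_derivative w') (at t)"
    "(a t)^2 + (b t)^2 > 0" "(a t)^2 + (c t)^2 > 0" "(b t)^2 + (c t)^2 > 0"
  shows "((\<lambda>t. slope (a t) (b t) (c t) (v t) (w t)) has_real_derivative
      ((6 * (a t * b t * c t) * (cub (a t) (b t) (c t) - (a t)^2 * quin (a t) (b t) (c t))) * a'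
      + mixed (a t) (b t) (c t) (w t) * b' + mixed (a t) (c t) (b t) (v t) * c'
      + c t * v' + b t * w')) (at t)"
proof -
  have pos: "(a t)^2 + (b t)^2 + (c t)^2 > 0" using assms(6) by (smt (verit) zero_le_power2)
  define A B C V W where "A = a t" "B = b t" "C = c t" "V = v t" "W = w t"
  note eqs = this[symmetric]
  \<comment> \<open>All distances are brought to one order of their arguments, after which only a
    polynomial identity is left to \<open>algebra\<close>.\<close>
  have commute: "r3 B A C = r3 A B C" "r3 C A B = r3 A B C" "r3 A C B = r3 A B C" "r2 B A = r2 A B" "r2 C A = r2 A C"
      "r2 C B = r2 B C" "r3 B C A = r3 A B C" "r3 C B A = r3 A B C"
    by (metis r3_commute r2_commute)+
  show ?thesis unfolding slope_def pot_def
    by (rule derivative_eq_intros DERIV_r2 DERIV_r3 DERIV_cub refl assms pos)+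
      (simp add: eqs, simp add: cub_def quin_def mixed_def pot_def commute, algebra)
qed

lemma pot_commute: "pot b a c = pot a b c" "pot a c b = pot a b c"
  unfolding pot_def by (simp_all add: r3_commute r2_commute)

lemma cub_commute: "cub a c b = cub a b c"
  unfolding cub_def by (simp add: r3_commute)

lemma quin_commute: "quin a c b = quin a b c"
  unfolding quin_def by (simp add: r3_commute)

lemma slope_commute: "slope a c b w v = slope a b c v w"
  unfolding slope_def by (simp add: pot_commute cub_commute mult_ac add_ac)

lemma mixed_commute: "mixed b a c w = mixed a b c w"
  unfolding mixed_def by (simp add: pot_commute r3_commute r2_commute mult_ac)

lemma curv_commute: "curv a c b w v = curv a b c v w"
  unfolding curv_def slope_commute[of a c b w v] cub_commute[of a c b] quin_commute[of a c b]
  by (simp add: mult_ac)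

lemma cM_commute: "cM x j i k = cM x i j k"
  unfolding cM_def by (simp add: mixed_commute mult_ac)

lemma DERIV_field:
  fixes x :: "real \<Rightarrow> phase"
  assumes x: "\<And>k. ((\<lambda>t. x t $ k) has_real_derivative v $ k) (at t)"
    and dom: "x t \<in> Gam_domain"
  shows "((\<lambda>t. field (x t) $ k) has_real_derivative dfield (x t) v $ k) (at t)"
proof -
  have pos: "(qq (x t) i)\<^sup>2 + (qq (x t) j)\<^sup>2 > 0" if "(i, j) \<in> {(1,2),(1,3),(2,3),(2,1),(3,1),(3,2)}" for i j
    using dom that unfolding Gam_domain_iff by (auto simp: sum_power2_gt_zero_iff)
  have dq: "((\<lambda>t. qq (x t) i) has_real_derivative x t $ Inl i * v $ Inl i / 4) (at t)" for i
    by (auto intro!: derivative_eq_intros x)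
  have dp: "((\<lambda>t. pp (x t) i) has_real_derivative 2 * (x t $ Inr i * v $ Inr i)) (at t)" for i
    by (auto intro!: derivative_eq_intros x)
  have P: "((\<lambda>t. 128 * (x t $ Inr i * (qq (x t) j * qq (x t) k))) has_real_derivative
      cQ (x t) i j k * v $ Inl j + cQ (x t) i k j * v $ Inl k + cP (x t) j k * v $ Inr i) (at t)" for i j k
    by (rule DERIV_cong[OF DERIV_cmult[OF DERIV_mult[OF x DERIV_mult[OF dq dq]]]])
      (simp add: cQ_def cP_def algebra_simps)
  \<comment> \<open>The values of \<open>slope\<close> and of its derivatives are free variables
    here, so the radicals do not enter the algebra.\<close>
  have ring: "- (16 * (a * S + (6 * (X\<^sup>2 / 8 * B * C) * (K - (X\<^sup>2 / 8)\<^sup>2 * F) * (X * a / 4) + M * (Y * b / 4) + N * (Z * c / 4)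
          + C * (2 * (p * u)) + B * (2 * (q * w))) * X))
      = - (16 * (S + 12 * (X\<^sup>2 / 8 * (X\<^sup>2 / 8 * B * C) * (K - (X\<^sup>2 / 8)\<^sup>2 * F))) * a + 4 * (X * Y * M) * b
          + 4 * (X * Z * N) * c + 32 * (p * (X * C)) * u + 32 * (q * (X * B)) * w)"
    for X a S B C K F M Y b N Z c p u q w :: real
    by (simp add: field_simps power2_eq_square)
  have Q: "((\<lambda>t. - (16 * (x t $ Inl i * slope (qq (x t) i) (qq (x t) j) (qq (x t) k) (pp (x t) j) (pp (x t) k))))
      has_real_derivative
      - (cD (x t) i j k * v $ Inl i + cM (x t) i j k * v $ Inl j + cM (x t) i k j * v $ Inl k
         + cQ (x t) j i k * v $ Inr j + cQ (x t) k i j * v $ Inr k)) (at t)"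
    if ijk: "(i, j, k) \<in> {(1,2,3),(2,1,3),(3,1,2)}" for i j k
    apply (rule DERIV_cong[OF DERIV_minus[OF DERIV_cmult[OF DERIV_mult[OF x DERIV_slope[OF dq dq dq dp dp]]]]])
    using ijk apply (intro pos; auto)
    using ijk apply (intro pos; auto)
    using ijk apply (intro pos; auto)
    apply (simp only: cD_def cM_def cQ_def curv_def)
    apply (rule ring)
    done
  have "\<forall>k. ((\<lambda>t. field (x t) $ k) has_real_derivative dfield (x t) v $ k) (at t)"
    unfolding all_phase field_def dfield_def ph_nth
    using P[of 1 2 3] P[of 2 1 3] P[of 3 1 2] Q[of 1 2 3] Q[of 2 1 3] Q[of 3 1 2]
    by (simp add: cM_commute[of _ 1 2] cM_commute[of _ 1 3] cM_commute[of _ 2 3] add_ac)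
  then show ?thesis by blast
qed

section \<open>The symplectic form; \<open>field\<close> and \<open>dfield\<close> as gradient and
  Hessian of \<open>Gam\<close>\<close>

definition om :: "phase \<Rightarrow> phase \<Rightarrow> real" where
  "om v w = v $ Inl 1 * w $ Inr 1 + v $ Inl 2 * w $ Inr 2 + v $ Inl 3 * w $ Inr 3
     - v $ Inr 1 * w $ Inl 1 - v $ Inr 2 * w $ Inl 2 - v $ Inr 3 * w $ Inl 3"

text \<open>The coefficient matrix of \<open>dfield\<close> is \<open>J\<close> times a symmetric
  matrix.\<close>

lemma om_dfield: "om (dfield x v) w = - om v (dfield x w)"
  unfolding om_def dfield_def ph_nth by (simp add: algebra_simps)

lemma DERIV_Gam_aux:
  assumes "(a has_real_derivative a') (at t)" "(b has_real_derivative b') (at t)" "(c has_real_derivative c') (at t)"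
    "(u has_real_derivative u') (at t)" "(v has_real_derivative v') (at t)" "(w has_real_derivative w') (at t)"
    "(a t)^2 + (b t)^2 > 0" "(a t)^2 + (c t)^2 > 0" "(b t)^2 + (c t)^2 > 0"
  shows "((\<lambda>t. u t * (b t * c t) + v t * (a t * c t) + w t * (a t * b t)
      - 2 * (a t * b t * c t * pot (a t) (b t) (c t))) has_real_derivative
      (slope (a t) (b t) (c t) (v t) (w t) * a' + slope (b t) (a t) (c t) (u t) (w t) * b'
       + slope (c t) (a t) (b t) (u t) (v t) * c' + b t * c t * u' + a t * c t * v' + a t * b t * w')) (at t)"
proof -
  have pos: "(a t)^2 + (b t)^2 + (c t)^2 > 0" using assms(7) by (smt (verit) zero_le_power2)
  define A B C where "A = a t" "B = b t" "C = c t"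
  note eqs = this[symmetric]
  have commute: "r3 B A C = r3 A B C" "r3 C A B = r3 A B C" "r2 B A = r2 A B" "r2 C A = r2 A C" "r2 C B = r2 B C"
    by (metis r3_commute r2_commute)+
  show ?thesis unfolding pot_def
    by (rule derivative_eq_intros DERIV_r2 DERIV_r3 refl assms pos)+
      (simp add: eqs, simp add: slope_def cub_def pot_def commute, algebra)
qed

lemma Gam_eq:
  "Gam (- 1) x = 64 * (pp x 1 * (qq x 2 * qq x 3) + pp x 2 * (qq x 1 * qq x 3) + pp x 3 * (qq x 1 * qq x 2)
     - 2 * (qq x 1 * qq x 2 * qq x 3 * pot (qq x 1) (qq x 2) (qq x 3)))"
proof -
  have s: "isq (r / 64) = 8 / sqrt r" for r by (simp add: isq_def real_sqrt_divide)
  have "r2 (a^2/8) (b^2/8) = 8 / sqrt (a^4 + b^4)" for a b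
    unfolding r2_def by (subst s[symmetric]) (simp add: power_divide add_divide_distrib)
  moreover have "r3 (a^2/8) (b^2/8) (c^2/8) = 8 / sqrt (a^4 + b^4 + c^4)" for a b c
    unfolding r3_def by (subst s[symmetric]) (simp add: power_divide add_divide_distrib)
  ultimately show ?thesis
    unfolding Gam_def Let_def pot_def by (simp add: algebra_simps add_divide_distrib diff_divide_distrib)
qed

lemma DERIV_Gam:
  fixes x :: "real \<Rightarrow> phase"
  assumes x: "\<And>k. ((\<lambda>t. x t $ k) has_real_derivative v $ k) (at t)"
    and dom: "x t \<in> Gam_domain"
  shows "((\<lambda>t. Gam (- 1) (x t)) has_real_derivative om (field (x t)) v) (at t)"
proof -
  have pos: "(qq (x t) i)\<^sup>2 + (qq (x t) j)\<^sup>2 > 0" if "(i, j) \<in> {(1,2),(1,3),(2,3),(2,1),(3,1),(3,2)}" for i j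
    using dom that unfolding Gam_domain_iff by (auto simp: sum_power2_gt_zero_iff)
  have dq: "((\<lambda>t. qq (x t) i) has_real_derivative x t $ Inl i * v $ Inl i / 4) (at t)" for i
    by (auto intro!: derivative_eq_intros x)
  have dp: "((\<lambda>t. pp (x t) i) has_real_derivative 2 * (x t $ Inr i * v $ Inr i)) (at t)" for i
    by (auto intro!: derivative_eq_intros x)
  show ?thesis unfolding Gam_eq
    by (rule DERIV_cong[OF DERIV_cmult[OF DERIV_Gam_aux[OF dq dq dq dp dp dp pos pos pos]]])
      (simp_all add: om_def field_def algebra_simps)
qed

lemma open_Gam_domain: "open Gam_domain"
proof -
  have "Gam_domain = {x. x $ Inl 1 \<noteq> 0 \<or> x $ Inl 2 \<noteq> 0} \<inter> {x. x $ Inl 1 \<noteq> 0 \<or> x $ Inl 3 \<noteq> 0}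
      \<inter> {x. x $ Inl 2 \<noteq> 0 \<or> x $ Inl 3 \<noteq> (0 :: real)}"
    using Gam_domain_iff by blast
  also have "open \<dots>"
    by (intro open_Int open_Collect_disj open_Collect_neq continuous_intros)
  finally show ?thesis .
qed

lemma DERIV_line: "((\<lambda>t. (x + t *\<^sub>R v) $ k) has_real_derivative (v :: real ^ 'n) $ k) (at t)"
  by (auto intro!: derivative_eq_intros)

lemma partial_Gam:
  assumes "x \<in> Gam_domain"
  shows "partial (Inr i) (Gam (- 1)) x = field x $ Inl i" "partial (Inl i) (Gam (- 1)) x = - field x $ Inr i"
proof -
  have "partial k (Gam (- 1)) x = om (field x) (axis k 1)" for k
    unfolding partial_def
    by (rule DERIV_imp_deriv) (use DERIV_Gam[where t = 0, OF DERIV_line[of x "axis k 1"]] assms in simp)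
  then have "\<forall>i. partial (Inr i) (Gam (- 1)) x = field x $ Inl i \<and> partial (Inl i) (Gam (- 1)) x = - field x $ Inr i"
    unfolding forall_3 by (simp add: om_def axis_def)
  then show "partial (Inr i) (Gam (- 1)) x = field x $ Inl i" "partial (Inl i) (Gam (- 1)) x = - field x $ Inr i"
    by blast+
qed

lemma has_real_derivative_phase_iff:
  fixes x :: "real \<Rightarrow> real ^ 'n"
  shows "(\<forall>k. ((\<lambda>t. x t $ k) has_real_derivative v $ k) (at t within S)) \<longleftrightarrow> (x has_vector_derivative v) (at t within S)"
proof -
  have "(x has_vector_derivative v) (at t within S) \<longleftrightarrow>
      (\<forall>k. ((\<lambda>t. x t \<bullet> axis k 1) has_derivative (\<lambda>h. (h *\<^sub>R v) \<bullet> axis k 1)) (at t within S))"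
    unfolding has_vector_derivative_def by (subst has_derivative_componentwise_within) (auto simp: Basis_vec_def)
  then show ?thesis
    by (simp add: inner_axis has_field_derivative_def mult_commute_abs)
qed

lemma Gam_solution_iff:
  "Gam_solution (- 1) \<gamma> \<longleftrightarrow> (\<forall>s. \<gamma> s \<in> Gam_domain \<and> (\<gamma> has_vector_derivative field (\<gamma> s)) (at s))"
  unfolding Gam_solution_def has_real_derivative_phase_iff[symmetric] split_sum_all
  by (intro all_cong1 conj_cong refl) (simp add: partial_Gam all_conj_distrib)

lemma partial_partial_Gam:
  assumes "x \<in> Gam_domain"
  shows "partial k (partial (Inr i) (Gam (- 1))) x = dfield x (axis k 1) $ Inl i"
    "partial k (partial (Inl i) (Gam (- 1))) x = - dfield x (axis k 1) $ Inr i"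
proof -
  let ?l = "\<lambda>t. x + t *\<^sub>R axis k (1 :: real)"
  \<comment> \<open>\<open>partial_Gam\<close> holds on the domain only; openness provides it for
    all small \<open>t\<close>, which is enough to differentiate the identity.\<close>
  have ev: "eventually (\<lambda>t. ?l t \<in> Gam_domain) (nhds 0)"
  proof -
    have "(?l \<longlongrightarrow> x + 0 *\<^sub>R axis k 1) (nhds 0)"
      by (intro tendsto_intros filterlim_ident)
    then show ?thesis
      using open_Gam_domain assms by (auto intro: topological_tendstoD)
  qed
  have D: "((\<lambda>t. field (?l t) $ j) has_real_derivative dfield x (axis k 1) $ j) (at 0)" for j
    using DERIV_field[where t = 0, OF DERIV_line[of x "axis k 1"]] assms by simp
  show "partial k (partial (Inr i) (Gam (- 1))) x = dfield x (axis k 1) $ Inl i"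
    unfolding partial_def[of k]
    by (rule DERIV_imp_deriv, subst DERIV_cong_ev[OF refl _ refl], rule eventually_mono[OF ev], erule partial_Gam, rule D)
  show "partial k (partial (Inl i) (Gam (- 1))) x = - dfield x (axis k 1) $ Inr i"
    unfolding partial_def[of k]
    by (rule DERIV_imp_deriv, subst DERIV_cong_ev[OF refl _ refl], rule eventually_mono[OF ev], erule partial_Gam,
        rule DERIV_minus[OF D])
qed

lemma om_axis: "om v (axis (Inr i) 1) = v $ Inl i" "om v (axis (Inl i) 1) = - v $ Inr i"
    "om (axis (Inr i) 1) v = - v $ Inl i" "om (axis (Inl i) 1) v = v $ Inr i"
proof -
  have "\<forall>i. om v (axis (Inr i) 1) = v $ Inl i \<and> om v (axis (Inl i) 1) = - v $ Inr i \<and>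
    om (axis (Inr i) 1) v = - v $ Inl i \<and> om (axis (Inl i) 1) v = v $ Inr i"
    unfolding forall_3 by (simp add: om_def axis_def)
  then show "om v (axis (Inr i) 1) = v $ Inl i" "om v (axis (Inl i) 1) = - v $ Inr i"
    "om (axis (Inr i) 1) v = - v $ Inl i" "om (axis (Inl i) 1) v = v $ Inr i" by blast+
qed

lemma linear_dfield: "linear (dfield x)"
  by (rule linearI) (simp_all add: dfield_def phase_eq_iff algebra_simps)

lemma J_hessian:
  assumes "x \<in> Gam_domain"
  shows "(J ** hessian (Gam (- 1)) x) *v v = dfield x v"
proof -
  have "(J ** hessian (Gam (- 1)) x) $ k $ l = dfield x (axis l 1) $ k" for k l
  proof -
    \<comment> \<open>\<open>hessian\<close> takes its outer derivative in the direction of the row,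
      whereas column \<open>l\<close> of the product is the derivative in direction
      \<open>l\<close>; symmetry exchanges the two.\<close>
    have sym: "om (dfield x (axis l 1)) (axis m 1) = om (dfield x (axis m 1)) (axis l 1)" for m
      using om_dfield[of x "axis m 1" "axis l 1"] by (simp add: om_def)
    have H: "hessian (Gam (- 1)) x $ m $ l = om (dfield x (axis m 1)) (axis l 1)" for m
      unfolding hessian_def by (cases l) (simp_all add: partial_partial_Gam[OF assms] om_axis)
    have "(J ** hessian (Gam (- 1)) x) $ Inl i $ l = hessian (Gam (- 1)) x $ Inr i $ l \<and>
        (J ** hessian (Gam (- 1)) x) $ Inr i $ l = - hessian (Gam (- 1)) x $ Inl i $ l" for i
    proof -
      have "\<forall>i. (J ** hessian (Gam (- 1)) x) $ Inl i $ l = hessian (Gam (- 1)) x $ Inr i $ l \<and>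
        (J ** hessian (Gam (- 1)) x) $ Inr i $ l = - hessian (Gam (- 1)) x $ Inl i $ l"
        unfolding forall_3 by (simp add: matrix_matrix_mult_def J_def sum_phase)
      then show ?thesis by blast
    qed
    then show ?thesis
      by (cases k) (simp_all add: H sym[symmetric] om_axis)
  qed
  then have "J ** hessian (Gam (- 1)) x = matrix (dfield x)"
    by (simp add: vec_eq_iff matrix_def)
  then show ?thesis using linear_dfield by (simp add: matrix_works)
qed

section \<open>The time-reversing symmetries and continuity of the field\<close>

definition sg :: "phase \<Rightarrow> phase" where
  "sg x = ph (- x $ Inl 1) (x $ Inl 3) (x $ Inl 2) (x $ Inr 1) (- x $ Inr 3) (- x $ Inr 2)"

definition rh :: "phase \<Rightarrow> phase" where
  "rh x = ph (x $ Inl 2) (x $ Inl 1) (x $ Inl 3) (- x $ Inr 2) (- x $ Inr 1) (- x $ Inr 3)"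

lemma sg_sg [simp]: "sg (sg x) = x" and rh_rh [simp]: "rh (rh x) = x"
  by (simp_all add: sg_def rh_def phase_eq_iff)

lemma linear_sg: "linear sg" and linear_rh: "linear rh"
  by (rule linearI; simp add: sg_def rh_def phase_eq_iff)+

text \<open>Time reversal changes the sign of all momenta. \<open>rh\<close> combines it with the
  exchange of the indices 1 and 2; \<open>sg\<close> with the exchange of 2 and 3 and the sign
  change of \<open>Q1\<close> and \<open>P1\<close>, which restores \<open>P1\<close>. The added
  maps are symplectic, so both combinations reverse the sign of the form.\<close>

lemma om_sg: "om (sg v) w = - om v (sg w)" and om_rh: "om (rh v) w = - om v (rh w)"
  by (simp_all add: om_def sg_def rh_def)

lemma sg_domain: "sg x \<in> Gam_domain \<longleftrightarrow> x \<in> Gam_domain" and rh_domain: "rh x \<in> Gam_domain \<longleftrightarrow> x \<in> Gam_domain"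
  by (auto simp: Gam_domain_iff sg_def rh_def)

lemma field_sg: "field (sg x) = - sg (field x)"
  unfolding phase_eq_iff
  by (simp add: field_def sg_def slope_commute[of "(x $ Inl 1)\<^sup>2 / 8" "(x $ Inl 3)\<^sup>2 / 8"])

lemma field_rh: "field (rh x) = - rh (field x)"
  unfolding phase_eq_iff
  by (simp add: field_def rh_def slope_commute[of "(x $ Inl 3)\<^sup>2 / 8" "(x $ Inl 2)\<^sup>2 / 8"])

lemma dfield_sg: "dfield (sg x) (sg v) = - sg (dfield x v)"
  unfolding phase_eq_iff
  by (simp add: dfield_def sg_def cP_def cQ_def cD_def cM_def mixed_commute[of "(x $ Inl 3)\<^sup>2 / 8" "(x $ Inl 2)\<^sup>2 / 8"]
      curv_commute[of "(x $ Inl 1)\<^sup>2 / 8" "(x $ Inl 3)\<^sup>2 / 8"] algebra_simps)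

lemma dfield_rh: "dfield (rh x) (rh v) = - rh (dfield x v)"
  unfolding phase_eq_iff
  by (simp add: dfield_def rh_def cP_def cQ_def cD_def cM_def mixed_commute[of "(x $ Inl 2)\<^sup>2 / 8" "(x $ Inl 1)\<^sup>2 / 8"]
      curv_commute[of "(x $ Inl 3)\<^sup>2 / 8" "(x $ Inl 2)\<^sup>2 / 8"] algebra_simps)

lemma continuous_on_r2:
  assumes "continuous_on S a" "continuous_on S b" "\<And>x. x \<in> S \<Longrightarrow> (a x)^2 + (b x)^2 \<noteq> 0"
  shows "continuous_on S (\<lambda>x. r2 (a x) (b x))"
  unfolding r2_def isq_def using assms by (intro continuous_intros) auto

lemma continuous_on_r3:
  assumes "continuous_on S a" "continuous_on S b" "continuous_on S c" "\<And>x. x \<in> S \<Longrightarrow> (a x)^2 + (b x)^2 + (c x)^2 \<noteq> 0"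
  shows "continuous_on S (\<lambda>x. r3 (a x) (b x) (c x))"
  unfolding r3_def isq_def using assms by (intro continuous_intros) auto

lemma continuous_on_phase:
  fixes f :: "'a :: topological_space \<Rightarrow> phase"
  assumes "\<And>k. continuous_on S (\<lambda>x. f x $ k)"
  shows "continuous_on S f"
  using continuous_on_vec_lambda[of S "\<lambda>k x. f x $ k"] assms by simp

lemma continuous_on_field: "continuous_on Gam_domain field"
  and continuous_on_dfield: "continuous_on Gam_domain (\<lambda>x. dfield x v)"
proof -
  have pos: "(qq x i)\<^sup>2 + (qq x j)\<^sup>2 \<noteq> 0" if "x \<in> Gam_domain" "(i, j) \<in> {(1,2),(1,3),(2,3),(2,1),(3,1),(3,2)}" for x i j
    using that unfolding Gam_domain_iff by (auto simp: sum_power2_eq_zero_iff)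
  have pos3: "(qq x i)\<^sup>2 + (qq x j)\<^sup>2 + (qq x k)\<^sup>2 \<noteq> 0" if "x \<in> Gam_domain" "(i, j) \<in> {(1,2),(1,3),(2,3),(2,1),(3,1),(3,2)}" for x i j k
    using pos[OF that] by (smt (verit) zero_le_power2)
  note ci = continuous_intros continuous_on_r2 continuous_on_r3 pos pos3
  have "\<forall>k. continuous_on Gam_domain (\<lambda>x. field x $ k)"
    unfolding all_phase field_def ph_nth slope_def pot_def cub_def
    by (intro conjI ci) auto
  then show "continuous_on Gam_domain field" by (blast intro: continuous_on_phase)
  have "\<forall>k. continuous_on Gam_domain (\<lambda>x. dfield x v $ k)"
    unfolding all_phase dfield_def ph_nth cP_def cQ_def cD_def cM_def mixed_def curv_def quin_def slope_def pot_def cub_def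
    by (intro conjI ci) auto
  then show "continuous_on Gam_domain (\<lambda>x. dfield x v)" by (blast intro: continuous_on_phase)
qed

section \<open>Extension by the symmetries\<close>

lemma has_vector_derivative_within_Un:
  assumes "(f has_vector_derivative d) (at t within A)" "(f has_vector_derivative d) (at t within B)"
  shows "(f has_vector_derivative d) (at t within (A \<union> B))"
  using assms unfolding has_vector_derivative_def has_derivative_within
  by (auto simp: at_within_union intro: filterlim_sup)

lemma has_vector_derivative_isolated:
  assumes "closed S" "t \<notin> S"
  shows "(f has_vector_derivative d) (at t within S)"
proof -
  have "at t within S = bot" using assms by (simp add: at_within_eq_bot_iff)
  then show ?thesis by (simp add: has_vector_derivative_def has_derivative_def bounded_linear_scaleR_left)
qed

definition turn :: "phase \<Rightarrow> phase" where "turn x = rh (sg x)"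

lemma linear_turn: "linear turn"
  using linear_compose[OF linear_sg linear_rh] by (simp add: turn_def[abs_def] o_def)

lemma linear_rh_sg_minus: "rh (- x) = - rh x" "sg (- x) = - sg x"
  using linear_neg[OF linear_rh] linear_neg[OF linear_sg] by auto

lemma field_turn: "field (turn x) = turn (field x)"
  by (simp add: turn_def field_rh field_sg linear_rh_sg_minus)

lemma dfield_turn: "dfield (turn x) (turn v) = turn (dfield x v)"
  by (simp add: turn_def dfield_rh dfield_sg linear_rh_sg_minus)

lemma turn_domain: "turn x \<in> Gam_domain \<longleftrightarrow> x \<in> Gam_domain"
  by (simp add: turn_def rh_domain sg_domain)

lemma turn_6: "(turn ^^ 6) x = x"
  by (simp add: numeral_eq_Suc turn_def rh_def sg_def phase_eq_iff)

text \<open>Reduction modulo 6 gives a meaning to negative exponents, so that one formula covers the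
  intervals in both directions of time.\<close>

definition turns :: "int \<Rightarrow> phase \<Rightarrow> phase" where "turns k = turn ^^ nat (k mod 6)"

lemma turns_Suc: "turns (k + 1) x = turn (turns k x)" "turns (k + 1) x = turns k (turn x)"
proof -
  have k: "nat ((k + 1) mod 6) = (if k mod 6 = 5 then 0 else Suc (nat (k mod 6)))"
  proof -
    have "0 \<le> k mod 6" "k mod 6 < 6" by simp_all
    moreover have "(k + 1) mod 6 = (if k mod 6 = 5 then 0 else k mod 6 + 1)" by presburger
    ultimately show ?thesis by (simp add: Suc_nat_eq_nat_zadd1 add.commute)
  qed
  show 1: "turns (k + 1) x = turn (turns k x)"
  proof (cases "k mod 6 = 5")
    case True
    have "turn ((turn ^^ 5) x) = (turn ^^ 6) x" by (simp add: numeral_eq_Suc)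
    then show ?thesis using True k turn_6 by (simp add: turns_def)
  qed (simp add: turns_def k)
  then show "turns (k + 1) x = turns k (turn x)" by (simp add: turns_def funpow_swap1)
qed

lemma funpow_props:
  "linear (turn ^^ n)" "field ((turn ^^ n) x) = (turn ^^ n) (field x)" "(turn ^^ n) x \<in> Gam_domain \<longleftrightarrow> x \<in> Gam_domain"
proof -
  show "linear (turn ^^ n)"
  proof (induction n)
    case 0 show ?case using linear_id by (simp add: id_def[symmetric])
  next
    case (Suc n) show ?case using linear_compose[OF Suc linear_turn] by (simp add: o_def)
  qed
  show "field ((turn ^^ n) x) = (turn ^^ n) (field x)" by (induction n) (simp_all add: field_turn)
  show "(turn ^^ n) x \<in> Gam_domain \<longleftrightarrow> x \<in> Gam_domain" by (induction n) (simp_all add: turn_domain)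
qed

lemma reversed_derivative:
  fixes g :: "real \<Rightarrow> phase" and R :: "phase \<Rightarrow> phase"
  assumes "(g has_vector_derivative d) (at (c - s) within B)" "linear R" "\<And>u. u \<in> A \<Longrightarrow> c - u \<in> B"
  shows "((\<lambda>s. R (g (c - s))) has_vector_derivative - R d) (at s within A)"
proof -
  have "((\<lambda>s. c - s) has_vector_derivative - 1) (at s within A)" by (auto intro!: derivative_eq_intros)
  moreover have "(g has_vector_derivative d) (at (c - s) within (\<lambda>s. c - s) ` A)"
    by (rule has_vector_derivative_within_subset[OF assms(1)]) (use assms(3) in auto)
  ultimately have "((g \<circ> (\<lambda>s. c - s)) has_vector_derivative - 1 *\<^sub>R d) (at s within A)"
    by (rule vector_diff_chain_within)
  from bounded_linear.has_vector_derivative[OF _ this, of R] show ?thesis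
    using assms(2) by (simp add: o_def linear_conv_bounded_linear linear_neg)
qed

lemma shifted_derivative:
  fixes g :: "real \<Rightarrow> phase" and R :: "phase \<Rightarrow> phase"
  assumes "(g has_vector_derivative d) (at (s - c) within B)" "linear R" "\<And>u. u \<in> A \<Longrightarrow> u - c \<in> B"
  shows "((\<lambda>s. R (g (s - c))) has_vector_derivative R d) (at s within A)"
proof -
  have "((\<lambda>s. s - c) has_vector_derivative 1) (at s within A)" by (auto intro!: derivative_eq_intros)
  moreover have "(g has_vector_derivative d) (at (s - c) within (\<lambda>s. s - c) ` A)"
    by (rule has_vector_derivative_within_subset[OF assms(1)]) (use assms(3) in auto)
  ultimately have "((g \<circ> (\<lambda>s. s - c)) has_vector_derivative 1 *\<^sub>R d) (at s within A)"
    by (rule vector_diff_chain_within)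
  from bounded_linear.has_vector_derivative[OF _ this, of R] show ?thesis
    using assms(2) by (simp add: o_def linear_conv_bounded_linear)
qed

lemma symmetric_extension:
  fixes g :: "real \<Rightarrow> phase"
  assumes \<tau>: "\<tau> > 0"
    and g: "\<And>s. s \<in> {0..\<tau>} \<Longrightarrow> (g has_vector_derivative field (g s)) (at s within {0..\<tau>})"
    and dom: "\<And>s. s \<in> {0..\<tau>} \<Longrightarrow> g s \<in> Gam_domain"
    and sg: "sg (g 0) = g 0" and rh: "rh (g \<tau>) = g \<tau>"
  shows "\<exists>\<gamma>. (\<forall>s. \<gamma> s \<in> Gam_domain \<and> (\<gamma> has_vector_derivative field (\<gamma> s)) (at s)) \<and>
    (\<forall>s\<in>{0..\<tau>}. \<gamma> s = g s) \<and> (\<forall>s. \<gamma> (s + 2 * \<tau>) = turn (\<gamma> s)) \<and> (\<forall>s\<in>{0..2 * \<tau>}. \<gamma> (2 * \<tau> - s) = rh (\<gamma> s))"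
proof -
  define g1 where "g1 s = (if s \<ge> 0 then g s else sg (g (- s)))" for s
  have g1_neg: "g1 s = sg (g (- s))" if "s \<le> 0" for s using that sg by (cases "s = 0") (auto simp: g1_def)
  have g1_dom: "g1 s \<in> Gam_domain" if "s \<in> {- \<tau>..\<tau>}" for s
    using that dom[of s] dom[of "- s"] by (auto simp: g1_def sg_domain)
  \<comment> \<open>The one-sided derivatives at 0 agree because \<open>sg (g 0) = g 0\<close> and
    \<open>field (sg x) = - sg (field x)\<close>.\<close>
  have g1: "(g1 has_vector_derivative field (g1 s)) (at s within {- \<tau>..\<tau>})" if s: "s \<in> {- \<tau>..\<tau>}" for s
  proof -
    have "(g1 has_vector_derivative field (g1 s)) (at s within {0..\<tau>})"
    proof (cases "s \<ge> 0")
      case True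
      have "(g1 has_vector_derivative field (g s)) (at s within {0..\<tau>})"
        by (rule has_vector_derivative_transform[OF _ _ g]) (use True s in \<open>auto simp: g1_def\<close>)
      then show ?thesis using True by (simp add: g1_def)
    qed (auto intro: has_vector_derivative_isolated)
    moreover have "(g1 has_vector_derivative field (g1 s)) (at s within {- \<tau>..0})"
    proof (cases "s \<le> 0")
      case True
      have "((\<lambda>s. sg (g (0 - s))) has_vector_derivative - sg (field (g (- s)))) (at s within {- \<tau>..0})"
        by (rule reversed_derivative[where B = "{0..\<tau>}"]) (use g[of "- s"] True s linear_sg in auto)
      then have "((\<lambda>s. sg (g (0 - s))) has_vector_derivative field (g1 s)) (at s within {- \<tau>..0})"
        by (simp add: g1_neg[OF True] field_sg)
      then show ?thesis
        by (rule has_vector_derivative_transform[OF _ _, rotated 2]) (use True s in \<open>auto simp: g1_neg\<close>)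
    qed (auto intro: has_vector_derivative_isolated)
    ultimately have "(g1 has_vector_derivative field (g1 s)) (at s within ({0..\<tau>} \<union> {- \<tau>..0}))"
      by (rule has_vector_derivative_within_Un)
    moreover have "{0..\<tau>} \<union> {- \<tau>..0} = {- \<tau>..\<tau>}" using \<tau> by auto
    ultimately show ?thesis by simp
  qed
  \<comment> \<open>The matching condition for consecutive copies at their common end point; this is
    where invariance of \<open>g \<tau>\<close> under \<open>rh\<close> enters.\<close>
  have turn_end: "turn (g1 (- \<tau>)) = g1 \<tau>"
    using \<tau> rh by (simp add: g1_def turn_def)
  define idx where "idx s = \<lfloor>(s + \<tau>) / (2 * \<tau>)\<rfloor>" for s
  define \<gamma> where "\<gamma> s = turns (idx s) (g1 (s - 2 * of_int (idx s) * \<tau>))" for s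
  define I where "I k = {2 * of_int k * \<tau> - \<tau>..2 * of_int k * \<tau> + \<tau>}" for k :: int
  have idx: "idx s = k" if "2 * of_int k * \<tau> - \<tau> \<le> s" "s < 2 * of_int k * \<tau> + \<tau>" for s k
    unfolding idx_def using that \<tau> by (intro floor_unique) (auto simp: field_simps)
  have \<gamma>I: "\<gamma> s = turns k (g1 (s - 2 * of_int k * \<tau>))" if "s \<in> I k" for s k
  proof (cases "s < 2 * of_int k * \<tau> + \<tau>")
    case True
    then show ?thesis using idx[of k s] that by (simp add: \<gamma>_def I_def)
  next
    case False
    then have s: "s = 2 * of_int k * \<tau> + \<tau>" using that by (simp add: I_def)
    then have "idx s = k + 1" using \<tau> by (intro idx) (auto simp: algebra_simps)
    then have "\<gamma> s = turns (k + 1) (g1 (s - 2 * of_int (k + 1) * \<tau>))" by (simp only: \<gamma>_def)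
    also have "s - 2 * of_int (k + 1) * \<tau> = - \<tau>" by (simp add: s algebra_simps)
    finally show ?thesis by (simp only: turns_Suc(2) turn_end) (simp add: s)
  qed
  have inI: "s \<in> I (idx s)" "s < 2 * of_int (idx s) * \<tau> + \<tau>" for s
  proof -
    have "of_int (idx s) \<le> (s + \<tau>) / (2 * \<tau>)" "(s + \<tau>) / (2 * \<tau>) < of_int (idx s) + 1"
      unfolding idx_def by linarith+
    then show "s \<in> I (idx s)" "s < 2 * of_int (idx s) * \<tau> + \<tau>" using \<tau> by (auto simp: I_def field_simps)
  qed
  have \<gamma>_dom: "\<gamma> s \<in> Gam_domain" for s
  proof -
    have "g1 (s - 2 * of_int (idx s) * \<tau>) \<in> Gam_domain" using inI(1)[of s] by (intro g1_dom) (auto simp: I_def)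
    then show ?thesis by (simp add: \<gamma>_def turns_def funpow_props)
  qed
  have \<gamma>_within: "(\<gamma> has_vector_derivative field (\<gamma> s)) (at s within I k)" for s k
  proof (cases "s \<in> I k")
    case True
    have "((\<lambda>s. turns k (g1 (s - 2 * of_int k * \<tau>))) has_vector_derivative turns k (field (g1 (s - 2 * of_int k * \<tau>)))) (at s within I k)"
      by (rule shifted_derivative[where B = "{- \<tau>..\<tau>}"])
        (use True funpow_props(1) in \<open>auto intro!: g1 simp: I_def turns_def\<close>)
    moreover have "turns k (field (g1 (s - 2 * of_int k * \<tau>))) = field (\<gamma> s)"
      using \<gamma>I[OF True] by (simp add: turns_def funpow_props)
    ultimately have "((\<lambda>s. turns k (g1 (s - 2 * of_int k * \<tau>))) has_vector_derivative field (\<gamma> s)) (at s within I k)" by simp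
    then show ?thesis
      by (rule has_vector_derivative_transform[OF _ _, rotated 2]) (use True \<gamma>I in auto)
  qed (auto intro: has_vector_derivative_isolated simp: I_def)
  \<comment> \<open>As \<open>idx\<close> rounds down, \<open>s\<close> may be the left but never
    the right end of \<open>I (idx s)\<close>. This interval and the preceding one therefore cover a
    neighbourhood of \<open>s\<close>.\<close>
  have \<gamma>_deriv: "(\<gamma> has_vector_derivative field (\<gamma> s)) (at s)" for s
  proof (rule has_vector_derivative_glue[OF \<gamma>_within[of s "idx s - 1"] \<gamma>_within[of s "idx s"]])
    show "open {2 * of_int (idx s) * \<tau> - 3 * \<tau><..<2 * of_int (idx s) * \<tau> + \<tau>}" by simp
    show "s \<in> {2 * of_int (idx s) * \<tau> - 3 * \<tau><..<2 * of_int (idx s) * \<tau> + \<tau>}"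
      using inI[of s] \<tau> by (auto simp: I_def)
    show "{2 * of_int (idx s) * \<tau> - 3 * \<tau><..<2 * of_int (idx s) * \<tau> + \<tau>} \<subseteq> I (idx s - 1) \<union> I (idx s)"
      by (auto simp: I_def algebra_simps)
  qed
  have \<gamma>g: "\<gamma> s = g s" if "s \<in> {0..\<tau>}" for s
    using that \<tau> \<gamma>I[of s 0] by (simp add: I_def turns_def g1_def)
  have \<gamma>_turn: "\<gamma> (s + 2 * \<tau>) = turn (\<gamma> s)" for s
  proof -
    have "idx (s + 2 * \<tau>) = idx s + 1"
      using inI[of s] by (intro idx) (auto simp: I_def algebra_simps)
    then have "\<gamma> (s + 2 * \<tau>) = turns (idx s + 1) (g1 (s + 2 * \<tau> - 2 * of_int (idx s + 1) * \<tau>))" by (simp only: \<gamma>_def)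
    also have "s + 2 * \<tau> - 2 * of_int (idx s + 1) * \<tau> = s - 2 * of_int (idx s) * \<tau>" by (simp add: algebra_simps)
    finally show ?thesis by (simp only: turns_Suc(1) \<gamma>_def)
  qed
  \<comment> \<open>On the first half, the reflection \<open>sg\<close> at time 0 followed by the
    shift \<open>turn\<close> amounts to \<open>rh\<close>; the second half follows because
    \<open>rh\<close> is an involution.\<close>
  have rev: "\<gamma> (2 * \<tau> - s) = rh (\<gamma> s)" if s: "s \<in> {0..\<tau>}" for s
  proof -
    have "\<gamma> (- s) = g1 (- s)" using s \<tau> \<gamma>I[of "- s" 0] by (simp add: I_def turns_def)
    then have "\<gamma> (- s) = sg (g s)" using s g1_neg[of "- s"] by simp
    then show ?thesis using \<gamma>_turn[of "- s"] \<gamma>g[OF s] by (simp add: turn_def algebra_simps)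
  qed
  have "\<gamma> (2 * \<tau> - s) = rh (\<gamma> s)" if s: "s \<in> {0..2 * \<tau>}" for s
  proof (cases "s \<le> \<tau>")
    case False
    then show ?thesis using rev[of "2 * \<tau> - s"] s by simp
  qed (use rev s in auto)
  then show ?thesis using \<gamma>_dom \<gamma>_deriv \<gamma>g \<gamma>_turn by (intro exI[of _ \<gamma>]) blast
qed

section \<open>Spectra of reversible matrices\<close>

lemma complex_matrix_mult: "complex_matrix (A ** B) = complex_matrix A ** complex_matrix B"
  by (simp add: complex_matrix_def matrix_matrix_mult_def vec_eq_iff)

lemma complex_matrix_1: "complex_matrix (mat 1) = mat 1"
  by (simp add: complex_matrix_def mat_def vec_eq_iff)

lemma det_complex_matrix: "det (complex_matrix A) = of_real (det A)"
  by (simp add: complex_matrix_def det_def)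

definition cvec :: "real ^ 'n \<Rightarrow> real ^ 'n \<Rightarrow> complex ^ 'n" where
  "cvec p q = (\<chi> i. Complex (p $ i) (q $ i))"

lemma complex_matrix_cvec: "complex_matrix A *v cvec p q = cvec (A *v p) (A *v q)"
  by (simp add: complex_matrix_def cvec_def matrix_vector_mult_def vec_eq_iff complex_eq_iff)

lemma poly_char_poly: "poly (char_poly A) z = det (mat z - A :: complex ^ 'n ^ 'n)"
  unfolding char_poly_def poly_det
  by (intro arg_cong[where f = det]) (simp add: vec_eq_iff mat_def)

lemma degree_char_poly: "degree (char_poly (A :: complex ^ 'n ^ 'n)) \<le> CARD('n)"
proof -
  have prod: "degree (\<Prod>i\<in>S. f i) \<le> card S" if "finite S" "\<And>i. degree (f i) \<le> 1" for S and f :: "'n \<Rightarrow> complex poly"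
    using that(1)
  proof (induction S)
    case (insert x S)
    have "degree (\<Prod>i\<in>insert x S. f i) \<le> degree (f x) + degree (\<Prod>i\<in>S. f i)"
      using insert by (simp add: degree_mult_le)
    then show ?case using insert that(2)[of x] by simp
  qed simp
  have e: "degree ((if i = j then [:0, 1:] else 0) - [:A $ i $ j:]) \<le> 1" for i j
    by (rule degree_diff_le) auto
  have "degree (of_int (sign p) * (\<Prod>i\<in>UNIV. (\<chi> i j. (if i = j then [:0, 1:] else 0) - [:A $ i $ j:]) $ i $ p i)) \<le> CARD('n)" for p
  proof -
    have "degree (of_int (sign p) :: complex poly) = 0" by (simp add: of_int_poly)
    moreover have "degree (\<Prod>i\<in>UNIV. (\<chi> i j. (if i = j then [:0, 1:] else 0) - [:A $ i $ j:]) $ i $ p i) \<le> CARD('n)"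
      by (rule prod) (use e in auto)
    ultimately show ?thesis by (metis (no_types, lifting) add_0 degree_mult_le order_trans)
  qed
  then show ?thesis unfolding char_poly_def det_def by (intro degree_sum_le) (auto simp: finite_permutations)
qed

definition smat :: "complex \<Rightarrow> complex ^ 'n ^ 'n \<Rightarrow> complex ^ 'n ^ 'n" where
  "smat c A = (\<chi> i j. c * A $ i $ j)"

lemma det_smat: "det (smat c A :: complex ^ 'n ^ 'n) = c ^ CARD('n) * det A"
proof -
  have "smat c A = (\<chi> i. c *s A $ i)" by (simp add: vec_eq_iff smat_def)
  then show ?thesis using det_rows_mul[of "\<lambda>_. c" "\<lambda>i. A $ i"] by simp
qed

text \<open>Conjugacy of \<open>N\<close> to its inverse and \<open>det N = 1\<close> in even
  dimension make the characteristic polynomial palindromic, \<open>p z = z ^ 6 * p (1 / z)\<close>.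
  Differentiating at 1 gives \<open>2 * p' 1 = 6 * p 1\<close>, so a zero at 1 is at least
  double.\<close>

lemma pderiv_char_poly_1:
  fixes N N' R :: "complex ^ 'n ^ 'n"
  assumes N: "N ** N' = mat 1" and R: "R ** R = mat 1" "R ** N ** R = N'" and det: "det N = 1"
    and card: "CARD('n) = 6" and root: "poly (char_poly N) 1 = 0"
  shows "poly (pderiv (char_poly N)) 1 = 0"
proof -
  let ?p = "char_poly N"
  have pal: "poly ?p z = z ^ 6 * poly ?p (1 / z)" if z: "z \<noteq> 0" for z
  proof -
    have diff: "X ** (Y - Z) = X ** Y - X ** Z" "(Y - Z) ** X = Y ** X - Z ** X" for X Y Z :: "complex ^ 'n ^ 'n"
      by (simp_all add: matrix_matrix_mult_def vec_eq_iff right_diff_distrib left_diff_distrib sum_subtractf)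
    have matz: "X ** mat c = smat c X" "mat c ** X = smat c X" for X :: "complex ^ 'n ^ 'n" and c
      by (simp_all add: matrix_matrix_mult_def vec_eq_iff mat_def smat_def if_distrib[of "\<lambda>x. _ * x"] if_distrib[of "\<lambda>x. x * _"] cong: if_cong)
    have sm: "smat c X ** Y = smat c (X ** Y)" for X Y :: "complex ^ 'n ^ 'n" and c
      by (simp add: matrix_matrix_mult_def vec_eq_iff smat_def sum_distrib_left mult_ac)
    have smI: "smat c (mat d) = mat (c * d)" for c d
      by (simp add: vec_eq_iff mat_def smat_def)
    have "R ** (mat z - N) ** R = mat z - N'"
      by (simp add: diff matz sm R smI)
    then have "det (mat z - N') = det R * det (mat z - N) * det R" by (metis det_mul)
    moreover have "det R * det R = 1" using R(1) by (metis det_I det_mul)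
    ultimately have 1: "det (mat z - N') = poly ?p z" by (simp add: poly_char_poly mult_ac)
    have "N ** (mat z - N') = smat (- z) (mat (1 / z) - N)"
      using z by (simp add: diff matz N) (simp add: vec_eq_iff smat_def mat_def algebra_simps)
    then have "det N * det (mat z - N') = (- z) ^ CARD('n) * det (mat (1 / z) - N)"
      by (metis det_smat det_mul)
    then show ?thesis using 1 det by (simp add: poly_char_poly card)
  qed
  have "((\<lambda>z. poly ?p z) has_field_derivative poly (pderiv ?p) 1) (at 1)" by (rule poly_DERIV)
  moreover have "((\<lambda>z. poly ?p z) has_field_derivative 6 * poly ?p 1 - poly (pderiv ?p) 1) (at 1)"
  proof -
    have D: "((\<lambda>z. z ^ 6 * poly ?p (1 / z)) has_field_derivative
        6 * poly ?p 1 - poly (pderiv ?p) 1) (at 1)"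
      by (auto intro!: derivative_eq_intros DERIV_chain2[OF poly_DERIV])
    have "eventually (\<lambda>z :: complex. z \<noteq> 0) (nhds 1)"
      by (rule t1_space_nhds) simp
    then have ev: "eventually (\<lambda>z. poly ?p z = z ^ 6 * poly ?p (1 / z)) (nhds 1)"
      by (rule eventually_mono) (rule pal)
    show ?thesis by (rule DERIV_cong_ev[OF refl ev refl, THEN iffD2, OF D])
  qed
  ultimately have "poly (pderiv ?p) 1 = 6 * poly ?p 1 - poly (pderiv ?p) 1" by (rule DERIV_unique)
  then show ?thesis using root by simp
qed

text \<open>The degree leaves no room: order at least 2 at 1 and at least 1 at each of the four
  points of \<open>Z\<close> already exhaust 6.\<close>

lemma orders_of_six_roots:
  fixes p :: "complex poly"
  assumes p0: "p \<noteq> 0" and deg: "degree p \<le> 6" and 1: "poly p 1 = 0" "poly (pderiv p) 1 = 0"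
    and Z: "card Z = 4" "1 \<notin> Z" "\<And>z. z \<in> Z \<Longrightarrow> poly p z = 0"
  shows "order 1 p = 2 \<and> (\<forall>z. poly p z = 0 \<longrightarrow> z = 1 \<or> z \<in> Z \<and> order z p = 1)"
proof -
  let ?R = "{z. poly p z = 0}"
  have fin: "finite ?R" using p0 by (rule poly_roots_finite)
  have o1: "order 1 p \<ge> 2"
  proof (cases "pderiv p = 0")
    case True
    then have "degree p = 0" by (simp add: pderiv_eq_0_iff)
    then obtain c where "p = [:c:]" by (rule degree_eq_zeroE)
    then show ?thesis using 1(1) p0 by simp
  next
    case False
    have "order 1 p = Suc (order 1 (pderiv p))" by (rule order_pderiv[OF p0 1(1)])
    moreover have "order 1 (pderiv p) \<noteq> 0" using 1 False by (simp add: order_root)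
    ultimately show ?thesis by simp
  qed
  have pos: "order z p \<ge> 1" if "z \<in> ?R" for z using that p0 order_root[of p z] by simp
  have sum: "(\<Sum>z\<in>?R. order z p) \<le> 6"
    using sum_order_le_degree[OF p0] deg by simp
  have sub: "insert 1 Z \<subseteq> ?R" using Z 1 by auto
  have finZ: "finite Z" using Z(1) by (metis card.infinite zero_neq_numeral)
  have split: "(\<Sum>z\<in>?R. order z p) = order 1 p + (\<Sum>z\<in>Z. order z p) + (\<Sum>z\<in>?R - insert 1 Z. order z p)"
    using sum.subset_diff[OF sub fin, of "\<lambda>z. order z p"] finZ Z(2) by simp
  have "(\<Sum>z\<in>Z. order z p) \<ge> (\<Sum>z\<in>Z. 1)" using Z pos by (intro sum_mono) auto
  then have s4: "(\<Sum>z\<in>Z. order z p) \<ge> 4" using Z(1) by simp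
  have "(\<Sum>z\<in>?R - insert 1 Z. order z p) = 0" using sum split o1 s4 by linarith
  then have "?R - insert 1 Z = {}" using fin pos by (force simp: sum_eq_0_iff)
  moreover have "order z p = 1" if z: "z \<in> Z" for z
  proof -
    have "(\<Sum>z\<in>Z. order z p) = order z p + (\<Sum>z\<in>Z - {z}. order z p)" using finZ z by (simp add: sum.remove)
    moreover have "(\<Sum>z\<in>Z - {z}. order z p) \<ge> (\<Sum>z\<in>Z - {z}. 1)" using Z pos by (intro sum_mono) auto
    then have "(\<Sum>z\<in>Z - {z}. order z p) \<ge> 3" using Z(1) finZ z by simp
    moreover have "(\<Sum>z\<in>Z. order z p) \<le> 4" using sum split o1 by linarith
    ultimately show ?thesis using pos[of z] Z z by auto
  qed
  moreover have "order 1 p = 2" using sum split o1 s4 by linarith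
  ultimately show ?thesis by auto
qed

section \<open>The linearised flow\<close>

lemma has_vector_derivative_vec:
  fixes X :: "real \<Rightarrow> 'a::euclidean_space ^ 'n"
  assumes "\<And>i. ((\<lambda>t. X t $ i) has_vector_derivative D $ i) (at t within S)"
  shows "(X has_vector_derivative D) (at t within S)"
  unfolding has_vector_derivative_def
proof (subst has_derivative_componentwise_within, rule ballI)
  fix b :: "'a ^ 'n" assume "b \<in> Basis"
  then obtain i u where b: "b = axis i u" "u \<in> Basis" by (auto simp: Basis_vec_def)
  have "((\<lambda>t. X t $ i \<bullet> u) has_derivative (\<lambda>h. (h *\<^sub>R D $ i) \<bullet> u)) (at t within S)"
    using assms[of i] unfolding has_vector_derivative_def by (rule has_derivative_inner_left)
  then show "((\<lambda>t. X t \<bullet> b) has_derivative (\<lambda>h. (h *\<^sub>R D) \<bullet> b)) (at t within S)"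
    by (simp add: b inner_axis)
qed

lemma om_add: "om (u + v) w = om u w + om v w" "om w (u + v) = om w u + om w v"
  and om_scale: "om (c *\<^sub>R u) w = c * om u w" "om w (c *\<^sub>R u) = c * om w u"
  and om_diff: "om (u - v) w = om u w - om v w" "om w (u - v) = om w u - om w v"
  by (simp_all add: om_def algebra_simps)

lemma om_nondegenerate: "(\<And>w. om v w = 0) \<Longrightarrow> v = 0"
proof -
  assume a: "\<And>w. om v w = 0"
  have "v $ Inl i = 0" "v $ Inr i = 0" for i
    using a[of "axis (Inr i) 1"] a[of "axis (Inl i) 1"] by (simp_all add: om_axis)
  then show ?thesis by (simp add: phase_eq_iff)
qed

lemma DERIV_om:
  assumes "(u has_vector_derivative u') (at s within S)" "(v has_vector_derivative v') (at s within S)"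
  shows "((\<lambda>s. om (u s) (v s)) has_real_derivative om u' (v s) + om (u s) v') (at s within S)"
proof -
  have "\<And>k. ((\<lambda>t. u t $ k) has_real_derivative u' $ k) (at s within S)" "\<And>k. ((\<lambda>t. v t $ k) has_real_derivative v' $ k) (at s within S)"
    using assms unfolding has_real_derivative_phase_iff[symmetric] by blast+
  then show ?thesis unfolding om_def
    by (auto intro!: derivative_eq_intros simp: algebra_simps)
qed

locale variational =
  fixes \<gamma> :: "real \<Rightarrow> phase" and \<tau> :: real
  assumes \<tau>: "\<tau> > 0"
    and dom: "\<And>s. \<gamma> s \<in> Gam_domain"
    and flow: "\<And>s. (\<gamma> has_vector_derivative field (\<gamma> s)) (at s)"
    and turn: "\<And>s. \<gamma> (s + 2 * \<tau>) = turn (\<gamma> s)"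
    and rev: "\<And>s. s \<in> {0..2 * \<tau>} \<Longrightarrow> \<gamma> (2 * \<tau> - s) = rh (\<gamma> s)"
begin

lemma period: "\<gamma> (s + 12 * \<tau>) = \<gamma> s"
proof -
  have "\<gamma> (s + real n * (2 * \<tau>)) = (turn ^^ n) (\<gamma> s)" for n
  proof (induction n)
    case (Suc n)
    have "s + real (Suc n) * (2 * \<tau>) = (s + real n * (2 * \<tau>)) + 2 * \<tau>" by (simp add: algebra_simps)
    then show ?case using Suc by (simp only: turn) simp
  qed simp
  from this[of 6] show ?thesis by (simp add: turn_6)
qed

lemma continuous_dfield: "continuous_on S (\<lambda>s. dfield (\<gamma> s) v)"
proof -
  have "continuous_on S \<gamma>"
    by (intro continuous_at_imp_continuous_on ballI has_vector_derivative_continuous[OF flow])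
  then show ?thesis
    by (rule continuous_on_compose2[OF continuous_on_dfield]) (use dom in auto)
qed

text \<open>Compactness of one period suffices. The bound is what makes the linearised equation
  globally Lipschitz.\<close>

lemma bounded_dfield: "\<exists>B. \<forall>s. norm (dfield (\<gamma> s) v) \<le> B"
proof -
  have "bounded ((\<lambda>s. dfield (\<gamma> s) v) ` {0..12 * \<tau>})"
    by (intro compact_imp_bounded compact_continuous_image continuous_dfield compact_Icc)
  then obtain B where B: "\<forall>y\<in>(\<lambda>s. dfield (\<gamma> s) v) ` {0..12 * \<tau>}. norm y \<le> B" unfolding bounded_iff by blast
  have p: "\<gamma> (s + of_int k * (12 * \<tau>)) = \<gamma> s" for s k
  proof (induction k rule: int_induct[where k = 0])
    case (step1 i)
    have "s + of_int (i + 1) * (12 * \<tau>) = (s + of_int i * (12 * \<tau>)) + 12 * \<tau>" by (simp add: algebra_simps)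
    then show ?case using step1 by (simp only: period)
  next
    case (step2 i)
    have "s + of_int i * (12 * \<tau>) = (s + of_int (i - 1) * (12 * \<tau>)) + 12 * \<tau>" by (simp add: algebra_simps)
    then show ?case using step2 by (metis period)
  qed simp
  have "norm (dfield (\<gamma> s) v) \<le> B" for s
  proof -
    define k where "k = \<lfloor>s / (12 * \<tau>)\<rfloor>"
    have "of_int k \<le> s / (12 * \<tau>)" "s / (12 * \<tau>) < of_int k + 1" unfolding k_def by linarith+
    then have "s - of_int k * (12 * \<tau>) \<in> {0..12 * \<tau>}" using \<tau> by (auto simp: field_simps)
    moreover have "\<gamma> (s - of_int k * (12 * \<tau>)) = \<gamma> s" using p[of "s - of_int k * (12 * \<tau>)" k] by simp
    ultimately show ?thesis using B by (metis image_eqI)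
  qed
  then show ?thesis by blast
qed

lemma dfield_expand: "dfield x v = (\<Sum>j\<in>UNIV. v $ j *\<^sub>R dfield x (axis j 1))"
proof -
  have "v = (\<Sum>j\<in>UNIV. v $ j *\<^sub>R axis j 1)"
    using basis_expansion[of v] by (simp add: scalar_mult_eq_scaleR)
  then show ?thesis using linear_dfield by (metis (no_types, lifting) linear_sum linear_scale sum.cong)
qed

lemma variational_solution: "\<exists>u. u 0 = v \<and> (\<forall>s. (u has_vector_derivative dfield (\<gamma> s) (u s)) (at s))"
proof -
  obtain B where B: "\<And>j s. norm (dfield (\<gamma> s) (axis j 1)) \<le> B j"
    using bounded_dfield[of "axis _ 1"] by metis
  show ?thesis
  proof (rule picard_global[where C = "\<Sum>j\<in>UNIV. B j" and B = 0])
    have "continuous_on UNIV (\<lambda>p :: real \<times> phase. \<Sum>j\<in>UNIV. snd p $ j *\<^sub>R dfield (\<gamma> (fst p)) (axis j 1))"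
      by (intro continuous_intros continuous_on_compose2[OF continuous_dfield]) auto
    then show "continuous_on UNIV (\<lambda>(s, v). dfield (\<gamma> s) v)"
      by (simp add: case_prod_beta dfield_expand[symmetric])
    fix s v w
    have "dfield (\<gamma> s) v - dfield (\<gamma> s) w = dfield (\<gamma> s) (v - w)" using linear_dfield by (simp add: linear_diff)
    also have "norm \<dots> \<le> (\<Sum>j\<in>UNIV. norm ((v - w) $ j *\<^sub>R dfield (\<gamma> s) (axis j 1)))"
      unfolding dfield_expand[of _ "v - w"] by (rule norm_sum)
    also have "\<dots> \<le> (\<Sum>j\<in>UNIV. norm (v - w) * B j)"
      unfolding norm_scaleR by (intro sum_mono mult_mono B) (use component_le_norm_cart[of "v - w"] in auto)
    finally show "norm (dfield (\<gamma> s) v - dfield (\<gamma> s) w) \<le> (\<Sum>j\<in>UNIV. B j) * norm (v - w)"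
      by (simp add: sum_distrib_right mult.commute)
    show "norm (dfield (\<gamma> s) 0) \<le> 0" using linear_dfield by (simp add: linear_0)
  qed
qed

lemma om_constant:
  assumes "a \<le> b" "\<And>s. s \<in> {a..b} \<Longrightarrow> (u has_vector_derivative dfield (\<gamma> s) (u s)) (at s within {a..b})"
    "\<And>s. s \<in> {a..b} \<Longrightarrow> (v has_vector_derivative dfield (\<gamma> s) (v s)) (at s within {a..b})"
  shows "om (u b) (v b) = om (u a) (v a)"
proof -
  have "((\<lambda>s. om (u s) (v s)) has_real_derivative 0) (at s within {a..b})" if "s \<in> {a..b}" for s
    using DERIV_om[OF assms(2)[OF that] assms(3)[OF that]] by (simp add: om_dfield)
  then have "\<exists>c. \<forall>s\<in>{a..b}. om (u s) (v s) = c"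
    by (intro has_field_derivative_zero_constant) auto
  then show ?thesis using assms(1) by fastforce
qed

section \<open>The fundamental matrix of the linearised equation\<close>

definition X :: "real \<Rightarrow> real ^ (3 + 3) ^ (3 + 3)" where
  "X = (SOME X. X 0 = mat 1 \<and> (\<forall>s. (X has_vector_derivative (J ** hessian (Gam (- 1)) (\<gamma> s) ** X s)) (at s)))"

lemma X: "X 0 = mat 1" "(X has_vector_derivative (J ** hessian (Gam (- 1)) (\<gamma> s) ** X s)) (at s)"
proof -
  obtain u where u: "\<And>j. u j 0 = axis j 1" "\<And>j s. (u j has_vector_derivative dfield (\<gamma> s) (u j s)) (at s)"
    using variational_solution[of "axis _ 1"] by metis
  define Y :: "real \<Rightarrow> real ^ (3 + 3) ^ (3 + 3)" where "Y s = (\<chi> i j. u j s $ i)" for s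
  have "(Y has_vector_derivative (J ** hessian (Gam (- 1)) (\<gamma> s) ** Y s)) (at s)" for s
  proof (rule has_vector_derivative_vec, unfold has_real_derivative_phase_iff[symmetric], rule allI)
    fix i j
    have "(\<lambda>t. Y t $ i $ j) = (\<lambda>t. u j t $ i)" by (simp add: Y_def)
    moreover have "(J ** hessian (Gam (- 1)) (\<gamma> s) ** Y s) $ i $ j = dfield (\<gamma> s) (u j s) $ i"
      unfolding J_hessian[OF dom, symmetric] by (simp add: matrix_matrix_mult_def matrix_vector_mult_def Y_def)
    ultimately show "((\<lambda>t. Y t $ i $ j) has_real_derivative (J ** hessian (Gam (- 1)) (\<gamma> s) ** Y s) $ i $ j) (at s)"
      using u(2)[of j s] unfolding has_real_derivative_phase_iff[symmetric] by simp
  qed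
  moreover have "Y 0 = mat 1" by (simp add: Y_def u(1) mat_def axis_def vec_eq_iff)
  ultimately have "\<exists>X. X 0 = mat 1 \<and> (\<forall>s. (X has_vector_derivative (J ** hessian (Gam (- 1)) (\<gamma> s) ** X s)) (at s))"
    by blast
  from someI_ex[OF this] show "X 0 = mat 1" "(X has_vector_derivative (J ** hessian (Gam (- 1)) (\<gamma> s) ** X s)) (at s)"
    unfolding X_def by blast+
qed

definition \<Phi> :: "real \<Rightarrow> phase \<Rightarrow> phase" where "\<Phi> s v = X s *v v"

lemma \<Phi>_0 [simp]: "\<Phi> 0 v = v"
  by (simp add: \<Phi>_def X)

lemma linear_\<Phi>: "linear (\<Phi> s)"
  unfolding \<Phi>_def[abs_def] by (rule matrix_vector_mul_linear)

lemma \<Phi>: "((\<lambda>s. \<Phi> s v) has_vector_derivative dfield (\<gamma> s) (\<Phi> s v)) (at s within S)"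
proof -
  have "bounded_linear (\<lambda>M :: real ^ (3 + 3) ^ (3 + 3). M *v v)"
    unfolding linear_conv_bounded_linear[symmetric]
    by (rule linearI) (simp_all add: matrix_vector_mult_add_rdistrib scaleR_matrix_vector_assoc)
  from bounded_linear.has_vector_derivative[OF this X(2), of s]
  have "((\<lambda>s. X s *v v) has_vector_derivative (J ** hessian (Gam (- 1)) (\<gamma> s) ** X s) *v v) (at s)" .
  moreover have "(J ** hessian (Gam (- 1)) (\<gamma> s) ** X s) *v v = dfield (\<gamma> s) (X s *v v)"
    by (simp add: J_hessian[OF dom, symmetric] matrix_vector_mul_assoc)
  ultimately show ?thesis unfolding \<Phi>_def by (simp add: has_vector_derivative_at_within)
qed

lemma om_\<Phi>: "om (\<Phi> s v) (\<Phi> s w) = om v w" if "s \<ge> 0"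
  using om_constant[OF that \<Phi> \<Phi>, of v w] by simp

text \<open>A solution \<open>u\<close> and the flow of \<open>u 0\<close> have the same symplectic
  pairing with every \<open>\<Phi> s w\<close>. These vectors fill the space and the form is
  nondegenerate, so uniqueness follows from invariance of the form alone.\<close>

lemma unique:
  assumes b: "0 \<le> b" and u: "\<And>s. s \<in> {0..b} \<Longrightarrow> (u has_vector_derivative dfield (\<gamma> s) (u s)) (at s within {0..b})"
    and s: "s \<in> {0..b}"
  shows "u s = \<Phi> s (u 0)"
proof -
  have s0: "0 \<le> s" using s by simp
  have inj: "inj (\<Phi> s)"
  proof (rule injI)
    fix v w assume "\<Phi> s v = \<Phi> s w"
    then have "om (v - w) z = 0" for z
      using om_\<Phi>[OF s0, of v z] om_\<Phi>[OF s0, of w z] by (simp add: om_diff)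
    then show "v = w" using om_nondegenerate by fastforce
  qed
  then have surj: "surj (\<Phi> s)" using linear_injective_imp_surjective[OF linear_\<Phi>] by blast
  have u': "(u has_vector_derivative dfield (\<gamma> t) (u t)) (at t within {0..s})" if "t \<in> {0..s}" for t
    by (rule has_vector_derivative_within_subset[OF u]) (use that s in auto)
  have "om (u s - \<Phi> s (u 0)) z = 0" for z
  proof -
    obtain w where w: "z = \<Phi> s w" using surj by (metis surjD)
    have "om (u s) (\<Phi> s w) = om (u 0) (\<Phi> 0 w)" by (rule om_constant[OF s0 u' \<Phi>])
    then show ?thesis by (simp add: w om_diff om_\<Phi>[OF s0])
  qed
  then have "u s - \<Phi> s (u 0) = 0" by (rule om_nondegenerate)
  then show ?thesis by simp
qed

section \<open>The reflection at time \<tau> and a sixth root of the monodromy matrix\<close>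

definition mirror :: "phase \<Rightarrow> phase" where "mirror v = rh (\<Phi> (2 * \<tau>) v)"

text \<open>\<open>rh\<close> reverses the linearised equation about time \<tau>, so both sides
  solve it and agree at \<open>s = 0\<close>. Thus \<open>mirror\<close> is this reflection
  expressed in initial values.\<close>

lemma \<Phi>_rev: "s \<in> {0..2 * \<tau>} \<Longrightarrow> rh (\<Phi> (2 * \<tau> - s) v) = \<Phi> s (mirror v)"
proof -
  assume s: "s \<in> {0..2 * \<tau>}"
  have "rh (\<Phi> (2 * \<tau> - s) v) = \<Phi> s (rh (\<Phi> (2 * \<tau> - 0) v))"
  proof (rule unique[where u = "\<lambda>s. rh (\<Phi> (2 * \<tau> - s) v)" and b = "2 * \<tau>"])
    fix s assume s: "s \<in> {0..2 * \<tau>}"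
    have "((\<lambda>s. rh (\<Phi> (2 * \<tau> - s) v)) has_vector_derivative - rh (dfield (\<gamma> (2 * \<tau> - s)) (\<Phi> (2 * \<tau> - s) v))) (at s within {0..2 * \<tau>})"
      by (rule reversed_derivative[where g = "\<lambda>s. \<Phi> s v" and B = UNIV, OF \<Phi> linear_rh]) simp
    moreover have "- rh (dfield (\<gamma> (2 * \<tau> - s)) (\<Phi> (2 * \<tau> - s) v)) = dfield (\<gamma> s) (rh (\<Phi> (2 * \<tau> - s) v))"
      using dfield_rh[of "\<gamma> s" "rh (\<Phi> (2 * \<tau> - s) v)"] by (simp add: rev[OF s] linear_rh_sg_minus)
    ultimately show "((\<lambda>s. rh (\<Phi> (2 * \<tau> - s) v)) has_vector_derivative dfield (\<gamma> s) (rh (\<Phi> (2 * \<tau> - s) v))) (at s within {0..2 * \<tau>})"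
      by simp
  qed (use \<tau> s in auto)
  then show ?thesis by (simp add: mirror_def)
qed

text \<open>At the centre of the reflection \<open>mirror\<close> becomes \<open>rh\<close> itself.
  This halves the time over which linearised solutions have to be enclosed, from
  \<open>2 * \<tau>\<close> to \<tau>.\<close>

lemma mirror_half: "\<Phi> \<tau> (mirror v) = rh (\<Phi> \<tau> v)"
  using \<Phi>_rev[of \<tau> v] \<tau> by simp

lemma mirror_mirror [simp]: "mirror (mirror v) = v"
proof -
  have "rh v = \<Phi> (2 * \<tau>) (mirror v)" using \<Phi>_rev[of "2 * \<tau>" v] \<tau> by simp
  then have "rh (rh v) = mirror (mirror v)" by (simp add: mirror_def)
  then show ?thesis by simp
qed

lemma linear_mirror: "linear mirror"
  unfolding mirror_def[abs_def] using linear_compose[OF linear_\<Phi> linear_rh] by (simp add: o_def)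

text \<open>The flow over time \<open>2 * \<tau>\<close> followed by the inverse of
  \<open>turn\<close>, as \<open>turn_step\<close> shows. The inverse map is
  \<open>mirror \<circ> sg\<close>.\<close>

definition step :: "phase \<Rightarrow> phase" where "step v = sg (mirror v)"

lemma linear_step: "linear step"
  unfolding step_def[abs_def] using linear_compose[OF linear_mirror linear_sg] by (simp add: o_def)

lemma turn_step: "turn (step v) = \<Phi> (2 * \<tau>) v"
  by (simp add: step_def mirror_def turn_def)

text \<open>Shifting by \<open>2 * \<tau>\<close> and undoing \<open>turn\<close> maps solutions to
  solutions; \<open>?R\<close> is the inverse of \<open>turn\<close>.\<close>

lemma \<Phi>_shift: "0 \<le> s \<Longrightarrow> \<Phi> (s + 2 * \<tau>) v = turn (\<Phi> s (step v))"
proof -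
  assume s: "0 \<le> s"
  let ?R = "\<lambda>v. sg (rh v)"
  have R: "linear ?R" using linear_compose[OF linear_rh linear_sg] by (simp add: o_def)
  have Rt: "?R (turn v) = v" "turn (?R v) = v" for v by (simp_all add: turn_def)
  \<comment> \<open>The double minus brings the shift into the form \<open>s - c\<close> of
    \<open>shifted_derivative\<close>.\<close>
  have "?R (\<Phi> (s - - 2 * \<tau>) v) = \<Phi> s (?R (\<Phi> (0 - - 2 * \<tau>) v))"
  proof (rule unique[where u = "\<lambda>s. ?R (\<Phi> (s - - 2 * \<tau>) v)" and b = s])
    fix s
    have "((\<lambda>s. ?R (\<Phi> (s - - 2 * \<tau>) v)) has_vector_derivative ?R (dfield (\<gamma> (s - - 2 * \<tau>)) (\<Phi> (s - - 2 * \<tau>) v))) (at s within A)" for A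
      by (rule shifted_derivative[where g = "\<lambda>s. \<Phi> s v" and B = UNIV, OF \<Phi> R]) simp
    moreover have "?R (dfield (\<gamma> (s - - 2 * \<tau>)) (\<Phi> (s - - 2 * \<tau>) v)) = dfield (\<gamma> s) (?R (\<Phi> (s - - 2 * \<tau>) v))"
      using dfield_turn[of "\<gamma> s" "?R (\<Phi> (s - - 2 * \<tau>) v)"] turn[of s] Rt by simp
    ultimately show "((\<lambda>s. ?R (\<Phi> (s - - 2 * \<tau>) v)) has_vector_derivative dfield (\<gamma> s) (?R (\<Phi> (s - - 2 * \<tau>) v))) (at s within A)" for A
      by simp
  qed (use s in auto)
  then have "turn (?R (\<Phi> (s + 2 * \<tau>) v)) = turn (\<Phi> s (?R (\<Phi> (2 * \<tau>) v)))" by simp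
  moreover have "?R (\<Phi> (2 * \<tau>) v) = step v" by (simp add: step_def mirror_def)
  ultimately show ?thesis by (simp only: Rt)
qed

lemma \<Phi>_period: "\<Phi> (12 * \<tau>) v = (step ^^ 6) v"
proof -
  have "\<Phi> (real n * (2 * \<tau>)) v = (turn ^^ n) ((step ^^ n) v)" for n v
  proof (induction n arbitrary: v)
    case (Suc n)
    have "\<Phi> (real (Suc n) * (2 * \<tau>)) v = \<Phi> (real n * (2 * \<tau>) + 2 * \<tau>) v" by (simp add: algebra_simps)
    also have "\<dots> = turn (\<Phi> (real n * (2 * \<tau>)) (step v))" using \<tau> by (intro \<Phi>_shift) auto
    finally show ?case by (simp add: Suc funpow_swap1)
  qed simp
  from this[of 6 v] show ?thesis by (simp add: turn_6)
qed

lemma \<Phi>_field: "\<Phi> s (field (\<gamma> 0)) = field (\<gamma> s)" if "s \<ge> 0"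
proof -
  have "((\<lambda>t. field (\<gamma> t)) has_vector_derivative dfield (\<gamma> t) (field (\<gamma> t))) (at t)" for t
    unfolding has_real_derivative_phase_iff[symmetric]
    using DERIV_field[of \<gamma> "field (\<gamma> t)" t] flow[of t] dom[of t] unfolding has_real_derivative_phase_iff[symmetric] by blast
  then show ?thesis
    using unique[OF that, of "\<lambda>t. field (\<gamma> t)" s] that has_vector_derivative_at_within by fastforce
qed

lemma step_field: "step (field (\<gamma> 0)) = field (\<gamma> 0)"
proof -
  have "\<Phi> (2 * \<tau>) (field (\<gamma> 0)) = field (turn (\<gamma> 0))" using \<Phi>_field[of "2 * \<tau>"] turn[of 0] \<tau> by simp
  then have "turn (step (field (\<gamma> 0))) = turn (field (\<gamma> 0))" by (simp add: turn_step field_turn)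
  then have "sg (rh (turn (step (field (\<gamma> 0))))) = sg (rh (turn (field (\<gamma> 0))))" by simp
  then show ?thesis by (simp add: turn_def)
qed

end

lemma cos_6: "cos (6 * t) = 32 * cos t ^ 6 - 48 * cos t ^ 4 + 18 * cos t ^ 2 - (1 :: real)"
proof -
  have "cos (6 * t) = cos (2 * (3 * t))" by simp
  also have "\<dots> = 2 * (4 * cos t ^ 3 - 3 * cos t)\<^sup>2 - 1" by (simp only: cos_double_cos cos_treble_cos)
  finally show ?thesis by (simp add: power2_eq_square power_numeral_reduce algebra_simps)
qed

context variational
begin

lemma step_mirror: "step (mirror (sg v)) = v" "mirror (sg (step v)) = v"
  by (simp_all add: step_def)

text \<open>On the span of \<open>v\<close> and \<open>step v\<close> the map satisfies
  \<open>step (step x) = 2 * cos t * step x - x\<close>, so it is a rotation by \<open>t\<close> in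
  the coordinates \<open>p\<close> and \<open>q\<close>, and \<open>p\<close> plus \<open>i\<close>
  times \<open>q\<close> is an eigenvector of the sixth power. The condition on \<open>sin t\<close>
  keeps \<open>q\<close>, and with it the eigenvector, from vanishing.\<close>

lemma rotation_eigenvalues:
  assumes v: "step v + mirror (sg v) = (2 * cos t) *\<^sub>R v" "v \<noteq> 0" and t: "sin t \<noteq> 0"
  shows "eigenvalue (complex_matrix (X (12 * \<tau>))) (cis (6 * t))" "eigenvalue (complex_matrix (X (12 * \<tau>))) (cis (- (6 * t)))"
proof -
  define p where "p = step v - cos t *\<^sub>R v"
  define q where "q = sin t *\<^sub>R v"
  have "step (step v + mirror (sg v)) = step ((2 * cos t) *\<^sub>R v)" using v(1) by simp
  then have 2: "step (step v) + v = (2 * cos t) *\<^sub>R step v"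
    using linear_step by (simp add: linear_add linear_scale step_mirror)
  have sv: "step v = p + cos t *\<^sub>R v" by (simp add: p_def)
  have "step p = step (step v) - cos t *\<^sub>R step v" unfolding p_def using linear_step by (simp add: linear_diff linear_scale)
  also have "step (step v) = (2 * cos t) *\<^sub>R step v - v" using 2 by (simp add: eq_diff_eq)
  also have "(2 * cos t) *\<^sub>R step v - v - cos t *\<^sub>R step v = cos t *\<^sub>R p - sin t *\<^sub>R q"
  proof -
    have "(2 * cos t) *\<^sub>R step v - v - cos t *\<^sub>R step v = cos t *\<^sub>R p - (1 - (cos t)\<^sup>2) *\<^sub>R v"
      unfolding sv by (simp add: vec_eq_iff algebra_simps power2_eq_square)
    also have "(1 - (cos t)\<^sup>2) *\<^sub>R v = sin t *\<^sub>R q" unfolding q_def sin_squared_eq[symmetric] by (simp add: power2_eq_square)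
    finally show ?thesis .
  qed
  finally have Wp: "step p = cos t *\<^sub>R p - sin t *\<^sub>R q" .
  have Wq: "step q = sin t *\<^sub>R p + cos t *\<^sub>R q"
    using linear_step by (simp add: q_def linear_scale sv scaleR_add_right mult.commute)
  have rot: "(step ^^ n) p = cos (real n * t) *\<^sub>R p - sin (real n * t) *\<^sub>R q \<and>
    (step ^^ n) q = sin (real n * t) *\<^sub>R p + cos (real n * t) *\<^sub>R q" for n
  proof (induction n)
    case (Suc n)
    have a: "real (Suc n) * t = real n * t + t" by (simp add: algebra_simps)
    have 1: "(step ^^ n) p = cos (real n * t) *\<^sub>R p - sin (real n * t) *\<^sub>R q"
      "(step ^^ n) q = sin (real n * t) *\<^sub>R p + cos (real n * t) *\<^sub>R q" using Suc by simp_all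
    show ?case
      unfolding funpow.simps o_apply 1 linear_diff[OF linear_step] linear_add[OF linear_step] linear_scale[OF linear_step]
        Wp Wq a cos_add sin_add
      by (simp add: vec_eq_iff algebra_simps)
  qed simp
  define c s where "c = cos (6 * t)" and "s = sin (6 * t)"
  have M: "X (12 * \<tau>) *v p = c *\<^sub>R p - s *\<^sub>R q" "X (12 * \<tau>) *v q = s *\<^sub>R p + c *\<^sub>R q"
    using \<Phi>_period[of p] \<Phi>_period[of q] rot[of 6] by (simp_all add: \<Phi>_def c_def s_def)
  have q0: "q \<noteq> 0" using v t by (simp add: q_def)
  then obtain i where i: "q $ i \<noteq> 0" by (auto simp: vec_eq_iff)
  have "complex_matrix (X (12 * \<tau>)) *v cvec p q = cis (6 * t) *s cvec p q"
    unfolding complex_matrix_cvec M by (simp add: cvec_def vec_eq_iff complex_eq_iff c_def s_def)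
  moreover have "cvec p q \<noteq> 0" using i by (auto simp: cvec_def vec_eq_iff complex_eq_iff)
  ultimately show "eigenvalue (complex_matrix (X (12 * \<tau>))) (cis (6 * t))" unfolding eigenvalue_def by blast
  have M': "X (12 * \<tau>) *v (- q) = - (s *\<^sub>R p + c *\<^sub>R q)" by (simp only: linear_neg[OF matrix_vector_mul_linear] M)
  have "complex_matrix (X (12 * \<tau>)) *v cvec p (- q) = cis (- (6 * t)) *s cvec p (- q)"
    unfolding complex_matrix_cvec M(1) M' by (simp add: cvec_def vec_eq_iff complex_eq_iff c_def s_def)
  moreover have "cvec p (- q) \<noteq> 0" using i by (auto simp: cvec_def vec_eq_iff complex_eq_iff)
  ultimately show "eigenvalue (complex_matrix (X (12 * \<tau>))) (cis (- (6 * t)))" unfolding eigenvalue_def by blast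
qed

lemma monodromy_stable:
  assumes e1: "step e = e" "e \<noteq> 0"
    and ev: "eigenvalue (complex_matrix (X (12 * \<tau>))) (cis a)" "eigenvalue (complex_matrix (X (12 * \<tau>))) (cis (- a))"
      "eigenvalue (complex_matrix (X (12 * \<tau>))) (cis b)" "eigenvalue (complex_matrix (X (12 * \<tau>))) (cis (- b))"
    and ab: "sin a \<noteq> 0" "sin b \<noteq> 0" "cos a \<noteq> cos b"
  shows "linearly_stable (- 1) \<gamma> (12 * \<tau>)"
proof -
  let ?M = "X (12 * \<tau>)" and ?N = "complex_matrix (X (12 * \<tau>))"
  define A where "A = matrix step"
  define B where "B = matrix (\<lambda>v. mirror (sg v))"
  define R where "R = matrix sg"
  have lin: "linear (\<lambda>v. mirror (sg v))" using linear_compose[OF linear_sg linear_mirror] by (simp add: o_def)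
  have Av: "A *v v = step v" and Bv: "B *v v = mirror (sg v)" and Rv: "R *v v = sg v" for v
    unfolding A_def B_def R_def using linear_step lin linear_sg by (simp_all add: matrix_works)
  define A3 where "A3 = A ** A ** A"
  define B3 where "B3 = B ** B ** B"
  have Mv: "?M *v v = (step ^^ 6) v" for v using \<Phi>_period[of v] by (simp add: \<Phi>_def)
  have M: "?M = A3 ** A3"
    unfolding matrix_eq Mv A3_def by (simp add: matrix_vector_mul_assoc[symmetric] Av numeral_eq_Suc)
  have inv: "?M ** (B3 ** B3) = mat 1"
    unfolding matrix_eq M A3_def B3_def by (simp add: matrix_vector_mul_assoc[symmetric] Av Bv step_mirror)
  have RR: "R ** R = mat 1" unfolding matrix_eq by (simp add: matrix_vector_mul_assoc[symmetric] Rv)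
  have RMR: "R ** ?M ** R = B3 ** B3"
    unfolding matrix_eq M A3_def B3_def by (simp add: matrix_vector_mul_assoc[symmetric] Av Bv Rv step_def)
  have D: "matrix mirror ** matrix mirror = mat 1"
    unfolding matrix_eq using linear_mirror by (simp add: matrix_vector_mul_assoc[symmetric] matrix_works)
  have A_RD: "A = R ** matrix mirror"
    unfolding matrix_eq using linear_mirror by (simp add: matrix_vector_mul_assoc[symmetric] Av Rv matrix_works step_def)
  \<comment> \<open>The determinant of the monodromy matrix is the square of that of
    \<open>step ^^ 3\<close>, and \<open>step\<close> is a product of two involutions, so the value
    is 1 whatever the signs of their determinants.\<close>
  have "det R * det R = 1" "det (matrix mirror) * det (matrix mirror) = 1"
    using arg_cong[OF RR, of det] arg_cong[OF D, of det] by (simp_all add: det_mul)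
  moreover have "det A * det A = (det R * det R) * (det (matrix mirror) * det (matrix mirror))"
    unfolding A_RD det_mul by (simp only: mult.assoc mult.left_commute)
  ultimately have "det A * det A = 1" by (simp only: mult_1)
  moreover have "det A3 * det A3 = (det A * det A) * (det A * det A) * (det A * det A)"
    unfolding A3_def det_mul by (simp only: mult.assoc)
  ultimately have "det A3 * det A3 = 1" by (simp only: mult_1)
  then have detM: "det ?M = 1" unfolding M det_mul .
  have one: "eigenvalue ?N 1"
  proof -
    have "(step ^^ n) e = e" for n by (induction n) (simp_all add: e1)
    then have "?N *v cvec e 0 = cvec e 0" unfolding complex_matrix_cvec Mv by (simp add: Mv[symmetric])
    moreover have "cvec e 0 \<noteq> 0" using e1(2) by (auto simp: cvec_def vec_eq_iff complex_eq_iff)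
    ultimately show ?thesis unfolding eigenvalue_def by (intro exI[of _ "cvec e 0"]) simp
  qed
  have card: "CARD(3 + 3) = 6" by (simp add: UNIV_phase)
  have p0: "char_poly ?N \<noteq> 0"
  proof
    assume "char_poly ?N = 0"
    then have "det (mat 0 - ?N) = 0" using poly_char_poly[of ?N 0] by simp
    moreover have "mat 0 - ?N = smat (- 1) ?N" by (simp add: vec_eq_iff mat_def smat_def)
    ultimately show False by (simp add: det_smat det_complex_matrix detM)
  qed
  have d1: "poly (pderiv (char_poly ?N)) 1 = 0"
  proof (rule pderiv_char_poly_1)
    show "?N ** complex_matrix (B3 ** B3) = mat 1"
      by (simp add: complex_matrix_mult[symmetric] inv complex_matrix_1)
    show "complex_matrix R ** complex_matrix R = mat 1"
      by (simp add: complex_matrix_mult[symmetric] RR complex_matrix_1)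
    show "complex_matrix R ** ?N ** complex_matrix R = complex_matrix (B3 ** B3)"
      by (simp add: complex_matrix_mult[symmetric] RMR)
  qed (use one card in \<open>auto simp: det_complex_matrix detM eigenvalue_iff_root\<close>)
  let ?Z = "{cis a, cis (- a), cis b, cis (- b)}"
  have dist: "cis a \<noteq> cis (- a)" "cis b \<noteq> cis (- b)" "cis a \<noteq> cis b" "cis a \<noteq> cis (- b)" "cis (- a) \<noteq> cis b" "cis (- a) \<noteq> cis (- b)"
    using ab by (auto simp: complex_eq_iff)
  have Z: "card ?Z = 4" "1 \<notin> ?Z" using dist ab by (auto simp: complex_eq_iff)
  have "order 1 (char_poly ?N) = 2 \<and> (\<forall>z. poly (char_poly ?N) z = 0 \<longrightarrow> z = 1 \<or> z \<in> ?Z \<and> order z (char_poly ?N) = 1)"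
    by (rule orders_of_six_roots[OF p0 _ _ d1 Z])
      (use degree_char_poly[of ?N] card one ev in \<open>auto simp: eigenvalue_iff_root\<close>)
  then have "eigenvalue_multiplicity ?N 1 = 2 \<and> (\<forall>z. eigenvalue ?N z \<longrightarrow> cmod z = 1 \<and> (z \<noteq> 1 \<longrightarrow> eigenvalue_multiplicity ?N z = 1))"
    unfolding eigenvalue_multiplicity_def eigenvalue_iff_root by auto
  moreover have "is_monodromy (- 1) \<gamma> (12 * \<tau>) ?M" unfolding is_monodromy_def using X by blast
  ultimately show ?thesis unfolding linearly_stable_def by blast
qed

section \<open>Reduction to four symplectic pairings at time \<tau>\<close>

definition pairing :: "phase \<Rightarrow> phase \<Rightarrow> real" where
  "pairing v u = om (rh (\<Phi> \<tau> v)) (\<Phi> \<tau> u) / 2"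

text \<open>\<open>e1\<close>, \<open>v1\<close>, \<open>v2\<close> span the -1-space of
  \<open>sg\<close>; \<open>ua\<close> and \<open>ub\<close> are fixed by \<open>sg\<close> and are
  the derivatives of the starting point in \<alpha> and \<beta>. The form pairs \<open>v1\<close>
  with \<open>ub\<close> and \<open>v2\<close> with \<open>ua\<close> to -2, while \<open>v1\<close>
  with \<open>ua\<close>, \<open>v2\<close> with \<open>ub\<close> and \<open>e1\<close> with either
  give 0.\<close>

abbreviation "e1 \<equiv> ph 1 0 0 0 0 0"
abbreviation "v1 \<equiv> ph 0 1 (- 1) 0 0 0"
abbreviation "v2 \<equiv> ph 0 0 0 0 1 1"
abbreviation "ua \<equiv> ph 0 1 1 0 0 0"
abbreviation "ub \<equiv> ph 0 0 0 0 (- 1) 1"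

text \<open>Invariance of the form moves the pairing from time 0 to \<tau>, where
  \<open>mirror\<close> is \<open>rh\<close>. The two summands contribute equally because
  \<open>sg\<close> changes the sign of the form.\<close>

lemma om_average:
  assumes v: "sg v = - v" and u: "sg u = u"
  shows "om (step v + mirror (sg v)) u = - 4 * pairing v u"
proof -
  have "mirror (sg v) = - mirror v" using linear_mirror by (simp add: v linear_neg)
  then have "om (step v + mirror (sg v)) u = om (sg (mirror v)) u - om (mirror v) u"
    by (simp add: step_def om_def algebra_simps)
  also have "om (sg (mirror v)) u = - om (mirror v) u" by (simp add: om_sg u)
  also have "om (mirror v) u = om (\<Phi> \<tau> (mirror v)) (\<Phi> \<tau> u)" using \<tau> by (simp add: om_\<Phi>)
  finally show ?thesis by (simp add: mirror_half pairing_def)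
qed

text \<open>The sum lies in the -1-space of \<open>sg\<close>, and its pairings with
  \<open>ub\<close> and \<open>ua\<close> give the coordinates along \<open>v1\<close> and
  \<open>v2\<close>. The coordinate along \<open>e1\<close> remains undetermined.\<close>

lemma average_expand:
  assumes v: "sg v = - v"
  obtains k where "step v + mirror (sg v) = (2 * k) *\<^sub>R e1 + (2 * pairing v ub) *\<^sub>R v1 + (2 * pairing v ua) *\<^sub>R v2"
proof -
  define w where "w = step v + mirror (sg v)"
  have m: "mirror (sg v) = - mirror v" using linear_mirror by (simp add: v linear_neg)
  have "sg w = - w"
    unfolding w_def m step_def using linear_sg by (simp add: linear_diff)
  then have k: "sg w $ k = - (w $ k)" for k by simp
  have w: "w $ Inl 3 = - w $ Inl 2" "w $ Inr 1 = 0" "w $ Inr 3 = w $ Inr 2"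
    using k[of "Inl 2"] k[of "Inr 1"] k[of "Inr 2"] by (simp_all add: sg_def)
  have "om w ub = - 4 * pairing v ub" "om w ua = - 4 * pairing v ua"
    unfolding w_def by (rule om_average[OF v]; simp add: sg_def)+
  then have "w $ Inl 2 = 2 * pairing v ub" "w $ Inr 2 = 2 * pairing v ua"
    using w by (simp_all add: om_def)
  then have "w = (2 * (w $ Inl 1 / 2)) *\<^sub>R e1 + (2 * pairing v ub) *\<^sub>R v1 + (2 * pairing v ua) *\<^sub>R v2"
    using w by (simp add: phase_eq_iff)
  then show ?thesis using that unfolding w_def by blast
qed

text \<open>The product equation is the characteristic equation of the action modulo
  \<open>e1\<close>. Since \<open>e1\<close> itself belongs to the eigenvalue 1, an eigenvector of
  the quotient lifts whenever \<open>a \<noteq> 1\<close>.\<close>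

lemma eigen_average:
  assumes e: "step e1 = e1" and a: "(pairing v1 ub - a) * (pairing v2 ua - a) = pairing v2 ub * pairing v1 ua"
    and a1: "a \<noteq> 1" and nz: "pairing v2 ub \<noteq> 0"
  shows "\<exists>v. v \<noteq> 0 \<and> step v + mirror (sg v) = (2 * a) *\<^sub>R v"
proof -
  define K where "K v = step v + mirror (sg v)" for v
  have K: "linear K"
    unfolding K_def[abs_def] using linear_compose[OF linear_sg linear_mirror] linear_step
    by (intro linear_compose_add) (simp_all add: o_def)
  have s: "sg v1 = - v1" "sg v2 = - v2" by (simp_all add: sg_def phase_eq_iff)
  obtain k where k: "K v1 = (2 * k) *\<^sub>R e1 + (2 * pairing v1 ub) *\<^sub>R v1 + (2 * pairing v1 ua) *\<^sub>R v2"
    unfolding K_def by (rule average_expand[OF s(1)])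
  obtain l where l: "K v2 = (2 * l) *\<^sub>R e1 + (2 * pairing v2 ub) *\<^sub>R v1 + (2 * pairing v2 ua) *\<^sub>R v2"
    unfolding K_def by (rule average_expand[OF s(2)])
  have "mirror (sg e1) = e1" using step_mirror(2)[of e1] e by simp
  then have Ke: "K e1 = 2 *\<^sub>R e1" using e by (simp add: K_def scaleR_2)
  define x where "x = pairing v2 ub"
  define y where "y = a - pairing v1 ub"
  \<comment> \<open>The component along \<open>e1\<close> that compensates the undetermined
    coordinates \<open>k\<close> and \<open>l\<close>.\<close>
  define c where "c = (x * k + y * l) / (a - 1)"
  have c: "c + x * k + y * l = a * c" using a1 by (simp add: c_def field_simps)
  have xy: "x * pairing v1 ub + y * x = a * x" "x * pairing v1 ua + y * pairing v2 ua = a * y"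
    using a by (simp_all add: x_def y_def algebra_simps)
  have "K (c *\<^sub>R e1 + x *\<^sub>R v1 + y *\<^sub>R v2) = c *\<^sub>R K e1 + x *\<^sub>R K v1 + y *\<^sub>R K v2"
    using K by (simp only: linear_add linear_scale)
  also have "\<dots> = (2 * (c + x * k + y * l)) *\<^sub>R e1 + (2 * (x * pairing v1 ub + y * x)) *\<^sub>R v1 + (2 * (x * pairing v1 ua + y * pairing v2 ua)) *\<^sub>R v2"
    unfolding Ke k l x_def[symmetric] by (simp add: phase_eq_iff algebra_simps)
  also have "\<dots> = (2 * a) *\<^sub>R (c *\<^sub>R e1 + x *\<^sub>R v1 + y *\<^sub>R v2)"
    unfolding c xy by (simp add: phase_eq_iff)
  finally have "K (c *\<^sub>R e1 + x *\<^sub>R v1 + y *\<^sub>R v2) = (2 * a) *\<^sub>R (c *\<^sub>R e1 + x *\<^sub>R v1 + y *\<^sub>R v2)" .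
  moreover have "c *\<^sub>R e1 + x *\<^sub>R v1 + y *\<^sub>R v2 \<noteq> 0" using nz by (simp add: phase_eq_iff x_def)
  ultimately show ?thesis unfolding K_def by blast
qed

lemma stable_from_pairings:
  assumes field: "field (\<gamma> 0) = c *\<^sub>R e1" "c \<noteq> 0"
    and m: "\<bar>pairing v1 ub + 1.12404\<bar> \<le> 0.0016" "\<bar>pairing v2 ub - 0.19267\<bar> \<le> 0.0011"
      "\<bar>pairing v1 ua + 1.12124\<bar> \<le> 0.0045" "\<bar>pairing v2 ua - 0.34824\<bar> \<le> 0.0032"
  shows "linearly_stable (- 1) \<gamma> (12 * \<tau>)"
proof -
  have e: "step e1 = e1"
  proof -
    have "step (c *\<^sub>R e1) = c *\<^sub>R e1" using step_field field by simp
    then have "c *\<^sub>R step e1 = c *\<^sub>R e1" using linear_step by (simp add: linear_scale)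
    then show ?thesis using field(2) by simp
  qed
  define a11 a12 a21 a22 where "a11 = - pairing v1 ub" "a12 = pairing v2 ub" "a21 = - pairing v1 ua" "a22 = pairing v2 ua"
  note as = this
  have b: "1.12244 \<le> a11" "a11 \<le> 1.12564" "0.19157 \<le> a12" "a12 \<le> 0.19377" "1.11674 \<le> a21" "a21 \<le> 1.12574"
      "0.34504 \<le> a22" "a22 \<le> 0.35144"
    using m unfolding as abs_le_iff by simp_all
  \<comment> \<open>The characteristic polynomial in terms of the four positive numbers
    \<open>a11\<close> to \<open>a22\<close>, so that bounds on products follow from monotonicity.
    Its zeros are near 0.183 and -0.959.\<close>
  define q where "q x = a12 * a21 - (a11 + x) * (a22 - x)" for x
  have o: "0.19157 * 1.11674 \<le> a12 * a21" "a12 * a21 \<le> 0.19377 * 1.12574"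
    by (rule mult_mono'; use b in simp)+
  have "(a11 + 0.193) * (a22 - 0.193) \<le> 1.31864 * 0.15844" "(a11 - 0.966) * (a22 + 0.966) \<le> 0.15964 * 1.31744"
    by (rule mult_mono'; use b in simp)+
  then have pos: "q 0.193 > 0" "q (- 0.966) > 0" using o(1) by (simp_all add: q_def)
  have "1.29544 * 0.17204 \<le> (a11 + 0.173) * (a22 - 0.173)" "0.17044 * 1.29704 \<le> (a11 - 0.952) * (a22 + 0.952)"
    by (rule mult_mono'; use b in simp)+
  then have neg: "q 0.173 < 0" "q (- 0.952) < 0" using o(2) by (simp_all add: q_def)
  have cq: "continuous_on S q" for S unfolding q_def[abs_def] by (intro continuous_intros)
  obtain x where x: "0.173 \<le> x" "x \<le> 0.193" "q x = 0"
    using IVT'[of q "0.173" 0 "0.193", OF _ _ _ cq] pos neg by auto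
  obtain y where y: "- 0.966 \<le> y" "y \<le> - 0.952" "q y = 0"
    using IVT2'[of q "- 0.952" 0 "- 0.966", OF _ _ _ cq] pos neg by auto
  have ev: "\<exists>v. v \<noteq> 0 \<and> step v + mirror (sg v) = (2 * z) *\<^sub>R v" if "q z = 0" "z \<noteq> 1" for z
    using that b by (intro eigen_average[OF e]) (auto simp: q_def as algebra_simps)
  obtain v where v: "v \<noteq> 0" "step v + mirror (sg v) = (2 * x) *\<^sub>R v" using ev[of x] x by auto
  obtain w where w: "w \<noteq> 0" "step w + mirror (sg w) = (2 * y) *\<^sub>R w" using ev[of y] y by auto
  define s t where "s = arccos x" and "t = arccos y"
  have cs: "cos s = x" "cos t = y" using x y by (simp_all add: s_def t_def)
  have sn: "sin s \<noteq> 0" "sin t \<noteq> 0" using x y by (auto simp: s_def t_def sin_arccos_nonzero)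
  \<comment> \<open>\<open>cos (6 * t)\<close> as a polynomial in the square of
    \<open>cos t\<close>. The value -0.35 will separate the two pairs of eigenvalues.\<close>
  define T where "T z = 32 * z ^ 3 - 48 * z\<^sup>2 + 18 * z - (1 :: real)" for z
  have c6: "cos (6 * s) = T (x\<^sup>2)" "cos (6 * t) = T (y\<^sup>2)"
    unfolding cos_6 cs T_def by (simp_all add: power_mult[symmetric])
  have X2: "0.0299 \<le> x\<^sup>2" "x\<^sup>2 \<le> 0.0373"
    using mult_mono'[of "0.173" x "0.173" x] mult_mono'[of x "0.193" x "0.193"] x by (simp_all add: power2_eq_square)
  have Y2: "0.906 \<le> y\<^sup>2" "y\<^sup>2 \<le> 0.9332"
    using mult_mono'[of "0.952" "- y" "0.952" "- y"] mult_mono'[of "- y" "0.966" "- y" "0.966"] y by (simp_all add: power2_eq_square)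
  have "- 1 < T u \<and> T u < - 0.35" if "0.0299 \<le> u" "u \<le> 0.0373" for u
  proof -
    have "u * u \<le> 0.0373 * 0.0373" "0.0299 * 0.0299 \<le> u * u" "u * u * u \<le> 0.0373 * 0.0373 * 0.0373"
        "0.0299 * 0.0299 * 0.0299 \<le> u * u * u"
      using that by (intro mult_mono'; simp)+
    then show ?thesis using that by (simp add: T_def power2_eq_square power3_eq_cube)
  qed
  then have Tx: "- 1 < T (x\<^sup>2)" "T (x\<^sup>2) < - 0.35" using X2 by blast+
  \<comment> \<open>For arguments near 0.92 the terms of \<open>T\<close> largely cancel, which a
    termwise estimate does not see; monotonicity reduces the bounds to the two ends of the
    interval.\<close>
  have mono: "T z \<le> T z'" if "0.906 \<le> z" "z \<le> z'" "z' \<le> 0.9332" for z z'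
  proof -
    have "0.906 * 0.906 \<le> z * z" "0.906 * 0.906 \<le> z * z'" "0.906 * 0.906 \<le> z' * z'"
      using that by (intro mult_mono; simp)+
    then have "0 \<le> (z' - z) * (32 * (z' * z' + z * z' + z * z) - 48 * (z + z') + 18)"
      using that by (intro mult_nonneg_nonneg) auto
    then show ?thesis by (simp add: T_def algebra_simps power2_eq_square power3_eq_cube)
  qed
  have "T 0.906 \<le> T (y\<^sup>2)" "T (y\<^sup>2) \<le> T 0.9332" by (rule mono; use Y2 in simp)+
  then have Ty: "- 0.35 < T (y\<^sup>2)" "T (y\<^sup>2) < 1" by (simp_all add: T_def power2_eq_square power3_eq_cube)
  have sin6: "sin r \<noteq> 0" if "- 1 < cos r" "cos r < 1" for r :: real
  proof
    assume "sin r = 0"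
    then have "(cos r)\<^sup>2 = 1" using sin_cos_squared_add[of r] by simp
    then show False using that unfolding power2_eq_1_iff by auto
  qed
  show ?thesis
  proof (rule monodromy_stable[of e1 "6 * s" "6 * t"])
    show "e1 \<noteq> 0" by (simp add: phase_eq_iff)
    show "sin (6 * s) \<noteq> 0" "sin (6 * t) \<noteq> 0" by (rule sin6; use Tx Ty in \<open>simp add: c6\<close>)+
    show "cos (6 * s) \<noteq> cos (6 * t)" using Tx Ty by (simp add: c6)
  qed (rule e rotation_eigenvalues[OF v(2)[folded cs] v(1) sn(1)] rotation_eigenvalues[OF w(2)[folded cs] w(1) sn(2)])+
qed

end

section \<open>Enclosures along the orbit\<close>

definition comps :: "phase \<Rightarrow> real list" where
  "comps x = [x $ Inl 1, x $ Inl 2, x $ Inl 3, x $ Inr 1, x $ Inr 2, x $ Inr 3]"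

abbreviation encs :: "real \<Rightarrow> tm list \<Rightarrow> real list \<Rightarrow> bool" where
  "encs \<theta> \<equiv> list_all2 (enc \<theta>)"

definition tminus :: "tm \<Rightarrow> tm" where "tminus A = tscale (- 1) A"

definition tsquares :: "nat \<Rightarrow> tm list \<Rightarrow> tm list" where
  "tsquares n X = [tmul n 49 (X ! 0) (X ! 0), tmul n 49 (X ! 1) (X ! 1), tmul n 49 (X ! 2) (X ! 2)]"

definition tmomenta :: "nat \<Rightarrow> tm list \<Rightarrow> tm list" where
  "tmomenta n X = [tadd (tmul n 46 (X ! 3) (X ! 3)) ([- (2 ^ 47)], 0),
     tadd (tmul n 46 (X ! 4) (X ! 4)) ([- (2 ^ 47)], 0), tadd (tmul n 46 (X ! 5) (X ! 5)) ([- (2 ^ 47)], 0)]"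

definition tpairs :: "nat \<Rightarrow> tm list \<Rightarrow> tm list" where
  "tpairs n q = [tmul n 46 (q ! 1) (q ! 2), tmul n 46 (q ! 0) (q ! 2), tmul n 46 (q ! 0) (q ! 1)]"

definition tself :: "nat \<Rightarrow> tm list \<Rightarrow> tm list" where
  "tself n q = [tmul n 46 (q ! 0) (q ! 0), tmul n 46 (q ! 1) (q ! 1), tmul n 46 (q ! 2) (q ! 2)]"

definition tpot :: "tm list \<Rightarrow> tm" where
  "tpot U = tadd (tadd (tadd (tadd (U ! 0) (U ! 1)) (U ! 2)) (U ! 3)) ([- (2 ^ 48)], 0)"

definition tpow :: "nat \<Rightarrow> tm list \<Rightarrow> tm list \<Rightarrow> tm list" where
  "tpow n U V = [tmul n 46 (U ! 0) (V ! 0), tmul n 46 (U ! 1) (V ! 1), tmul n 46 (U ! 2) (V ! 2), tmul n 46 (U ! 3) (V ! 3)]"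

definition tcubs :: "tm list \<Rightarrow> tm list" where
  "tcubs c = [tadd (tadd (c ! 0) (c ! 1)) (c ! 2), tadd (tadd (c ! 0) (c ! 1)) (c ! 3), tadd (tadd (c ! 0) (c ! 2)) (c ! 3)]"

definition tslope :: "nat \<Rightarrow> tm \<Rightarrow> tm \<Rightarrow> tm \<Rightarrow> tm \<Rightarrow> tm \<Rightarrow> tm \<Rightarrow> tm \<Rightarrow> tm" where
  "tslope n b c bc as v w W = tadd (tadd (tmul n 46 v c) (tmul n 46 w b))
     (tscale (- 2) (tmul n 46 bc (tadd W (tminus as))))"

definition tslopes :: "nat \<Rightarrow> tm list \<Rightarrow> tm list \<Rightarrow> tm list \<Rightarrow> tm list \<Rightarrow> tm \<Rightarrow> tm list" where
  "tslopes n q p m s W = [tslope n (q ! 1) (q ! 2) (m ! 0) (s ! 0) (p ! 1) (p ! 2) W,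
     tslope n (q ! 0) (q ! 2) (m ! 1) (s ! 1) (p ! 0) (p ! 2) W, tslope n (q ! 0) (q ! 1) (m ! 2) (s ! 2) (p ! 0) (p ! 1) W]"

definition tzip :: "nat \<Rightarrow> tm list \<Rightarrow> tm list \<Rightarrow> tm list" where
  "tzip n a c = [tmul n 46 (a ! 0) (c ! 0), tmul n 46 (a ! 1) (c ! 1), tmul n 46 (a ! 2) (c ! 2)]"

definition tfield2 :: "nat \<Rightarrow> int \<Rightarrow> tm list \<Rightarrow> tm list \<Rightarrow> tm list \<Rightarrow> tm list" where
  "tfield2 n T X m sl = [tmul n 46 ([128 * T], 0) (tmul n 46 (X ! 3) (m ! 0)),
     tmul n 46 ([128 * T], 0) (tmul n 46 (X ! 4) (m ! 1)), tmul n 46 ([128 * T], 0) (tmul n 46 (X ! 5) (m ! 2)),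
     tmul n 46 ([- (16 * T)], 0) (tmul n 46 (X ! 0) (sl ! 0)),
     tmul n 46 ([- (16 * T)], 0) (tmul n 46 (X ! 1) (sl ! 1)),
     tmul n 46 ([- (16 * T)], 0) (tmul n 46 (X ! 2) (sl ! 2))]"

definition tfield1 :: "nat \<Rightarrow> int \<Rightarrow> tm list \<Rightarrow> tm list \<Rightarrow> tm list \<Rightarrow> tm list \<Rightarrow> tm list" where
  "tfield1 n T X q m U = tfield2 n T X m
     (tslopes n q (tmomenta n X) m (tzip n (tself n q) (tcubs (tpow n U (tpow n U U)))) (tpot U))"

definition tfield :: "nat \<Rightarrow> int \<Rightarrow> tm list \<Rightarrow> tm list \<Rightarrow> tm list \<Rightarrow> tm list" where
  "tfield n T X U q = tfield1 n T X q (tpairs n q) U"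

definition tcurv :: "nat \<Rightarrow> tm \<Rightarrow> tm \<Rightarrow> tm \<Rightarrow> tm \<Rightarrow> tm \<Rightarrow> tm \<Rightarrow> tm" where
  "tcurv n sl a abc s aa f = tadd sl (tscale 12 (tmul n 46 (tmul n 46 a abc) (tadd s (tminus (tmul n 46 aa f)))))"

definition tmixed :: "nat \<Rightarrow> tm \<Rightarrow> tm \<Rightarrow> tm \<Rightarrow> tm \<Rightarrow> tm \<Rightarrow> tm \<Rightarrow> tm \<Rightarrow> tm \<Rightarrow> tm \<Rightarrow> tm" where
  "tmixed n c W as bs w abc ab r s = tadd (tadd w (tscale (- 2) (tmul n 46 c (tadd (tadd W (tminus as)) (tminus bs)))))
     (tscale (- 6) (tmul n 46 (tmul n 46 abc ab) (tadd r s)))"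

text \<open>The fifteen entries follow the order of \<open>jac\<close>. Intermediate series are
  parameters instead of subterms, so that each is computed once and shared; the definitions down to
  \<open>tjac\<close> supply them one after another.\<close>

definition tjac3 :: "nat \<Rightarrow> int \<Rightarrow> tm list \<Rightarrow> tm list \<Rightarrow> tm list \<Rightarrow> tm list \<Rightarrow> tm list \<Rightarrow> tm list \<Rightarrow> tm list \<Rightarrow> tm
    \<Rightarrow> tm list \<Rightarrow> tm list \<Rightarrow> tm list \<Rightarrow> tm \<Rightarrow> tm list" where
  "tjac3 n T X q m p aa c s W z f5 sl abc = [
     tmul n 46 ([128 * T], 0) (m ! 0), tmul n 46 ([128 * T], 0) (m ! 1), tmul n 46 ([128 * T], 0) (m ! 2),
     tmul n 46 ([32 * T], 0) (tmul n 46 (X ! 3) (tmul n 46 (X ! 1) (q ! 2))),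
     tmul n 46 ([32 * T], 0) (tmul n 46 (X ! 3) (tmul n 46 (X ! 2) (q ! 1))),
     tmul n 46 ([32 * T], 0) (tmul n 46 (X ! 4) (tmul n 46 (X ! 0) (q ! 2))),
     tmul n 46 ([32 * T], 0) (tmul n 46 (X ! 4) (tmul n 46 (X ! 2) (q ! 0))),
     tmul n 46 ([32 * T], 0) (tmul n 46 (X ! 5) (tmul n 46 (X ! 0) (q ! 1))),
     tmul n 46 ([32 * T], 0) (tmul n 46 (X ! 5) (tmul n 46 (X ! 1) (q ! 0))),
     tmul n 46 ([16 * T], 0) (tcurv n (sl ! 0) (q ! 0) abc (s ! 0) (aa ! 0) (tadd (tadd (f5 ! 0) (f5 ! 1)) (f5 ! 2))),
     tmul n 46 ([16 * T], 0) (tcurv n (sl ! 1) (q ! 1) abc (s ! 1) (aa ! 1) (tadd (tadd (f5 ! 0) (f5 ! 1)) (f5 ! 3))),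
     tmul n 46 ([16 * T], 0) (tcurv n (sl ! 2) (q ! 2) abc (s ! 2) (aa ! 2) (tadd (tadd (f5 ! 0) (f5 ! 2)) (f5 ! 3))),
     tmul n 46 ([4 * T], 0) (tmul n 46 (tmul n 46 (X ! 0) (X ! 1))
       (tmixed n (q ! 2) W (z ! 0) (z ! 1) (p ! 2) abc (m ! 2) (f5 ! 0) (f5 ! 1))),
     tmul n 46 ([4 * T], 0) (tmul n 46 (tmul n 46 (X ! 0) (X ! 2))
       (tmixed n (q ! 1) W (z ! 0) (z ! 2) (p ! 1) abc (m ! 1) (f5 ! 0) (f5 ! 2))),
     tmul n 46 ([4 * T], 0) (tmul n 46 (tmul n 46 (X ! 1) (X ! 2))
       (tmixed n (q ! 0) W (z ! 1) (z ! 2) (p ! 0) abc (m ! 0) (f5 ! 0) (f5 ! 3)))]"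

definition tjac2 :: "nat \<Rightarrow> int \<Rightarrow> tm list \<Rightarrow> tm list \<Rightarrow> tm list \<Rightarrow> tm list \<Rightarrow> tm list \<Rightarrow> tm list \<Rightarrow> tm list \<Rightarrow> tm
    \<Rightarrow> tm list \<Rightarrow> tm list \<Rightarrow> tm list" where
  "tjac2 n T X q m p aa c s W z f5 = tjac3 n T X q m p aa c s W z f5 (tslopes n q p m z W) (tmul n 46 (q ! 0) (m ! 0))"

definition tjac1 :: "nat \<Rightarrow> int \<Rightarrow> tm list \<Rightarrow> tm list \<Rightarrow> tm list \<Rightarrow> tm list \<Rightarrow> tm list \<Rightarrow> tm list \<Rightarrow> tm list \<Rightarrow> tm list \<Rightarrow> tm \<Rightarrow> tm list" where
  "tjac1 n T X q m p aa u2 c s W = tjac2 n T X q m p aa c s W (tzip n aa s) (tpow n u2 c)"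

definition tjac0 :: "nat \<Rightarrow> int \<Rightarrow> tm list \<Rightarrow> tm list \<Rightarrow> tm list \<Rightarrow> tm list \<Rightarrow> tm list \<Rightarrow> tm list" where
  "tjac0 n T X U q u2 c = tjac1 n T X q (tpairs n q) (tmomenta n X) (tself n q) u2 c (tcubs c) (tpot U)"

definition tjac' :: "nat \<Rightarrow> int \<Rightarrow> tm list \<Rightarrow> tm list \<Rightarrow> tm list \<Rightarrow> tm list \<Rightarrow> tm list" where
  "tjac' n T X U q u2 = tjac0 n T X U q u2 (tpow n U u2)"

definition tjac :: "nat \<Rightarrow> int \<Rightarrow> tm list \<Rightarrow> tm list \<Rightarrow> tm list \<Rightarrow> tm list" where
  "tjac n T X U q = tjac' n T X U q (tpow n U U)"

text \<open>A posteriori test of a proposed inverse square root. The first condition makes the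
  constant coefficient dominate the others, hence the series positive. The second measures how far
  its square times the radicand is from 1 and demands a radius that covers the resulting
  error.\<close>

definition isq_ok :: "nat \<Rightarrow> tm \<Rightarrow> tm \<Rightarrow> bool" where
  "isq_ok n u r \<longleftrightarrow> pnorm (fst u) < 2 * hd (fst u @ [0]) \<and>
     (let d = tnorm (tadd (tmul n 46 (tmul n 46 (fst u, 0) (fst u, 0)) r) ([- (2 ^ 46)], 0)) in
        d \<le> 2 ^ 45 \<and> pnorm (fst u) * d \<le> snd u * 2 ^ 46)"

definition rads_ok :: "nat \<Rightarrow> tm list \<Rightarrow> tm list \<Rightarrow> bool" where
  "rads_ok n U aa \<longleftrightarrow> isq_ok n (U ! 0) (tadd (tadd (aa ! 0) (aa ! 1)) (aa ! 2)) \<and>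
     isq_ok n (U ! 1) (tadd (aa ! 0) (aa ! 1)) \<and> isq_ok n (U ! 2) (tadd (aa ! 0) (aa ! 2)) \<and>
     isq_ok n (U ! 3) (tadd (aa ! 1) (aa ! 2))"

definition tcol :: "nat \<Rightarrow> tm list \<Rightarrow> tm list \<Rightarrow> tm list" where
  "tcol n A v = [
     tadd (tadd (tmul n 46 (A ! 3) (v ! 1)) (tmul n 46 (A ! 4) (v ! 2))) (tmul n 46 (A ! 0) (v ! 3)),
     tadd (tadd (tmul n 46 (A ! 5) (v ! 0)) (tmul n 46 (A ! 6) (v ! 2))) (tmul n 46 (A ! 1) (v ! 4)),
     tadd (tadd (tmul n 46 (A ! 7) (v ! 0)) (tmul n 46 (A ! 8) (v ! 1))) (tmul n 46 (A ! 2) (v ! 5)),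
     tminus (tadd (tadd (tadd (tadd (tmul n 46 (A ! 9) (v ! 0)) (tmul n 46 (A ! 12) (v ! 1))) (tmul n 46 (A ! 13) (v ! 2)))
       (tmul n 46 (A ! 5) (v ! 4))) (tmul n 46 (A ! 7) (v ! 5))),
     tminus (tadd (tadd (tadd (tadd (tmul n 46 (A ! 12) (v ! 0)) (tmul n 46 (A ! 10) (v ! 1))) (tmul n 46 (A ! 14) (v ! 2)))
       (tmul n 46 (A ! 3) (v ! 3))) (tmul n 46 (A ! 8) (v ! 5))),
     tminus (tadd (tadd (tadd (tadd (tmul n 46 (A ! 13) (v ! 0)) (tmul n 46 (A ! 14) (v ! 1))) (tmul n 46 (A ! 11) (v ! 2)))
       (tmul n 46 (A ! 4) (v ! 3))) (tmul n 46 (A ! 6) (v ! 4)))]"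

fun tdefect :: "tm list \<Rightarrow> int list list \<Rightarrow> int list" where
  "tdefect (f # fs) (p # ps) = tnorm (tadd f (psmul (- 1) (pder p), 0)) # tdefect fs ps"
| "tdefect _ _ = []"

fun ttrunc :: "nat \<Rightarrow> int \<Rightarrow> int list \<Rightarrow> tm" where
  "ttrunc n r a = (take n a, pnorm (drop n a) + r)"

definition wts :: "int list" where "wts = [69, 53, 30, 79, 82, 100]"

text \<open>The factor 100 undoes the scaling of the integer weights \<open>wts\<close>.\<close>

definition wbound :: "int \<Rightarrow> int list \<Rightarrow> bool" where
  "wbound c ds \<longleftrightarrow> list_all2 (\<lambda>d w. 100 * d \<le> c * w) ds wts"

definition rowsums :: "tm list \<Rightarrow> int list" where
  "rowsums A = [
     53 * tnorm (A ! 3) + 30 * tnorm (A ! 4) + 79 * tnorm (A ! 0),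
     69 * tnorm (A ! 5) + 30 * tnorm (A ! 6) + 82 * tnorm (A ! 1),
     69 * tnorm (A ! 7) + 53 * tnorm (A ! 8) + 100 * tnorm (A ! 2),
     69 * tnorm (A ! 9) + 53 * tnorm (A ! 12) + 30 * tnorm (A ! 13) + 82 * tnorm (A ! 5) + 100 * tnorm (A ! 7),
     69 * tnorm (A ! 12) + 53 * tnorm (A ! 10) + 30 * tnorm (A ! 14) + 79 * tnorm (A ! 3) + 100 * tnorm (A ! 8),
     69 * tnorm (A ! 13) + 53 * tnorm (A ! 14) + 30 * tnorm (A ! 11) + 79 * tnorm (A ! 4) + 82 * tnorm (A ! 6)]"

definition exact :: "int list list \<Rightarrow> tm list" where "exact = map (\<lambda>a. (a, 0))"

definition jac :: "real \<Rightarrow> phase \<Rightarrow> real list" where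
  "jac T x = map ((*) T) [cP x 2 3, cP x 1 3, cP x 1 2, cQ x 1 2 3, cQ x 1 3 2, cQ x 2 1 3, cQ x 2 3 1, cQ x 3 1 2, cQ x 3 2 1,
     cD x 1 2 3, cD x 2 1 3, cD x 3 1 2, cM x 1 2 3, cM x 1 3 2, cM x 2 3 1]"

section \<open>Soundness of the enclosures\<close>

lemma enc_mul: "enc \<theta> A v \<Longrightarrow> enc \<theta> B w \<Longrightarrow> enc \<theta> (tmul n 46 A B) (v * w)"
  using enc_tmul[of \<theta> A v B w n 46] by simp

lemma enc_sq8: "enc \<theta> A v \<Longrightarrow> enc \<theta> (tmul n 49 A A) (v\<^sup>2 / 8)"
  using enc_tmul[of \<theta> A v A v n 49] by (simp add: power2_eq_square)

lemma enc_minus: "enc \<theta> A v \<Longrightarrow> enc \<theta> (tminus A) (- v)"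
  using enc_tscale[of \<theta> A v "- 1"] by (simp add: tminus_def)

lemma enc_int: "c = k * 2 ^ 46 \<Longrightarrow> enc \<theta> ([c], 0) (of_int k)"
  using enc_const[of \<theta> c] by simp

text \<open>For \<open>t = V * V * v - 1\<close> one has \<open>isq v = V / sqrt (1 + t)\<close>,
  and \<open>1 / sqrt (1 + t)\<close> differs from 1 by at most \<open>\<bar>t\<bar>\<close> as long
  as \<open>\<bar>t\<bar> \<le> 1 / 2\<close>.\<close>

lemma enc_isq:
  assumes ok: "isq_ok n u r" and r: "enc \<theta> r v"
  shows "v > 0 \<and> enc \<theta> u (isq v)"
proof -
  obtain c e where u: "u = (c, e)" by fastforce
  let ?P = "of_int (pnorm c) / 2 ^ 46 :: real"
  define V where "V = Re (pev (cis \<theta>) c) / 2 ^ 46"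
  define E where "E = tadd (tmul n 46 (tmul n 46 (c, 0) (c, 0)) r) ([- (2 ^ 46)], 0)"
  define d where "d = real_of_int (tnorm E) / 2 ^ 46"
  have chk: "pnorm c < 2 * hd (c @ [0])" "tnorm E \<le> 2 ^ 45" "pnorm c * tnorm E \<le> e * 2 ^ 46"
    using ok by (auto simp: isq_ok_def u E_def Let_def)
  have Vpos: "V > 0"
  proof (cases c)
    case (Cons x xs)
    have "\<bar>Re (cis \<theta> * pev (cis \<theta>) xs)\<bar> \<le> of_int (pnorm xs)"
      using abs_Re_le_cmod[of "cis \<theta> * pev (cis \<theta>) xs"] norm_pev_le[of "cis \<theta>" xs] by (simp add: norm_mult)
    moreover have "of_int (pnorm xs) < real_of_int x" using chk(1) Cons by auto
    ultimately show ?thesis unfolding V_def Cons by simp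
  qed (use chk in auto)
  have "Re (pev (cis \<theta>) c) \<le> of_int (pnorm c)"
    using abs_Re_le_cmod[of "pev (cis \<theta>) c"] norm_pev_le[of "cis \<theta>" c] by simp
  then have VP: "V \<le> ?P" by (simp add: V_def divide_right_mono)
  have "enc \<theta> E (V * V * v + of_int (- 1))"
    unfolding E_def V_def by (intro enc_tadd enc_mul enc_exact r enc_int) simp
  from enc_tnorm[OF this] have V2: "\<bar>V * V * v - 1\<bar> \<le> d" by (simp add: d_def)
  have d: "d \<le> 1 / 2" using chk(2) by (simp add: d_def field_simps)
  have w: "V * V * v \<ge> 1 / 2" using V2 d by linarith
  have v: "v > 0"
  proof (rule ccontr)
    assume "\<not> v > 0"
    then have "V * V * v \<le> 0" by (intro mult_nonneg_nonpos) auto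
    then show False using w by simp
  qed
  define t where "t = V * V * v - 1"
  have t: "\<bar>t\<bar> \<le> d" "- (1/2) \<le> t" "t \<le> 1/2" using V2 d by (auto simp: t_def)
  have "sqrt (V * V * v) = V * sqrt v" using Vpos by (simp add: real_sqrt_mult)
  then have isq: "isq v = V / sqrt (1 + t)" using Vpos v by (simp add: isq_def t_def)
  have up: "1 / sqrt (1 + t) \<le> 1 + \<bar>t\<bar>"
  proof -
    have "1 \<le> (1 + \<bar>t\<bar>)\<^sup>2 * (1 + t)"
    proof (cases "t \<ge> 0")
      case True then show ?thesis by (smt (verit) mult_le_cancel_left1 one_le_power mult_mono)
    next
      case False
      define x where "x = - t"
      have x: "0 \<le> x" "x \<le> 1/2" using False t by (auto simp: x_def)
      have "x * x \<le> (1/2) * (1/2)" "x * (x * x) \<le> (1/2) * (x * x)" using x by (intro mult_mono; simp)+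
      moreover have "(1 + x)\<^sup>2 * (1 - x) = 1 + x - x * x - x * (x * x)" by (simp add: power2_eq_square algebra_simps)
      moreover have "x * x \<le> (1/2) * x" using x by (intro mult_right_mono) auto
      ultimately have "1 \<le> (1 + x)\<^sup>2 * (1 - x)" using x by linarith
      then show ?thesis using False by (simp add: x_def)
    qed
    then have "1 \<le> (1 + \<bar>t\<bar>) * sqrt (1 + t)"
      using real_sqrt_le_mono[of 1 "(1 + \<bar>t\<bar>)\<^sup>2 * (1 + t)"] by (simp add: real_sqrt_mult)
    then show ?thesis using t by (simp add: divide_le_eq)
  qed
  have low: "1 - \<bar>t\<bar> \<le> 1 / sqrt (1 + t)"
  proof -
    have "(1 - \<bar>t\<bar>)\<^sup>2 * (1 + t) \<le> 1"
    proof (cases "t \<ge> 0")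
      case True
      have "(1 - t) * (1 - t) * (1 + t) \<le> 1 * (1 - t) * (1 + t)" using True t by (intro mult_right_mono) auto
      also have "\<dots> = 1 - t * t" by (simp add: algebra_simps)
      also have "\<dots> \<le> 1" by simp
      finally show ?thesis using True by (simp add: power2_eq_square)
    next
      case False
      have "(1 + t)\<^sup>2 * (1 + t) \<le> 1 * 1" using False t by (intro mult_mono power_le_one) auto
      then show ?thesis using False by simp
    qed
    then have "(1 - \<bar>t\<bar>) * sqrt (1 + t) \<le> 1"
      using real_sqrt_le_mono[of "(1 - \<bar>t\<bar>)\<^sup>2 * (1 + t)" 1] t by (simp add: real_sqrt_mult)
    then show ?thesis using t by (simp add: le_divide_eq)
  qed
  have "isq v - V = V * (1 / sqrt (1 + t) - 1)" by (simp add: isq right_diff_distrib)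
  then have "\<bar>isq v - V\<bar> = V * \<bar>1 / sqrt (1 + t) - 1\<bar>" using Vpos by (simp add: abs_mult)
  also have "\<dots> \<le> V * d" using up low t(1) Vpos by (intro mult_left_mono) auto
  also have "\<dots> \<le> ?P * d" using VP t(1) by (intro mult_right_mono) auto
  also have "\<dots> = of_int (pnorm c * tnorm E) / 2 ^ 46 / 2 ^ 46" by (simp add: d_def)
  also have "\<dots> \<le> of_int (e * 2 ^ 46) / 2 ^ 46 / 2 ^ 46"
    using chk(3) by (intro divide_right_mono) (auto simp only: of_int_le_iff, auto)
  finally have "\<bar>isq v - V\<bar> \<le> of_int e / 2 ^ 46" by simp
  then show ?thesis using v by (simp add: enc_def u V_def field_simps abs_le_iff)
qed

lemma enc_cong: "enc \<theta> A v \<Longrightarrow> v = w \<Longrightarrow> enc \<theta> A w"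
  by simp

lemma nth_one: "(x # xs) ! 1 = xs ! 0"
  by simp

lemma list_all2_6: "list_all2 R X [a, b, c, d, e, f] \<Longrightarrow>
    R (X ! 0) a \<and> R (X ! 1) b \<and> R (X ! 2) c \<and> R (X ! 3) d \<and> R (X ! 4) e \<and> R (X ! 5) f"
  by (auto simp: list_all2_Cons2)

text \<open>The evaluation of series follows the formulas of \<open>field\<close> and
  \<open>dfield\<close> operation by operation. Membership in the domain comes along: the certified
  radicands are positive, hence no two of the \<open>Q\<close> vanish together.\<close>

lemma enc_field_jac:
  assumes X: "encs \<theta> X (comps x)" and ok: "rads_ok n U (tself n (tsquares n X))"
  shows "x \<in> Gam_domain"
    and "encs \<theta> (tfield n T X U (tsquares n X)) (map ((*) (of_int T / 2 ^ 46)) (comps (field x)))"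
    and "encs \<theta> (tjac n T X U (tsquares n X)) (jac (of_int T / 2 ^ 46) x)"
proof -
  define Q1 Q2 Q3 P1 P2 P3 where "Q1 = x $ Inl 1" "Q2 = x $ Inl 2" "Q3 = x $ Inl 3"
    "P1 = x $ Inr 1" "P2 = x $ Inr 2" "P3 = x $ Inr 3"
  note defs = this
  define a b c where "a = Q1\<^sup>2 / 8" "b = Q2\<^sup>2 / 8" "c = Q3\<^sup>2 / 8"
  note abc = this
  define u v w where "u = P1\<^sup>2 - 2" "v = P2\<^sup>2 - 2" "w = P3\<^sup>2 - 2"
  note uvw = this
  define q where "q = tsquares n X"
  define aa where "aa = tself n q"
  define p where "p = tmomenta n X"
  define m where "m = tpairs n q"
  define u2 where "u2 = tpow n U U"
  define u3 where "u3 = tpow n U u2"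
  define f5 where "f5 = tpow n u2 u3"
  define s where "s = tcubs u3"
  define W where "W = tpot U"
  define z where "z = tzip n aa s"
  define sl where "sl = tslopes n q p m z W"
  define d where "d = tmul n 46 (q ! 0) (m ! 0)"
  let ?T = "of_int T / 2 ^ 46 :: real"
  have X': "enc \<theta> (X ! 0) Q1" "enc \<theta> (X ! 1) Q2" "enc \<theta> (X ! 2) Q3"
      "enc \<theta> (X ! 3) P1" "enc \<theta> (X ! 4) P2" "enc \<theta> (X ! 5) P3"
    using list_all2_6[OF X[unfolded comps_def]] by (simp_all del: One_nat_def add: nth_one defs)
  have q: "enc \<theta> (q ! 0) a" "enc \<theta> (q ! 1) b" "enc \<theta> (q ! 2) c"
    unfolding q_def tsquares_def abc by (simp_all del: One_nat_def add: nth_one enc_sq8 X')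
  have aa: "enc \<theta> (aa ! 0) (a * a)" "enc \<theta> (aa ! 1) (b * b)" "enc \<theta> (aa ! 2) (c * c)"
    unfolding aa_def tself_def by (simp_all del: One_nat_def add: nth_one enc_mul q)
  have k2: "enc \<theta> ([- (2 ^ 47)], 0) (- 2)" and k4: "enc \<theta> ([- (2 ^ 48)], 0) (- 4)"
    using enc_int[of "- (2 ^ 47)" "- 2"] enc_int[of "- (2 ^ 48)" "- 4"] by simp_all
  have pm: "enc \<theta> (tadd (tmul n 46 A A) ([- (2 ^ 47)], 0)) (V\<^sup>2 - 2)" if "enc \<theta> A V" for A V
    using enc_tadd[OF enc_mul[OF that that] k2] by (simp add: power2_eq_square)
  have p: "enc \<theta> (p ! 0) u" "enc \<theta> (p ! 1) v" "enc \<theta> (p ! 2) w"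
    unfolding p_def tmomenta_def uvw
    by (simp_all del: One_nat_def add: nth_one pm[simplified] X')
  have m: "enc \<theta> (m ! 0) (b * c)" "enc \<theta> (m ! 1) (a * c)" "enc \<theta> (m ! 2) (a * b)"
    unfolding m_def tpairs_def by (simp_all del: One_nat_def add: nth_one enc_mul q)
  note oks = ok[folded q_def, folded aa_def, unfolded rads_ok_def, THEN conjunct1]
    ok[folded q_def, folded aa_def, unfolded rads_ok_def, THEN conjunct2, THEN conjunct1]
    ok[folded q_def, folded aa_def, unfolded rads_ok_def, THEN conjunct2, THEN conjunct2, THEN conjunct1]
    ok[folded q_def, folded aa_def, unfolded rads_ok_def, THEN conjunct2, THEN conjunct2, THEN conjunct2]
  have U: "a\<^sup>2 + b\<^sup>2 + c\<^sup>2 > 0 \<and> enc \<theta> (U ! 0) (r3 a b c)" "a\<^sup>2 + b\<^sup>2 > 0 \<and> enc \<theta> (U ! 1) (r2 a b)"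
     "a\<^sup>2 + c\<^sup>2 > 0 \<and> enc \<theta> (U ! 2) (r2 a c)" "b\<^sup>2 + c\<^sup>2 > 0 \<and> enc \<theta> (U ! 3) (r2 b c)"
    unfolding r2_def r3_def power2_eq_square
    by (rule enc_isq[OF oks(1) enc_tadd[OF enc_tadd[OF aa(1,2)] aa(3)]] enc_isq[OF oks(2) enc_tadd[OF aa(1,2)]]
        enc_isq[OF oks(3) enc_tadd[OF aa(1,3)]] enc_isq[OF oks(4) enc_tadd[OF aa(2,3)]])+
  show dom: "x \<in> Gam_domain"
    using U(2-4) unfolding Gam_domain_iff abc defs by (auto simp: power2_eq_square)
  note U = U[THEN conjunct2]
  have u2: "enc \<theta> (u2 ! 0) ((r3 a b c)^2)" "enc \<theta> (u2 ! 1) ((r2 a b)^2)" "enc \<theta> (u2 ! 2) ((r2 a c)^2)" "enc \<theta> (u2 ! 3) ((r2 b c)^2)"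
    unfolding u2_def tpow_def power2_eq_square by (simp_all del: One_nat_def add: nth_one enc_mul U)
  have r3: "r ^ 3 = r * r ^ 2" and r5: "r ^ 5 = r ^ 2 * r ^ 3" for r :: real
    by (simp_all del: One_nat_def add: nth_one power_numeral_reduce)
  have u3: "enc \<theta> (u3 ! 0) ((r3 a b c)^3)" "enc \<theta> (u3 ! 1) ((r2 a b)^3)" "enc \<theta> (u3 ! 2) ((r2 a c)^3)" "enc \<theta> (u3 ! 3) ((r2 b c)^3)"
    unfolding u3_def tpow_def r3 by (simp_all del: One_nat_def add: nth_one enc_mul U u2)
  have p5: "enc \<theta> (tmul n 46 A B) (r ^ 5)" if "enc \<theta> A (r\<^sup>2)" "enc \<theta> B (r ^ 3)" for A B r
    using enc_mul[OF that] unfolding r5 .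
  have f5: "enc \<theta> (f5 ! 0) ((r3 a b c)^5)" "enc \<theta> (f5 ! 1) ((r2 a b)^5)" "enc \<theta> (f5 ! 2) ((r2 a c)^5)" "enc \<theta> (f5 ! 3) ((r2 b c)^5)"
    unfolding f5_def tpow_def by (simp_all del: One_nat_def add: nth_one p5 u3 u2)
  have cub: "cub a b c = r3 a b c ^ 3 + r2 a b ^ 3 + r2 a c ^ 3" "cub b a c = r3 a b c ^ 3 + r2 a b ^ 3 + r2 b c ^ 3"
      "cub c a b = r3 a b c ^ 3 + r2 a c ^ 3 + r2 b c ^ 3"
    unfolding cub_def by (simp_all del: One_nat_def add: nth_one r3_commute r2_commute)
  have quin: "quin a b c = r3 a b c ^ 5 + r2 a b ^ 5 + r2 a c ^ 5" "quin b a c = r3 a b c ^ 5 + r2 a b ^ 5 + r2 b c ^ 5"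
      "quin c a b = r3 a b c ^ 5 + r2 a c ^ 5 + r2 b c ^ 5"
    unfolding quin_def by (simp_all del: One_nat_def add: nth_one r3_commute r2_commute)
  have s: "enc \<theta> (s ! 0) (cub a b c)" "enc \<theta> (s ! 1) (cub b a c)" "enc \<theta> (s ! 2) (cub c a b)"
    unfolding s_def tcubs_def cub by (simp_all del: One_nat_def add: nth_one enc_tadd u3)
  have W: "enc \<theta> W (pot a b c)"
    unfolding W_def tpot_def pot_def diff_conv_add_uminus[of _ 4]
    by (intro enc_tadd U k4)
  have z: "enc \<theta> (z ! 0) (a * a * cub a b c)" "enc \<theta> (z ! 1) (b * b * cub b a c)" "enc \<theta> (z ! 2) (c * c * cub c a b)"
    unfolding z_def tzip_def by (simp_all del: One_nat_def add: nth_one enc_mul aa s)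
  have pots: "pot b a c = pot a b c" "pot c a b = pot a b c"
    by (simp_all del: One_nat_def add: nth_one pot_def r3_commute r2_commute)
  have slope: "enc \<theta> (tslope n B C BC AS V W' W) (slope a b c v w)"
    if "enc \<theta> B b" "enc \<theta> C c" "enc \<theta> BC (b * c)" "enc \<theta> AS (a * a * cub a b c)" "enc \<theta> V v" "enc \<theta> W' w" "enc \<theta> W (pot a b c)"
    for B C BC AS V W' W a b c v w
    unfolding tslope_def slope_def
    by (rule enc_cong, (rule enc_tadd enc_mul enc_tscale enc_minus that)+) (simp add: power2_eq_square)
  have sl: "enc \<theta> (sl ! 0) (slope a b c v w)" "enc \<theta> (sl ! 1) (slope b a c u w)" "enc \<theta> (sl ! 2) (slope c a b u v)"
    unfolding sl_def tslopes_def
    using q p m z W by (simp_all del: One_nat_def add: nth_one slope pots)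
  have kc: "enc \<theta> ([k * T], 0) (of_int k * ?T)" for k
    using enc_const[of \<theta> "k * T"] by simp
  have kc16: "enc \<theta> ([- (16 * T)], 0) (- 16 * ?T)"
    using kc[of "- 16"] by simp
  have "encs \<theta> (tfield2 n T X m sl) (map ((*) ?T) (comps (field x)))"
    unfolding tfield2_def comps_def list.map list_all2_Cons list_all2_Nil field_def ph_nth defs[symmetric] abc[symmetric] uvw[symmetric]
    by (intro conjI refl) (rule enc_cong, (rule enc_mul kc kc16 X' m sl)+, simp)+
  then show "encs \<theta> (tfield n T X U (tsquares n X)) (map ((*) ?T) (comps (field x)))"
    unfolding tfield_def tfield1_def sl_def z_def s_def u3_def u2_def m_def p_def aa_def q_def W_def .
  have curv: "enc \<theta> (tcurv n SL A ABC S AA F) (curv a b c v w)"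
    if "enc \<theta> SL (slope a b c v w)" "enc \<theta> A a" "enc \<theta> ABC (a * b * c)" "enc \<theta> S (cub a b c)" "enc \<theta> AA (a * a)" "enc \<theta> F (quin a b c)"
    for SL A ABC S AA F a b c v w
    unfolding tcurv_def curv_def
    by (rule enc_cong, (rule enc_tadd enc_mul enc_tscale enc_minus that)+) (simp add: power2_eq_square)
  have mixed: "enc \<theta> (tmixed n C W AS BS W' ABC AB R S) (mixed a b c w)"
    if "enc \<theta> C c" "enc \<theta> W (pot a b c)" "enc \<theta> AS (a * a * cub a b c)" "enc \<theta> BS (b * b * cub b a c)" "enc \<theta> W' w"
      "enc \<theta> ABC (a * b * c)" "enc \<theta> AB (a * b)" "enc \<theta> R (r3 a b c ^ 5)" "enc \<theta> S (r2 a b ^ 5)"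
    for C W AS BS W' ABC AB R S a b c w
    unfolding tmixed_def mixed_def
    by (rule enc_cong, (rule enc_tadd enc_mul enc_tscale enc_minus that)+) (simp add: power2_eq_square)
  have d: "enc \<theta> d (a * b * c)"
    unfolding d_def mult.assoc by (intro enc_mul q m)
  have cD: "enc \<theta> (tcurv n (sl ! 0) (q ! 0) d (s ! 0) (aa ! 0) (tadd (tadd (f5 ! 0) (f5 ! 1)) (f5 ! 2))) (curv a b c v w)"
    "enc \<theta> (tcurv n (sl ! 1) (q ! 1) d (s ! 1) (aa ! 1) (tadd (tadd (f5 ! 0) (f5 ! 1)) (f5 ! 3))) (curv b a c u w)"
    "enc \<theta> (tcurv n (sl ! 2) (q ! 2) d (s ! 2) (aa ! 2) (tadd (tadd (f5 ! 0) (f5 ! 2)) (f5 ! 3))) (curv c a b u v)"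
    by (rule curv; (intro sl q s aa)?; simp del: One_nat_def add: quin enc_tadd f5 d mult_ac d[unfolded mult.assoc])+
  have mx: "enc \<theta> (tmixed n (q ! 2) W (z ! 0) (z ! 1) (p ! 2) d (m ! 2) (f5 ! 0) (f5 ! 1)) (mixed a b c w)"
    "enc \<theta> (tmixed n (q ! 1) W (z ! 0) (z ! 2) (p ! 1) d (m ! 1) (f5 ! 0) (f5 ! 2)) (mixed a c b v)"
    "enc \<theta> (tmixed n (q ! 0) W (z ! 1) (z ! 2) (p ! 0) d (m ! 0) (f5 ! 0) (f5 ! 3)) (mixed b c a u)"
  proof -
    have e: "pot a c b = pot a b c" "pot b c a = pot a b c" "cub a c b = cub a b c" "cub b c a = cub b a c" "cub c b a = cub c a b"
      "r3 a c b = r3 a b c" "r3 b c a = r3 a b c" "a * c * b = a * b * c" "b * c * a = a * b * c"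
      unfolding pot_def cub_def by (simp_all del: One_nat_def add: nth_one r3_commute r2_commute mult_ac)
    show "enc \<theta> (tmixed n (q ! 2) W (z ! 0) (z ! 1) (p ! 2) d (m ! 2) (f5 ! 0) (f5 ! 1)) (mixed a b c w)"
      by (rule mixed; simp only: e q W z p d m f5)
    show "enc \<theta> (tmixed n (q ! 1) W (z ! 0) (z ! 2) (p ! 1) d (m ! 1) (f5 ! 0) (f5 ! 2)) (mixed a c b v)"
      by (rule mixed; simp only: e q W z p d m f5)
    show "enc \<theta> (tmixed n (q ! 0) W (z ! 1) (z ! 2) (p ! 0) d (m ! 0) (f5 ! 0) (f5 ! 3)) (mixed b c a u)"
      by (rule mixed; simp only: e q W z p d m f5)
  qed
  have "encs \<theta> (tjac3 n T X q m p aa u3 s W z f5 sl d) (jac ?T x)"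
    unfolding tjac3_def jac_def list.map list_all2_Cons list_all2_Nil cP_def cQ_def cD_def cM_def defs[symmetric] abc[symmetric] uvw[symmetric]
    by (intro conjI refl) (rule enc_cong, (rule cD mx enc_mul kc X' m sl q)+, simp)+
  then show "encs \<theta> (tjac n T X U (tsquares n X)) (jac ?T x)"
    unfolding tjac_def tjac'_def tjac0_def tjac1_def tjac2_def sl_def d_def z_def s_def f5_def u3_def u2_def m_def p_def aa_def q_def W_def .
qed

text \<open>
  Numerically computed coefficients, in units of \<open>2 ^ - 46\<close> and with \<open>s = Tr / 2 * t\<close>, \<open>1 - t = cos \<theta>\<close>,
  of the orbit on \<open>0 \<le> s \<le> Tr\<close> and of four solutions of its linearised equation.
\<close>

definition Tn :: "int" where "Tn =
   731450239209"

definition orbit :: "int list list" where "orbit =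
   [[94022879418306, - 92554929922553, - 2429442239200, 1331187818834, - 428579663444, 47972216495, 19128269682, - 9757678046, 1367415937, 345684301, - 211936822, 39605700, 4695424, - 4795746, 1163011, 25968, - 108032, 33392, - 1622, - 2390, 931, - 96, - 54, 24],
    [207880949745878, 16061982290074, - 7408613636658, 1895036864978, - 215063865989, - 33191936203, 30786585251, - 6872859149, - 276065593, 619121793, - 181494972, 7595764, 12897466, - 4850405, 478077, 259874, - 125996, 18729, 4797, - 3197, 629, 73, - 78, 17],
    [222279402113707, - 5477575336046, 1080868089762, 616392472156, - 316850875549, 7906463803, 20655133502, - 6091632637, 235007144, 367180120, - 135191528, 13806904, 6444724, - 3207807, 519634, 97303, - 76966, 17356, 931, - 1841, 531, - 13, - 44, 14],
    [97287530092352, 4539232106948, - 3643036827419, 1611823838915, - 241553867083, - 77602577581, 48325408153, - 7366063927, - 1810488604, 1087850053, - 188179000, - 27044160, 23311550, - 5411529, - 132714, 515091, - 164595, 8587, 12421, - 4838, 394, 315, - 122, 8],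
    [- 61161515518087, 20429194513760, - 6661724699052, - 129546744128, 642373621878, - 121301377786, - 7763109123, 12436069716, - 3259673396, - 27256500, 284255507, - 85818587, 2504181, 6437803, - 2196877, 135584, 142581, - 55077, 4992, 3046, - 1344, 160, 66, - 30],
    [31378643505783, 22960820929463, - 8292644406671, 628211202664, 411112424878, - 92859467665, 4593887769, 4242237053, - 1332828329, 122050471, 33618404, - 19219019, 5614444, - 543674, - 430489, 221966, - 28892, - 13109, 6612, - 728, - 356, 158, - 13, - 7]]"

text \<open>Numerical candidates for \<open>r3 a b c\<close>, \<open>r2 a b\<close>,
  \<open>r2 a c\<close> and \<open>r2 b c\<close> along the orbit; \<open>orbit_rads\<close>
  certifies both the series and the radii.\<close>

definition invs :: "tm list" where "invs =
   [([40764669587441, 901477797848, - 244382977516, - 83782183462, 73512202913, - 9393013522, - 5431497986, 1989123394, - 112222497, - 121773633, 44449570, - 3119360, - 2609662, 997212, - 83607, - 53268, 21885, - 2258, - 1021, 473, - 61, - 18, 11, 0], 176),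
    ([58979490439555, - 442921922727, - 103387952068, 105286330937, 32971835641, - 24653690929, - 2363689368, 2424092757, - 574632247, - 64079571, 82653146, - 19064487, - 2078209, 2485965, - 561584, - 61825, 69830, - 15103, - 1806, 1862, - 379, - 52, 48, - 6], 263),
    ([53722141437943, 6915079320508, - 2119784963205, - 221733209486, 287953288675, - 20726264194, - 22124377215, 5058626739, 882443790, - 521633398, 18662164, 33818877, - 6140978, - 1406541, 558437, 32889, - 38045, - 152, 2915, - 136, - 268, 44, 23, - 7], 326),
    ([42307719560118, - 1539340529203, 919232825224, - 363744353030, 76143464620, 4386948578, - 7850522872, 2080762341, - 88123697, - 110662786, 40866758, - 4823828, - 1394075, 759239, - 130712, - 14747, 14024, - 3205, - 72, 268, - 77, 3, 6, - 1], 173)]"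

text \<open>The same functions with radii wide enough for every point of the tube.\<close>

definition invs2 :: "tm list" where "invs2 =
   [([40764669587441, 901477797848, - 244382977516, - 83782183462, 73512202913, - 9393013522, - 5431497986, 1989123394, - 112222497, - 121773634, 44449571, - 3119343, - 2609683, 997047, - 83376, - 52575], 8926806),
    ([58979490439555, - 442921922727, - 103387952068, 105286330937, 32971835641, - 24653690929, - 2363689368, 2424092757, - 574632246, - 64079568, 82653126, - 19064461, - 2078000, 2485064, - 561609, - 56290], 15630004),
    ([53722141437943, 6915079320508, - 2119784963205, - 221733209486, 287953288675, - 20726264193, - 22124377216, 5058626739, 882443794, - 521633405, 18662133, 33818976, - 6140775, - 1407388, 557215, 40706], 18196006),
    ([42307719560118, - 1539340529203, 919232825224, - 363744353030, 76143464620, 4386948578, - 7850522872, 2080762341, - 88123697, - 110662790, 40866770, - 4823833, - 1394206, 759798, - 131911, - 13032], 8754643)]"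

text \<open>\<open>tube\<close> and \<open>jacs\<close> are stored results of \<open>ttrunc\<close>
  and \<open>tjac\<close>, so that the later evaluations start from literals.\<close>

definition tube :: "tm list" where "tube =
   [([94022879418306, - 92554929922553, - 2429442239200, 1331187818834, - 428579663444, 47972216495, 19128269682, - 9757678046, 1367415937, 345684301, - 211936822, 39605700, 4695424, - 4795746, 1163011, 25968], 7183416),
    ([207880949745878, 16061982290074, - 7408613636658, 1895036864978, - 215063865989, - 33191936203, 30786585251, - 6872859149, - 276065593, 619121793, - 181494972, 7595764, 12897466, - 4850405, 478077, 259874], 7190391),
    ([222279402113707, - 5477575336046, 1080868089762, 616392472156, - 316850875549, 7906463803, 20655133502, - 6091632637, 235007144, 367180120, - 135191528, 13806904, 6444724, - 3207807, 519634, 97303], 7134571),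
    ([97287530092352, 4539232106948, - 3643036827419, 1611823838915, - 241553867083, - 77602577581, 48325408153, - 7366063927, - 1810488604, 1087850053, - 188179000, - 27044160, 23311550, - 5411529, - 132714, 515091], 7228155),
    ([- 61161515518087, 20429194513760, - 6661724699052, - 129546744128, 642373621878, - 121301377786, - 7763109123, 12436069716, - 3259673396, - 27256500, 284255507, - 85818587, 2504181, 6437803, - 2196877, 135584], 7244171),
    ([31378643505783, 22960820929463, - 8292644406671, 628211202664, 411112424878, - 92859467665, 4593887769, 4242237053, - 1332828329, 122050471, 33618404, - 19219019, 5614444, - 543674, - 430489, 221966], 7086750)]"

definition jacs :: "tm list" where "jacs =
   [([127380163175874, 13274353535046, - 7795897384502, 2943601303646, - 502931578209, - 114248391183, 89536220019, - 18633124838, - 1812414054, 2234159053, - 608896891, 3637660, 54971314, - 19139417, 1474977, 1270776], 21466110),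
    ([40019509502274, - 53069299728562, 12364661596860, 1297539609111, - 844725408220, 254242383136, - 6072791378, - 22919384055, 7935334433, - 528558825, - 535715724, 227443815, - 28142231, - 11366730, 6439996, - 1193661], 15681932),
    ([30302848203874, - 37096056294174, 3718207440742, 4042604420474, - 1094311085279, 86767741688, 66424704311, - 32256508057, 5211075175, 1290017953, - 926394027, 196534128, 18638839, - 24861031, 6822743, - 63967], 16492287),
    ([119184168533678, 8811824319817, - 7578904490337, 3695923352865, - 657472658016, - 191876679445, 134509031799, - 24833976104, - 4566323040, 3804432426, - 874231242, - 59984974, 102734034, - 29624481, 510303, 2640532], 24937787),
    ([112179148614500, 18927945387214, - 10858987754984, 3548685366708, - 243321774809, - 299536623891, 137732924594, - 14951209458, - 8487491410, 4209143889, - 635693267, - 181247924, 122673222, - 25199170, - 2956617, 3461185], 25582929),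
    ([- 40627167397397, 48727194961801, - 9692612057410, 1051252100939, 896878544456, - 411160771077, 43401135288, 22175404006, - 12279611802, 2143788000, 459185601, - 366012149, 80997557, 7315146, - 10195249, 2850118], 19642535),
    ([- 26771608560951, 38344947797458, - 13311496224185, 1571985867291, 483048346173, - 410003918069, 92261095982, 9923877266, - 12213228796, 3370656146, 20801091, - 339679059, 115678610, - 6839049, - 8826458, 3747248], 17053143),
    ([10022671570345, - 1402306552476, - 10659508870618, 1726760769979, 601114177525, - 338946134384, 43894814804, 13042826216, - 8442839300, 1701713139, 179300180, - 215195048, 58862722, - 887120, - 5279589, 1997817], 15044117),
    ([4924691885075, - 2923889467406, - 4833934799541, 3184476999258, - 179786154220, - 255900213327, 95032358585, - 7150275119, - 5743982103, 2628026689, - 368174675, - 113940263, 72601830, - 14701102, - 1637256, 1983916], 13112177),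
    ([33903248392121, - 55167013451867, 15618673813595, 5128317287666, - 5078442091882, 851415838043, 416192392200, - 213628084874, 20375606539, 15167966420, - 6498852134, 693317990, 347375020, - 191790944, 39259513, 5335322], 479252819),
    ([39014263963960, - 51286288282087, 10578753864263, 3332478118558, - 2413747812887, 917858072281, - 95992049798, - 86696017799, 49212327158, - 8849981419, - 2536667801, 1991122777, - 430237933, - 71429755, 72031951, - 17327813], 454316891),
    ([32459236703320, - 40729546627165, 5451849286024, 4129659303354, - 1617262314798, 258438561541, 104354790400, - 67782744097, 7501720334, 5468521955, - 1946235424, - 144895580, 202833213, - 17043620, - 15805407, 3039420], 663344077),
    ([43390385737978, - 34983833618470, - 10845741517876, 2110820632956, 852999964339, - 653157524705, 90892972861, 71032043162, - 40164584070, 4661605971, 3674149518, - 1838912170, 174394053, 155175545, - 69164571, 5908139], 351788433),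
    ([53441736151049, - 50871603380229, - 3663375498939, 1431924686532, - 508565977922, 268883845575, - 114807150263, 1086126845, 22634516034, - 8217536098, - 636153842, 1219162889, - 245228048, - 69296941, 40417257, - 3062655], 494594777),
    ([46809547179479, - 56172551812640, 3721571056443, 7172756084424, - 1547930651181, - 133347986775, 198165400540, - 49185376755, - 3124953649, 5571995610, - 1603469724, 41932438, 136996416, - 54298210, 5945613, 3484554], 332511189)]"

text \<open>The series \<open>col_a\<close> to \<open>col_d\<close> start exactly at
  \<open>ua\<close>, \<open>ub\<close>, \<open>v1\<close>, \<open>v2\<close>; the first two
  approximate the derivatives of the orbit in \<alpha> and \<beta>.\<close>

definition col_a :: "int list list" where "col_a =
   [[89040187509239, - 68924714887765, - 26863947582287, 7913146613550, - 1048912949116, - 314415420953, 258823707847, - 59829583321, - 6357100362, 8011692866, - 2104130467, - 41059223, 217764521, - 71861262, 1484135, 5802598],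
    [35765677580431, 53586562911303, - 24011447179470, 5151256877494, 281509792468, - 597813543052, 217870431335, - 13483075273, - 17791878556, 7563209644, - 928624668, - 431088437, 245538643, - 43116328, - 10861251, 7203381],
    [75739004447721, - 4925822827924, - 3264922861490, 3850297747081, - 863568262155, - 322903216763, 187190946671, - 25433394719, - 9546106548, 5513507552, - 1009539105, - 177934802, 159011109, - 38557249, - 3144820, 4363105],
    [- 55472197250850, 78236696911714, - 25513656258260, 2266003393012, 1232724012879, - 989456408151, 232762882123, 35022199379, - 36002384684, 8133329297, 707864895, - 990898771, 272408854, - 2695579, - 25761059, 8655201],
    [- 26693348439493, 34955075219518, - 4915854697824, - 5930668938002, 2843906692600, - 90951418838, - 255676097145, 100168857231, - 7744920383, - 7878522635, 3467586719, - 363588053, - 223851205, 108967416, - 10581838, - 6268068],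
    [- 34014371257525, 47460837694315, - 12573257486638, - 2817453284602, 2257330763964, - 270938166819, - 78647114381, 44260032391, - 7628120030, - 686171807, 774510110, - 271593894, 45187587, 14125767, - 11379751, 2261313]]"

definition col_b :: "int list list" where "col_b =
   [[- 9534446195365, 14067820931558, - 5163564304210, 429341220337, 270053868437, - 80047878864, 8176082201, 4548036095, - 2192448042, 232173439, 127445439, - 56477893, 5616730, 3148964, - 1351959, 133133],
    [- 9335166586683, 13659026268170, - 4827833344044, 284865036857, 272666012866, - 57049277108, 47817125, 4869695728, - 1543285260, 30758857, 123205287, - 39856811, 1404171, 3122502, - 994030, 22373],
    [9741719631372, - 14449210355143, 5506313179000, - 736521915276, - 70652449572, 13304441116, - 7903781161, 3565792167, - 515959514, - 190229245, 113477722, - 21002627, - 3052188, 2886438, - 629130, - 33959],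
    [- 16935262667038, 21643501140840, - 3792223955782, - 1236888889394, 363452465612, - 24658571367, - 27129828426, 9593893739, 499677779, - 1132634358, 221911437, 57966980, - 35642610, 3734438, 2214114, - 815964],
    [- 63000535613831, - 11407719990897, 5114638148904, - 1129773062350, 7452595100, 66440099439, - 21088245157, 1224968852, 832554464, - 215033728, - 12749101, 11891710, 2214663, - 2409136, 209682, 243722],
    [75967894278698, - 8394977363065, 3280900520624, - 376939683648, - 161018616413, 56991988569, 311385347, - 5881217176, 1420440654, 181224510, - 163465536, 19012533, 7930125, - 2076328, - 270570, 89340]]"

definition col_c :: "int list list" where "col_c =
   [[4950299178892, - 7797501425417, 3637414428318, - 773717369254, - 91062595022, 95529200718, - 22755347467, 373436355, 2170874967, - 891871770, 115630969, 50579128, - 31120988, 6066028, 1306542, - 971999],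
    [76251890743992, - 8961886774204, 3765633571176, - 649471606836, - 97684495519, 79881388750, - 18951429303, - 3157760887, 3265613273, - 789697129, - 58683152, 100383893, - 29227820, 194911, 2868346, - 911827],
    [- 68449458381548, - 2284644064967, - 152667622891, 837822933900, - 371104432494, 45697796807, 11121642280, - 7068841147, 1725455955, - 98667392, - 114331671, 55691086, - 11378602, - 1176533, 1650719, - 451166],
    [186031285889, - 248943389810, 1449186597, 159545066741, - 164006373490, 90229163629, - 26794652387, 26308138, 3853017905, - 1591590194, 99225440, 160328311, - 64136889, 2409401, 5947785, - 1797066],
    [1739502603620, - 1493299536122, - 1343661763583, 1576471934088, - 472813553716, - 62216733053, 74693542987, - 19228943984, - 1096686662, 2255664739, - 648392725, - 2530943, 62901743, - 20198368, - 26311, 1718290],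
    [- 7942804386646, 12010010537670, - 4955786684752, 909432443412, - 12350043395, - 13861081369, 7861277769, - 3385854997, 820688103, 239152830, - 219461950, 33942439, 16808265, - 8197641, 219878, 640384]]"

definition col_d :: "int list list" where "col_d =
   [[6974944588367, - 10847276977931, 4778749410800, - 746783661397, - 307664589184, 178475590463, - 27938201983, - 6617114992, 5345293148, - 1254147409, - 96522622, 158844086, - 46041591, 591949, 4369859, - 1431563],
    [7347475102889, - 10145141012249, 2425659889199, 943436772431, - 708029520658, 140551523495, 7579997255, - 16255617316, 5301767685, - 315016921, - 414273117, 178027558, - 22750315, - 9311004, 5283208, - 862140],
    [10431983014923, - 15391961289603, 5612064879501, - 370605806950, - 394679701934, 132669305171, - 14439058160, - 8846746246, 4598764630, - 679611668, - 213261698, 137256648, - 26927162, - 3751899, 3801022, - 866575],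
    [- 855362081094, 1560321767320, - 1157379281121, 654557413804, - 248541220741, 38990248882, 17423599645, - 13276250814, 3372004097, 216912656, - 452893999, 143526949, - 5474005, - 12584811, 4688207, - 374975],
    [62382697523447, 12486752325002, - 5788806675630, 1355471148258, 32507446876, - 150682937260, 57908220389, - 4199568633, - 4653964704, 2086994662, - 277294840, - 114195608, 68718689, - 12717947, - 2860072, 2015035],
    [70772916830227, 199577667944, - 1459730217292, 1171849093520, - 301458612784, - 50438908016, 46007007020, - 9982459039, - 845526363, 1138223850, - 310275406, 2776502, 26904427, - 9473771, 511971, 634874]]"

section \<open>Checks by integer evaluation\<close>

lemma orbit_rads: "rads_ok 24 invs (tself 24 (tsquares 24 (exact orbit)))"
  by code_simp

text \<open>In real terms about \<open>1.13 / 10 ^ 10\<close> times the weights. The defect is taken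
  along the approximate orbit alone, with all 24 coefficients and no tube radius.\<close>

lemma orbit_defect:
  "wbound 7965 (tdefect (tfield 24 Tn (exact orbit) invs (tsquares 24 (exact orbit))) orbit)"
  by code_simp

lemma tube_trunc: "map (ttrunc 16 7036875) orbit = tube"
  by code_simp

lemma tube_rads: "rads_ok 16 invs2 (tself 16 (tsquares 16 tube))"
  by code_simp

lemma jacs_eq: "tjac 16 Tn tube invs2 (tsquares 16 tube) = jacs"
  by code_simp

text \<open>The number stands for 4.911, in units of \<open>2 ^ - 46\<close> and with a factor 100
  from the integer weights.\<close>

lemma jacs_rows: "wbound (4911 * 2 ^ 46 div 10) (rowsums jacs)"
  by code_simp

text \<open>As \<open>jacs\<close> encloses the Jacobian on the whole tube, the bound holds at every
  tube point at once. Most of it stems from the width of that enclosure.\<close>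

lemma col_a_defect: "wbound 3582224770 (tdefect (tcol 16 jacs (exact col_a)) col_a)"
  by code_simp

lemma col_b_defect: "wbound 781902204 (tdefect (tcol 16 jacs (exact col_b)) col_b)"
  by code_simp

lemma col_c_defect: "wbound 1402261112 (tdefect (tcol 16 jacs (exact col_c)) col_c)"
  by code_simp

lemma col_d_defect: "wbound 754724350 (tdefect (tcol 16 jacs (exact col_d)) col_d)"
  by code_simp

section \<open>A tube around the approximate orbit\<close>

definition Tr :: real where "Tr = of_int Tn / 2 ^ 46"

text \<open>The weights nearly minimise the weighted row-sum norm of the Jacobian along the orbit.\<close>

definition wt :: "3 + 3 \<Rightarrow> real" where
  "wt k = ph 0.69 0.53 0.3 0.79 0.82 1 $ k"

definition track :: "int list list \<Rightarrow> real \<Rightarrow> phase" where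
  "track P t = ph (cheb (P ! 0) t) (cheb (P ! 1) t) (cheb (P ! 2) t) (cheb (P ! 3) t) (cheb (P ! 4) t) (cheb (P ! 5) t)"

lemma wt_simps [simp]: "wt (Inl 1) = 0.69" "wt (Inl 2) = 0.53" "wt (Inl 3) = 0.3"
    "wt (Inr 1) = 0.79" "wt (Inr 2) = 0.82" "wt (Inr 3) = 1"
  unfolding wt_def by simp_all

lemma wt_pos: "wt k > 0" and wt_ge: "wt k \<ge> 0.3" and wt_le: "wt k \<le> 1"
proof -
  have "\<forall>k. wt k > 0 \<and> wt k \<ge> 0.3 \<and> wt k \<le> 1"
    unfolding all_phase wt_def by simp
  then show "wt k > 0" "wt k \<ge> 0.3" "wt k \<le> 1" by blast+
qed

lemma DERIV_track:
  assumes "0 < t" "t < 2" "length P = 6"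
  shows "((\<lambda>t. track P t $ k) has_real_derivative track (map pder P) t $ k / 2) (at t)"
proof -
  have "\<forall>k. ((\<lambda>t. track P t $ k) has_real_derivative track (map pder P) t $ k / 2) (at t)"
    unfolding all_phase track_def using DERIV_cheb[OF assms(1,2)] assms(3) by simp
  then show ?thesis by blast
qed

lemma continuous_on_track: "continuous_on {0..2} (track P)"
proof -
  have "\<forall>k. continuous_on {0..2} (\<lambda>t. track P t $ k)"
    unfolding all_phase track_def using continuous_on_cheb by simp
  then show ?thesis by (intro continuous_on_phase) blast
qed

lemma length_6E:
  assumes "length P = 6" obtains a b c d e f where "P = [a, b, c, d, e, f]"
  using assms by (auto simp: numeral_eq_Suc length_Suc_conv)

abbreviation ang :: "real \<Rightarrow> real" where "ang t \<equiv> arccos (1 - t)"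

lemma enc_cheb: "enc (ang t) (a, 0) (cheb a t)"
  using enc_exact by (simp add: cheb_def)

lemma encs_exact:
  assumes "length P = 6"
  shows "encs (ang t) (exact P) (comps (track P t))"
proof -
  obtain a b c d e f where P: "P = [a, b, c, d, e, f]" using length_6E[OF assms] .
  show ?thesis unfolding P exact_def comps_def track_def by (simp add: enc_cheb)
qed

lemma defect_bound:
  assumes F: "encs (ang t) F (comps y)" and c: "wbound c (tdefect F P)" and P: "length P = 6"
  shows "\<bar>y $ k - track (map pder P) t $ k\<bar> \<le> of_int c / 2 ^ 46 * wt k"
proof -
  obtain a1 a2 a3 a4 a5 a6 where Pl: "P = [a1, a2, a3, a4, a5, a6]" using length_6E[OF P] .
  have "length F = 6" using list_all2_lengthD[OF F] by (simp add: comps_def)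
  from length_6E[OF this] obtain f1 f2 f3 f4 f5 f6 where Fl: "F = [f1, f2, f3, f4, f5, f6]" .
  have e: "\<bar>y - cheb g t\<bar> \<le> of_int c / 2 ^ 46 * r"
    if "enc (ang t) f y" "100 * tnorm (tadd f (psmul (- 1) (pder a), 0)) \<le> c * w" "r = of_int w / 100" "g = pder a" for f y a w r g
  proof -
    have "enc (ang t) (psmul (- 1) (pder a), 0) (- cheb (pder a) t)"
      using enc_tscale[OF enc_cheb, of t "- 1" "pder a"] by simp
    from enc_tnorm[OF enc_tadd[OF that(1) this]]
    have "\<bar>y - cheb (pder a) t\<bar> \<le> of_int (tnorm (tadd f (psmul (- 1) (pder a), 0))) / 2 ^ 46" by simp
    also have "\<dots> \<le> of_int c / 2 ^ 46 * r"
    proof -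
      have "real_of_int (100 * tnorm (tadd f (psmul (- 1) (pder a), 0))) \<le> of_int (c * w)"
        using that(2) by (rule of_int_le_iff[THEN iffD2])
      then have "of_int (tnorm (tadd f (psmul (- 1) (pder a), 0))) \<le> of_int c * r"
        unfolding that(3) by simp
      from divide_right_mono[OF this, of "2 ^ 46"] show ?thesis by simp
    qed
    finally show ?thesis unfolding that(4) .
  qed
  have "\<forall>k. \<bar>y $ k - track (map pder P) t $ k\<bar> \<le> of_int c / 2 ^ 46 * wt k"
    unfolding all_phase wt_simps track_def Pl list.map ph_nth
    using F[unfolded Fl comps_def list_all2_Cons list_all2_Nil]
      c[unfolded Fl Pl tdefect.simps wbound_def wts_def list_all2_Cons list_all2_Nil]
    by (elim conjE, intro conjI) (rule e, assumption, assumption, simp, simp)+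
  then show ?thesis by blast
qed

lemma encs_tcol:
  assumes A: "encs \<theta> A (jac T x)" and v: "encs \<theta> V (comps v)"
  shows "encs \<theta> (tcol n A V) (comps (T *\<^sub>R dfield x v))"
proof -
  have nth: "list_all2 R xs ys \<Longrightarrow> i < length ys \<Longrightarrow> R (xs ! i) (ys ! i)" for R :: "tm \<Rightarrow> real \<Rightarrow> bool" and xs ys i
    by (simp add: list_all2_conv_all_nth)
  have A': "enc \<theta> (A ! i) (jac T x ! i)" if "i < 15" for i
    using nth[OF A, of i] that by (simp add: jac_def)
  have v': "enc \<theta> (V ! i) (comps v ! i)" if "i < 6" for i
    using nth[OF v, of i] that by (simp add: comps_def)
  have m: "enc \<theta> (tmul n 46 (A ! i) (V ! j)) (jac T x ! i * comps v ! j)" if "i < 15" "j < 6" for i j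
    by (intro enc_mul A' v' that)
  show ?thesis
    unfolding comps_def[of "T *\<^sub>R _"] tcol_def list_all2_Cons list_all2_Nil
    by (intro conjI refl) (rule enc_cong, (rule enc_tadd enc_minus | (rule m, simp, simp))+,
        (simp add: jac_def comps_def dfield_def algebra_simps; fail))+
qed

lemma rowsum_bound:
  assumes A: "encs \<theta> A (jac T x)" and c: "wbound c (rowsums A)" and m: "\<And>j. \<bar>v $ j\<bar> \<le> m * wt j"
  shows "\<bar>T * dfield x v $ k\<bar> \<le> (of_int c / (100 * 2 ^ 46)) * m * wt k"
proof -
  have m0: "m \<ge> 0" using m[of "Inr 3"] by (simp add: wt_def)
  have "\<forall>j. \<bar>v $ j\<bar> \<le> m * wt j" using m by blast
  note v = this[unfolded all_phase wt_simps]
  have A': "\<bar>jac T x ! i\<bar> \<le> of_int (tnorm (A ! i)) / 2 ^ 46" if "i < 15" for i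
    using A that by (intro enc_tnorm[of \<theta>]) (simp add: list_all2_conv_all_nth jac_def)
  have p: "\<bar>jac T x ! i * a\<bar> \<le> m / 2 ^ 46 * (r * of_int (tnorm (A ! i)))" if "i < 15" "\<bar>a\<bar> \<le> m * r" "r \<ge> 0" for i a r
  proof -
    have "\<bar>jac T x ! i * a\<bar> \<le> (of_int (tnorm (A ! i)) / 2 ^ 46) * (m * r)"
      unfolding abs_mult using A'[OF that(1)] that(2) by (intro mult_mono) auto
    then show ?thesis by (simp add: mult_ac)
  qed
  have fin: "\<bar>y\<bar> \<le> (of_int c / (100 * 2 ^ 46)) * m * r"
    if y: "\<bar>y\<bar> \<le> m / 2 ^ 46 * (of_int s / 100)" and s: "100 * s \<le> c * w" and r: "r = of_int w / 100" for y s w r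
  proof -
    have "real_of_int (100 * s) \<le> of_int (c * w)" using s by (rule of_int_le_iff[THEN iffD2])
    then have "of_int s / 100 \<le> of_int c / 100 * r" unfolding r by simp
    then have "m / 2 ^ 46 * (of_int s / 100) \<le> m / 2 ^ 46 * (of_int c / 100 * r)"
      using m0 by (intro mult_left_mono) auto
    then show ?thesis using y by (simp add: mult_ac)
  qed
  have t3: "\<bar>a + b + c\<bar> \<le> k * (x + y + z)" if "\<bar>a\<bar> \<le> k * x" "\<bar>b\<bar> \<le> k * y" "\<bar>c\<bar> \<le> k * z" for a b c x y z k :: real
    using that by (simp add: distrib_left)
  have t5: "\<bar>- (a + b + c + d + e)\<bar> \<le> k * (x + y + z + u + w)"
    if "\<bar>a\<bar> \<le> k * x" "\<bar>b\<bar> \<le> k * y" "\<bar>c\<bar> \<le> k * z" "\<bar>d\<bar> \<le> k * u" "\<bar>e\<bar> \<le> k * w" for a b c d e x y z u w k :: real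
    using that by (simp add: distrib_left)
  let ?J = "\<lambda>i. jac T x ! i" and ?N = "\<lambda>i. real_of_int (tnorm (A ! i))"
  note pv = p[OF _ v[THEN conjunct1]] p[OF _ v[THEN conjunct2, THEN conjunct1]]
    p[OF _ v[THEN conjunct2, THEN conjunct2, THEN conjunct1]] p[OF _ v[THEN conjunct2, THEN conjunct2, THEN conjunct2, THEN conjunct1]]
    p[OF _ v[THEN conjunct2, THEN conjunct2, THEN conjunct2, THEN conjunct2, THEN conjunct1]]
    p[OF _ v[THEN conjunct2, THEN conjunct2, THEN conjunct2, THEN conjunct2, THEN conjunct2]]
  have "\<bar>?J 3 * v $ Inl 2 + ?J 4 * v $ Inl 3 + ?J 0 * v $ Inr 1\<bar> \<le> m / 2 ^ 46 * (0.53 * ?N 3 + 0.3 * ?N 4 + 0.79 * ?N 0)"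
    "\<bar>?J 5 * v $ Inl 1 + ?J 6 * v $ Inl 3 + ?J 1 * v $ Inr 2\<bar> \<le> m / 2 ^ 46 * (0.69 * ?N 5 + 0.3 * ?N 6 + 0.82 * ?N 1)"
    "\<bar>?J 7 * v $ Inl 1 + ?J 8 * v $ Inl 2 + ?J 2 * v $ Inr 3\<bar> \<le> m / 2 ^ 46 * (0.69 * ?N 7 + 0.53 * ?N 8 + 1 * ?N 2)"
    by (intro t3 pv; simp)+
  note r3 = this
  have "\<bar>- (?J 9 * v $ Inl 1 + ?J 12 * v $ Inl 2 + ?J 13 * v $ Inl 3 + ?J 5 * v $ Inr 2 + ?J 7 * v $ Inr 3)\<bar>
      \<le> m / 2 ^ 46 * (0.69 * ?N 9 + 0.53 * ?N 12 + 0.3 * ?N 13 + 0.82 * ?N 5 + 1 * ?N 7)"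
    "\<bar>- (?J 12 * v $ Inl 1 + ?J 10 * v $ Inl 2 + ?J 14 * v $ Inl 3 + ?J 3 * v $ Inr 1 + ?J 8 * v $ Inr 3)\<bar>
      \<le> m / 2 ^ 46 * (0.69 * ?N 12 + 0.53 * ?N 10 + 0.3 * ?N 14 + 0.79 * ?N 3 + 1 * ?N 8)"
    "\<bar>- (?J 13 * v $ Inl 1 + ?J 14 * v $ Inl 2 + ?J 11 * v $ Inl 3 + ?J 4 * v $ Inr 1 + ?J 6 * v $ Inr 2)\<bar>
      \<le> m / 2 ^ 46 * (0.69 * ?N 13 + 0.53 * ?N 14 + 0.3 * ?N 11 + 0.79 * ?N 4 + 0.82 * ?N 6)"
    by (intro t5 pv; simp)+
  note r5 = this
  have w: "100 * (rowsums A ! i) \<le> c * (wts ! i)" if "i < 6" for i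
    using c that unfolding wbound_def by (auto simp: list_all2_conv_all_nth wts_def rowsums_def)
  have D: "?J 3 * v $ Inl 2 + ?J 4 * v $ Inl 3 + ?J 0 * v $ Inr 1 = T * dfield x v $ Inl 1"
    "?J 5 * v $ Inl 1 + ?J 6 * v $ Inl 3 + ?J 1 * v $ Inr 2 = T * dfield x v $ Inl 2"
    "?J 7 * v $ Inl 1 + ?J 8 * v $ Inl 2 + ?J 2 * v $ Inr 3 = T * dfield x v $ Inl 3"
    "- (?J 9 * v $ Inl 1 + ?J 12 * v $ Inl 2 + ?J 13 * v $ Inl 3 + ?J 5 * v $ Inr 2 + ?J 7 * v $ Inr 3) = T * dfield x v $ Inr 1"
    "- (?J 12 * v $ Inl 1 + ?J 10 * v $ Inl 2 + ?J 14 * v $ Inl 3 + ?J 3 * v $ Inr 1 + ?J 8 * v $ Inr 3) = T * dfield x v $ Inr 2"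
    "- (?J 13 * v $ Inl 1 + ?J 14 * v $ Inl 2 + ?J 11 * v $ Inl 3 + ?J 4 * v $ Inr 1 + ?J 6 * v $ Inr 2) = T * dfield x v $ Inr 3"
    by (simp_all add: dfield_def jac_def algebra_simps)
  have S: "0.53 * ?N 3 + 0.3 * ?N 4 + 0.79 * ?N 0 = of_int (rowsums A ! 0) / 100"
    "0.69 * ?N 5 + 0.3 * ?N 6 + 0.82 * ?N 1 = of_int (rowsums A ! 1) / 100"
    "0.69 * ?N 7 + 0.53 * ?N 8 + 1 * ?N 2 = of_int (rowsums A ! 2) / 100"
    "0.69 * ?N 9 + 0.53 * ?N 12 + 0.3 * ?N 13 + 0.82 * ?N 5 + 1 * ?N 7 = of_int (rowsums A ! 3) / 100"
    "0.69 * ?N 12 + 0.53 * ?N 10 + 0.3 * ?N 14 + 0.79 * ?N 3 + 1 * ?N 8 = of_int (rowsums A ! 4) / 100"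
    "0.69 * ?N 13 + 0.53 * ?N 14 + 0.3 * ?N 11 + 0.79 * ?N 4 + 0.82 * ?N 6 = of_int (rowsums A ! 5) / 100"
    by (simp_all add: rowsums_def)
  have "\<forall>k. \<bar>T * dfield x v $ k\<bar> \<le> (of_int c / (100 * 2 ^ 46)) * m * wt k"
    unfolding all_phase wt_simps
    by (intro conjI fin[OF r3(1)[unfolded D S] w[of 0]] fin[OF r3(2)[unfolded D S] w[of 1]] fin[OF r3(3)[unfolded D S] w[of 2]]
        fin[OF r5(1)[unfolded D S] w[of 3]] fin[OF r5(2)[unfolded D S] w[of 4]] fin[OF r5(3)[unfolded D S] w[of 5]])
      (simp_all add: wts_def)
  then show ?thesis by blast
qed

lemma pev_take_drop: "pev z a = pev z (take n a) + z ^ n * pev z (drop n a)"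
proof (induction n arbitrary: a)
  case (Suc n)
  show ?case
  proof (cases a)
    case (Cons x xs)
    show ?thesis unfolding Cons pev.simps take_Suc_Cons drop_Suc_Cons by (subst Suc[of xs]) (simp add: algebra_simps)
  qed simp
qed simp

lemma enc_ttrunc:
  assumes "\<bar>v - cheb a t\<bar> \<le> of_int r / 2 ^ 46"
  shows "enc (ang t) (ttrunc n r a) v"
proof -
  let ?z = "cis (ang t)"
  have "Re (pev ?z a) - Re (pev ?z (take n a)) = Re (?z ^ n * pev ?z (drop n a))"
    using arg_cong[OF pev_take_drop[of ?z a n], of Re] by simp
  also have "\<bar>\<dots>\<bar> \<le> of_int (pnorm (drop n a))"
    using abs_Re_le_cmod[of "?z ^ n * pev ?z (drop n a)"] norm_pev_le[of ?z "drop n a"] by (simp add: norm_mult norm_power)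
  finally have 1: "\<bar>Re (pev ?z a) - Re (pev ?z (take n a))\<bar> \<le> of_int (pnorm (drop n a))" .
  have "\<bar>2 ^ 46 * v - Re (pev ?z a)\<bar> = 2 ^ 46 * \<bar>v - cheb a t\<bar>"
  proof -
    have "2 ^ 46 * v - Re (pev ?z a) = 2 ^ 46 * (v - cheb a t)" by (simp add: cheb_def right_diff_distrib)
    then show ?thesis by (simp only: abs_mult power_abs abs_numeral)
  qed
  also have "\<dots> \<le> of_int r" using assms by (simp add: field_simps)
  finally show ?thesis using 1 by (simp add: enc_def)
qed

text \<open>The radius is \<open>1 / 10 ^ 7\<close>, rounded up to a whole number of units. It has
  to accommodate the shifts \<open>c1 * col_a + c2 * col_b\<close>, up to
  \<open>8.6 / 10 ^ 8\<close>, and a deviation of \<open>1 / 10 ^ 8\<close> from the shifted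
  curve.\<close>

definition in_tube :: "real \<Rightarrow> phase \<Rightarrow> bool" where
  "in_tube t x \<longleftrightarrow> (\<forall>k. \<bar>x $ k - track orbit t $ k\<bar> \<le> 7036875 / 2 ^ 46)"

lemma length_data: "length orbit = 6" "length col_a = 6" "length col_b = 6" "length col_c = 6" "length col_d = 6"
  by (simp_all add: orbit_def col_a_def col_b_def col_c_def col_d_def)

lemma in_tube_encs:
  assumes "in_tube t x" shows "encs (ang t) tube (comps x)"
proof -
  obtain a b c d e f where o: "orbit = [a, b, c, d, e, f]" using length_6E[OF length_data(1)] .
  have e: "enc (ang t) (ttrunc 16 7036875 p) v" if "\<bar>v - cheb p t\<bar> \<le> 7036875 / 2 ^ 46" for p v
    using that by (intro enc_ttrunc) simp
  show ?thesis
    using assms unfolding in_tube_def all_phase tube_trunc[symmetric] o track_def comps_def ph_nth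
      list.map list_all2_Cons list_all2_Nil
    by (elim conjE, intro conjI e refl) simp_all
qed

lemma in_tube_jac:
  assumes "in_tube t x"
  shows "x \<in> Gam_domain" "encs (ang t) jacs (jac Tr x)"
  by (rule enc_field_jac(1)[OF in_tube_encs[OF assms] tube_rads])
    (rule enc_field_jac(3)[OF in_tube_encs[OF assms] tube_rads, where T = Tn, folded Tr_def, unfolded jacs_eq])

lemma dfield_bound:
  assumes "in_tube t x" "\<And>j. \<bar>v $ j\<bar> \<le> m * wt j"
  shows "\<bar>Tr * dfield x v $ k\<bar> \<le> 4.911 * m * wt k"
proof -
  have m: "m \<ge> 0" using assms(2)[of "Inr 3"] by simp
  have "\<bar>Tr * dfield x v $ k\<bar> \<le> (of_int (4911 * 2 ^ 46 div 10) / (100 * 2 ^ 46)) * m * wt k"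
    by (rule rowsum_bound[OF in_tube_jac(2)[OF assms(1)] jacs_rows assms(2)])
  also have "\<dots> \<le> 4.911 * m * wt k"
    using m wt_pos[of k] by (intro mult_right_mono) auto
  finally show ?thesis .
qed

lemma in_tube_orbit: "in_tube t (track orbit t)"
  by (simp add: in_tube_def)

lemma orbit_bound:
  "\<bar>Tr * field (track orbit t) $ k - track (map pder orbit) t $ k\<bar> \<le> 7965 / 2 ^ 46 * wt k"
proof -
  have "encs (ang t) (tfield 24 Tn (exact orbit) invs (tsquares 24 (exact orbit))) (comps (Tr *\<^sub>R field (track orbit t)))"
    using enc_field_jac(2)[OF encs_exact orbit_rads, where T = Tn] length_data
    unfolding Tr_def by (simp add: comps_def)
  from defect_bound[OF this orbit_defect, of k] show ?thesis by (simp add: length_data)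
qed

lemma col_bound:
  assumes "in_tube t x" "wbound c (tdefect (tcol 16 jacs (exact V)) V)" "length V = 6"
  shows "\<bar>Tr * dfield x (track V t) $ k - track (map pder V) t $ k\<bar> \<le> of_int c / 2 ^ 46 * wt k"
  using defect_bound[OF encs_tcol[OF in_tube_jac(2)[OF assms(1)] encs_exact[OF assms(3)]] assms(2,3)] by simp

lemma in_tube_convex:
  assumes "in_tube t x" "in_tube t y" "0 \<le> s" "s \<le> 1"
  shows "in_tube t (x + s *\<^sub>R (y - x))"
  unfolding in_tube_def
proof
  fix k
  define R :: real where "R = 7036875 / 2 ^ 46"
  let ?a = "x $ k - track orbit t $ k" and ?b = "y $ k - track orbit t $ k"
  have a: "\<bar>?a\<bar> \<le> R" and b: "\<bar>?b\<bar> \<le> R"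
    using assms unfolding in_tube_def R_def by blast+
  have "(x + s *\<^sub>R (y - x)) $ k - track orbit t $ k = (1 - s) * ?a + s * ?b" by (simp add: algebra_simps)
  also have "\<bar>\<dots>\<bar> \<le> \<bar>(1 - s) * ?a\<bar> + \<bar>s * ?b\<bar>" by (rule abs_triangle_ineq)
  also have "\<dots> = (1 - s) * \<bar>?a\<bar> + s * \<bar>?b\<bar>" using assms by (simp add: abs_mult)
  also have "\<dots> \<le> (1 - s) * R + s * R"
    using assms a b by (intro add_mono mult_left_mono) auto
  also have "\<dots> = R" by (simp add: algebra_simps)
  finally show "\<bar>(x + s *\<^sub>R (y - x)) $ k - track orbit t $ k\<bar> \<le> 7036875 / 2 ^ 46" by (simp only: R_def)
qed

lemma abs3: "\<bar>a\<bar> \<le> x \<Longrightarrow> \<bar>b\<bar> \<le> y \<Longrightarrow> \<bar>c\<bar> \<le> z \<Longrightarrow> \<bar>a + b + c\<bar> \<le> x + y + (z :: real)"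
  by linarith

text \<open>The intermediate point depends on the component \<open>k\<close>, which is harmless
  because the bounds applied to it are componentwise and hold on the whole tube.\<close>

lemma field_mvt:
  assumes "in_tube t x" "in_tube t y"
  obtains z where "in_tube t z" "field y $ k - field x $ k = dfield z (y - x) $ k"
proof -
  have "\<exists>s>0. s < 1 \<and> field (x + 1 *\<^sub>R (y - x)) $ k - field (x + 0 *\<^sub>R (y - x)) $ k
      = (1 - 0) * dfield (x + s *\<^sub>R (y - x)) (y - x) $ k"
    by (rule MVT2) (auto intro!: DERIV_field[OF DERIV_line] in_tube_jac(1)[OF in_tube_convex[OF assms]])
  then obtain s where "0 < s" "s < 1" "field y $ k - field x $ k = dfield (x + s *\<^sub>R (y - x)) (y - x) $ k"
    by auto
  then show ?thesis using that[OF in_tube_convex[OF assms, of s]] by simp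
qed

lemma cheb_le: "pnorm a \<le> c \<Longrightarrow> \<bar>cheb a t\<bar> \<le> of_int c / 2 ^ 46"
  by (rule enc_norm_le[OF enc_cheb]) simp

lemma col_a_le: "\<bar>track col_a t $ k\<bar> \<le> 3" and col_b_le: "\<bar>track col_b t $ k\<bar> \<le> 1.3"
proof -
  have "\<forall>k. \<bar>track col_a t $ k\<bar> \<le> of_int (3 * 2 ^ 46) / 2 ^ 46"
    unfolding all_phase track_def ph_nth by (intro conjI cheb_le) (simp_all add: col_a_def)
  then show "\<bar>track col_a t $ k\<bar> \<le> 3" by simp
  have "\<forall>k. \<bar>track col_b t $ k\<bar> \<le> of_int (13 * 2 ^ 46 div 10) / 2 ^ 46"
    unfolding all_phase track_def ph_nth by (intro conjI cheb_le) (simp_all add: col_b_def)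
  then have "\<bar>track col_b t $ k\<bar> \<le> of_int (13 * 2 ^ 46 div 10) / 2 ^ 46" by blast
  also have "\<dots> \<le> 1.3" by simp
  finally show "\<bar>track col_b t $ k\<bar> \<le> 1.3" .
qed

section \<open>A two-parameter family of approximate solutions\<close>

definition center :: "real \<Rightarrow> real \<Rightarrow> real \<Rightarrow> phase" where
  "center c1 c2 t = track orbit t + c1 *\<^sub>R track col_a t + c2 *\<^sub>R track col_b t"

text \<open>Cutting off the deviation keeps the modified field inside the tube for every argument
  and thereby makes it globally Lipschitz. The solutions to be found stay within the cutoff.\<close>

definition clamp1 :: "phase \<Rightarrow> phase" where
  "clamp1 v = (\<chi> k. max (- (1 / 10 ^ 8)) (min (1 / 10 ^ 8) (v $ k)))"

lemma clamp1_diff: "\<bar>clamp1 v $ k - clamp1 w $ k\<bar> \<le> \<bar>v $ k - w $ k\<bar>"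
proof -
  have "\<bar>max (- r) (min r a) - max (- r) (min r b)\<bar> \<le> \<bar>a - b\<bar>" for r a b :: real by linarith
  then show ?thesis by (simp only: clamp1_def vec_lambda_beta)
qed

lemma clamp1_le: "\<bar>clamp1 v $ k\<bar> \<le> 1 / 10 ^ 8" "\<bar>clamp1 v $ k\<bar> \<le> \<bar>v $ k\<bar>"
proof -
  have "\<bar>max (- r) (min r a)\<bar> \<le> r \<and> \<bar>max (- r) (min r a)\<bar> \<le> \<bar>a\<bar>" if "r \<ge> 0" for r a :: real using that by linarith
  from this[of "1 / 10 ^ 8" "v $ k"]
  show "\<bar>clamp1 v $ k\<bar> \<le> 1 / 10 ^ 8" "\<bar>clamp1 v $ k\<bar> \<le> \<bar>v $ k\<bar>"
    unfolding clamp1_def vec_lambda_beta by simp_all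
qed

lemma clamp1_id: "(\<And>k. \<bar>v $ k\<bar> \<le> 1 / 10 ^ 8) \<Longrightarrow> clamp1 v = v"
proof -
  have "max (- r) (min r a) = a" if "\<bar>a\<bar> \<le> r" for r a :: real using that by linarith
  moreover assume "\<And>k. \<bar>v $ k\<bar> \<le> 1 / 10 ^ 8"
  ultimately show ?thesis unfolding clamp1_def vec_eq_iff vec_lambda_beta by blast
qed

lemma in_tube_center:
  assumes "\<bar>c1\<bar> \<le> 2 / 10 ^ 8" "\<bar>c2\<bar> \<le> 2 / 10 ^ 8" "\<And>k. \<bar>v $ k\<bar> \<le> 1 / 10 ^ 8"
  shows "in_tube t (center c1 c2 t + v)"
  unfolding in_tube_def
proof
  fix k
  have "\<bar>c1 * track col_a t $ k\<bar> \<le> 2 / 10 ^ 8 * 3" "\<bar>c2 * track col_b t $ k\<bar> \<le> 2 / 10 ^ 8 * 1.3"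
    unfolding abs_mult using assms by (intro mult_mono col_a_le col_b_le; simp)+
  from abs3[OF this assms(3)[of k]]
  have "\<bar>c1 * track col_a t $ k + c2 * track col_b t $ k + v $ k\<bar> \<le> 7036875 / 2 ^ 46" by simp
  moreover have "(center c1 c2 t + v) $ k - track orbit t $ k = c1 * track col_a t $ k + c2 * track col_b t $ k + v $ k"
    by (simp add: center_def)
  ultimately show "\<bar>(center c1 c2 t + v) $ k - track orbit t $ k\<bar> \<le> 7036875 / 2 ^ 46" by (simp only:)
qed

text \<open>By the mean value theorem the shift changes the field by the Jacobian at some tube point
  applied to \<open>c1 * col_a + c2 * col_b\<close>, and the columns satisfy their linear equation
  at every tube point up to a small defect. So no quadratic remainder appears, and the shift adds
  only about \<open>1.24 / 10 ^ 12\<close> to the defect of the orbit.\<close>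

lemma center_defect:
  assumes c: "\<bar>c1\<bar> \<le> 2 / 10 ^ 8" "\<bar>c2\<bar> \<le> 2 / 10 ^ 8"
  shows "\<bar>Tr * field (center c1 c2 t) $ k - (track (map pder orbit) t + c1 *\<^sub>R track (map pder col_a) t
     + c2 *\<^sub>R track (map pder col_b) t) $ k\<bar> \<le> 1.1445 / 10 ^ 10 * wt k"
proof -
  have z: "in_tube t (center c1 c2 t)" using in_tube_center[OF c, of 0 t] by simp
  obtain x where x: "in_tube t x" "field (center c1 c2 t) $ k - field (track orbit t) $ k = dfield x (center c1 c2 t - track orbit t) $ k"
    using field_mvt[OF in_tube_orbit z] .
  have d: "center c1 c2 t - track orbit t = c1 *\<^sub>R track col_a t + c2 *\<^sub>R track col_b t"
    by (simp add: center_def)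
  have e: "dfield x (center c1 c2 t - track orbit t) = c1 *\<^sub>R dfield x (track col_a t) + c2 *\<^sub>R dfield x (track col_b t)"
    unfolding d using linear_dfield by (simp add: linear_add linear_scale)
  have eq: "Tr * field (center c1 c2 t) $ k - (track (map pder orbit) t + c1 *\<^sub>R track (map pder col_a) t
     + c2 *\<^sub>R track (map pder col_b) t) $ k = (Tr * field (track orbit t) $ k - track (map pder orbit) t $ k)
     + c1 * (Tr * dfield x (track col_a t) $ k - track (map pder col_a) t $ k)
     + c2 * (Tr * dfield x (track col_b t) $ k - track (map pder col_b) t $ k)"
    using arg_cong[OF x(2), of "(*) Tr"] unfolding e by (simp add: algebra_simps)
  have b1: "\<bar>c1 * (Tr * dfield x (track col_a t) $ k - track (map pder col_a) t $ k)\<bar> \<le> 2 / 10 ^ 8 * (of_int 3582224770 / 2 ^ 46 * wt k)"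
    unfolding abs_mult using c by (intro mult_mono col_bound[OF x(1) col_a_defect] length_data) auto
  have b2: "\<bar>c2 * (Tr * dfield x (track col_b t) $ k - track (map pder col_b) t $ k)\<bar> \<le> 2 / 10 ^ 8 * (of_int 781902204 / 2 ^ 46 * wt k)"
    unfolding abs_mult using c by (intro mult_mono col_bound[OF x(1) col_b_defect] length_data) auto
  have "\<bar>Tr * field (center c1 c2 t) $ k - (track (map pder orbit) t + c1 *\<^sub>R track (map pder col_a) t
     + c2 *\<^sub>R track (map pder col_b) t) $ k\<bar> \<le> 7965 / 2 ^ 46 * wt k + 2 / 10 ^ 8 * (of_int 3582224770 / 2 ^ 46 * wt k)
       + 2 / 10 ^ 8 * (of_int 781902204 / 2 ^ 46 * wt k)"
    unfolding eq by (rule abs3[OF orbit_bound b1 b2])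
  also have "\<dots> = (7965 / 2 ^ 46 + 2 / 10 ^ 8 * (3582224770 / 2 ^ 46) + 2 / 10 ^ 8 * (781902204 / 2 ^ 46)) * wt k"
    by (simp add: distrib_right)
  also have "\<dots> \<le> 1.1445 / 10 ^ 10 * wt k"
    using wt_pos[of k] by (intro mult_right_mono) auto
  finally show ?thesis .
qed

text \<open>The sixteenth power of a Taylor estimate for \<open>exp (4.911 / 16)\<close>; the true
  value is about 135.8.\<close>

lemma exp_bound_4911: "exp (4.911 :: real) \<le> 136"
proof -
  define x :: real where "x = 4.911 / 16"
  obtain t where t: "\<bar>t\<bar> \<le> \<bar>x\<bar>" "exp x = (\<Sum>m<6. x ^ m / fact m) + exp t / fact 6 * x ^ 6"
    using Maclaurin_exp_le by blast
  have s6: "(\<Sum>m<6. x ^ m / fact m) = 1 + x + x ^ 2 / 2 + x ^ 3 / 6 + x ^ 4 / 24 + x ^ 5 / 120"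
    by (simp add: lessThan_nat_numeral fact_numeral)
  have "exp t \<le> exp 1" using t(1) by (simp add: x_def)
  then have "exp t \<le> 3" using exp_le by linarith
  then have "exp t / fact 6 * x ^ 6 \<le> 3 / fact 6 * x ^ 6"
    by (intro mult_right_mono divide_right_mono) (auto simp: x_def)
  then have "exp x \<le> 1 + x + x ^ 2 / 2 + x ^ 3 / 6 + x ^ 4 / 24 + x ^ 5 / 120 + 3 / fact 6 * x ^ 6"
    using t(2) unfolding s6 by linarith
  also have "\<dots> \<le> 1.3593"
    by (simp add: x_def power_divide fact_numeral)
  finally have "exp x \<le> 1.3593" .
  then have "exp x ^ 16 \<le> 1.3593 ^ 16" by (intro power_mono) auto
  also have "\<dots> \<le> (136 :: real)" by (simp add: field_simps)
  finally show ?thesis by (simp add: exp_of_nat_mult[symmetric] x_def)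
qed

definition alpha0 :: real where "alpha0 = 218205191025160 / 2 ^ 46"
definition beta0 :: real where "beta0 = 47000928760713 / 2 ^ 46"

definition start :: "real \<Rightarrow> real \<Rightarrow> phase" where
  "start c1 c2 = ph 0 (alpha0 + c1) (alpha0 + c1) (sqrt 2) (- (beta0 + c2)) (beta0 + c2)"

lemma center_0: "center c1 c2 0 = ph 0 (alpha0 + c1) (alpha0 + c1) (99516432383215 / 2 ^ 46) (- (beta0 + c2)) (beta0 + c2)"
  by (simp add: phase_eq_iff center_def track_def cheb_0 orbit_def col_a_def col_b_def alpha0_def beta0_def)

text \<open>All coordinates agree except the irrational \<open>sqrt 2\<close>.\<close>

lemma start_error: "\<bar>start c1 c2 $ k - center c1 c2 0 $ k\<bar> \<le> 2 / 10 ^ 14 * wt k"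
proof -
  have "99516432383215 / 2 ^ 46 \<le> sqrt 2" by (rule real_le_rsqrt) (simp add: power_divide)
  moreover have "sqrt 2 \<le> 99516432383216 / 2 ^ 46" by (rule real_le_lsqrt) (simp_all add: power_divide)
  ultimately have "\<bar>sqrt 2 - 99516432383215 / 2 ^ 46\<bar> \<le> 2 / 10 ^ 14 * 0.79" by simp
  then have "\<forall>k. \<bar>start c1 c2 $ k - center c1 c2 0 $ k\<bar> \<le> 2 / 10 ^ 14 * wt k"
    unfolding all_phase center_0 start_def wt_simps by simp
  then show ?thesis by blast
qed

lemma continuous_on_center: "continuous_on {0..2} (center c1 c2)"
  unfolding center_def by (intro continuous_intros continuous_on_track)

lemma DERIV_center:
  assumes "0 < t" "t < 2"
  shows "((\<lambda>t. center c1 c2 t $ k) has_real_derivative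
    (track (map pder orbit) t + c1 *\<^sub>R track (map pder col_a) t + c2 *\<^sub>R track (map pder col_b) t) $ k / 2) (at t)"
proof -
  have "((\<lambda>t. track orbit t $ k + c1 * track col_a t $ k + c2 * track col_b t $ k) has_real_derivative
     (track (map pder orbit) t $ k / 2 + c1 * (track (map pder col_a) t $ k / 2) + c2 * (track (map pder col_b) t $ k / 2))) (at t)"
    by (intro DERIV_add DERIV_cmult DERIV_track assms length_data)
  then show ?thesis by (simp add: center_def add_divide_distrib)
qed

lemma continuous_on_clamp1: "continuous_on UNIV clamp1"
  by (rule continuous_on_phase) (auto simp: clamp1_def intro!: continuous_intros)

lemma field_tube_diff:
  assumes "in_tube t x" "in_tube t y" "\<And>j. \<bar>y $ j - x $ j\<bar> \<le> m * wt j"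
  shows "\<bar>Tr * field y $ k - Tr * field x $ k\<bar> \<le> 4.911 * m * wt k"
proof -
  obtain z where z: "in_tube t z" "field y $ k - field x $ k = dfield z (y - x) $ k"
    using field_mvt[OF assms(1,2)] .
  have "Tr * field y $ k - Tr * field x $ k = Tr * dfield z (y - x) $ k"
    using z(2) by (simp add: right_diff_distrib[symmetric])
  then show ?thesis using dfield_bound[OF z(1), of "y - x" m k] assms(3) by simp
qed

section \<open>Exact solutions near the family\<close>

definition solves :: "(real \<Rightarrow> phase) \<Rightarrow> bool" where
  "solves x \<longleftrightarrow> (\<forall>t\<in>{0..2}. (x has_vector_derivative (Tr / 2) *\<^sub>R field (x t)) (at t within {0..2}))"

lemma solves_continuous: "solves x \<Longrightarrow> continuous_on {0..2} (\<lambda>t. x t $ k)"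
proof -
  assume "solves x"
  then have "continuous_on {0..2} x"
    unfolding solves_def continuous_on_eq_continuous_within by (blast intro: has_vector_derivative_continuous)
  then show ?thesis by (intro continuous_intros)
qed

lemma solves_DERIV:
  assumes "solves x" "0 < t" "t < 2"
  shows "((\<lambda>t. x t $ k) has_real_derivative Tr / 2 * field (x t) $ k) (at t)"
proof -
  have "(x has_vector_derivative (Tr / 2) *\<^sub>R field (x t)) (at t within {0..2})"
    by (rule bspec[OF assms(1)[unfolded solves_def]]) (use assms in simp)
  moreover have "at t within {0..2} = at t" by (rule at_within_interior) (use assms in simp)
  ultimately have "(x has_vector_derivative (Tr / 2) *\<^sub>R field (x t)) (at t)" by simp
  from this[folded has_real_derivative_phase_iff] show ?thesis
    unfolding vector_scaleR_component real_scaleR_def by blast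
qed

text \<open>The clamped equation has a global solution. The Gronwall estimate keeps it within about
  \<open>136 * 1.1445 / 10 ^ 10 / 4.911\<close> of the family, well below the cutoff
  \<open>1 / 10 ^ 8\<close>, so the clamp is inactive and the original equation is solved.\<close>

lemma ivp_exists:
  assumes c: "\<bar>c1\<bar> \<le> 2 / 10 ^ 8" "\<bar>c2\<bar> \<le> 2 / 10 ^ 8"
  shows "\<exists>x. x 0 = start c1 c2 \<and> solves x \<and>
    (\<forall>t\<in>{0..2}. \<forall>k. \<bar>x t $ k - center c1 c2 t $ k\<bar> \<le> 3.2 / 10 ^ 9 * wt k)"
proof -
  \<comment> \<open>Time is clamped as well, since \<open>picard_global\<close> asks for a field
    defined at all times.\<close>
  define s :: "real \<Rightarrow> real" where "s t = max 0 (min 2 t)" for t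
  have s: "s t \<in> {0..2}" for t by (simp add: s_def)
  have s_id: "s t = t" if "t \<in> {0..2}" for t using that by (simp add: s_def)
  have cs: "continuous_on S s" for S unfolding s_def by (intro continuous_intros)
  define G where "G t x = center c1 c2 (s t) + clamp1 (x - center c1 c2 (s t))" for t x
  define F where "F t x = (Tr / 2) *\<^sub>R field (G t x)" for t x
  have G_tube: "in_tube (s t) (G t x)" for t x
    unfolding G_def by (rule in_tube_center[OF c clamp1_le(1)])
  have G_diff: "\<bar>G t x $ k - G t y $ k\<bar> \<le> \<bar>x $ k - y $ k\<bar>" for t x y k
    using clamp1_diff[of "x - center c1 c2 (s t)" k "y - center c1 c2 (s t)"] by (simp add: G_def)
  have "continuous_on UNIV (\<lambda>p :: real \<times> phase. center c1 c2 (s (fst p)))"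
    by (rule continuous_on_compose2[OF continuous_on_center]) (use s in \<open>auto intro!: continuous_intros continuous_on_compose2[OF cs]\<close>)
  then have cG: "continuous_on UNIV (\<lambda>p. G (fst p) (snd p))"
    unfolding G_def by (intro continuous_intros continuous_on_compose2[OF continuous_on_clamp1]) auto
  have cont: "continuous_on UNIV (\<lambda>(t, x). F t x)"
    unfolding F_def case_prod_beta
    by (intro continuous_intros continuous_on_compose2[OF continuous_on_field cG])
      (use in_tube_jac(1)[OF G_tube] in auto)
  \<comment> \<open>Each component has the constant \<open>4.911 / 0.3 / 2 < 10\<close>, where 0.3
    is the smallest weight; six components give 60.\<close>
  have lip: "norm (F t x - F t y) \<le> 60 * norm (x - y)" for t x y
  proof -
    have "\<bar>(F t x - F t y) $ k\<bar> \<le> 10 * norm (x - y)" for k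
    proof -
      have "\<bar>G t x $ j - G t y $ j\<bar> \<le> norm (x - y) / 0.3 * wt j" for j
      proof -
        have "norm (x - y) / 0.3 * 0.3 \<le> norm (x - y) / 0.3 * wt j"
          by (intro mult_left_mono wt_ge) auto
        then show ?thesis using G_diff[of t x j y] component_le_norm_cart[of "x - y" j] by simp
      qed
      from field_tube_diff[OF G_tube G_tube this, of k]
      have "\<bar>Tr * field (G t x) $ k - Tr * field (G t y) $ k\<bar> \<le> 4.911 * (norm (x - y) / 0.3) * wt k" .
      also have "\<dots> \<le> 4.911 * (norm (x - y) / 0.3) * 1"
        by (intro mult_left_mono wt_le) auto
      also have "\<dots> \<le> 20 * norm (x - y)" using norm_ge_zero[of "x - y"] by simp
      finally have "\<bar>Tr * field (G t x) $ k - Tr * field (G t y) $ k\<bar> \<le> 20 * norm (x - y)" .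
      moreover have "(F t x - F t y) $ k = (Tr * field (G t x) $ k - Tr * field (G t y) $ k) / 2"
        unfolding F_def by (simp add: diff_divide_distrib)
      ultimately show ?thesis by simp
    qed
    then have "(\<Sum>k\<in>UNIV. \<bar>(F t x - F t y) $ k\<bar>) \<le> (\<Sum>k\<in>(UNIV :: (3 + 3) set). 10 * norm (x - y))"
      by (intro sum_mono) auto
    then show ?thesis using norm_le_l1_cart[of "F t x - F t y"] by simp
  qed
  have "continuous_on {0..2} (\<lambda>t. (t, 0 :: phase))" by (intro continuous_intros)
  from continuous_on_compose2[OF cont this] have "continuous_on {0..2} (\<lambda>t. F t 0)" by simp
  then have "bounded ((\<lambda>t. F t 0) ` {0..2})"
    by (intro compact_imp_bounded compact_continuous_image compact_Icc)
  then obtain B where "\<forall>y\<in>(\<lambda>t. F t 0) ` {0..2}. norm y \<le> B" unfolding bounded_iff by blast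
  then have B: "\<And>t. t \<in> {0..2} \<Longrightarrow> norm (F t 0) \<le> B" by blast
  have "F t 0 = F (s t) 0" for t using s_id[OF s[of t]] by (simp add: F_def G_def)
  then have bnd: "norm (F t 0) \<le> B" for t using B[OF s[of t]] by metis
  obtain x where x0: "x 0 = start c1 c2" and x: "\<And>t. (x has_vector_derivative F t (x t)) (at t)"
    using picard_global[OF cont lip bnd, of "start c1 c2"] by blast
  define y where "y k t = x t $ k - center c1 c2 t $ k" for k t
  define y' where "y' k t = Tr / 2 * field (G t (x t)) $ k - (track (map pder orbit) t + c1 *\<^sub>R track (map pder col_a) t
     + c2 *\<^sub>R track (map pder col_b) t) $ k / 2" for k t
  have dx: "((\<lambda>t. x t $ k) has_real_derivative Tr / 2 * field (G t (x t)) $ k) (at t)" for k t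
    using x[of t, folded has_real_derivative_phase_iff] unfolding F_def vector_scaleR_component real_scaleR_def by blast
  have cx: "continuous_on S (\<lambda>t. x t $ k)" for S k
    by (intro continuous_at_imp_continuous_on ballI DERIV_isCont[OF dx])
  \<comment> \<open>Rate and defect are halved because the derivative in \<open>t\<close> is half of
    \<open>Tr * field\<close>; the interval has length 2.\<close>
  have gr: "\<bar>y k t\<bar> \<le> ((2 / 10 ^ 14 + 1.1445 / 10 ^ 10 / 2 / (4.911 / 2)) * exp (4.911 / 2 * t)
      - 1.1445 / 10 ^ 10 / 2 / (4.911 / 2)) * wt k" if t: "t \<in> {0..2}" for k t
  proof (rule gronwall_weighted_sup[where y = y and y' = y' and S = 2])
    show "continuous_on {0..2} (y k)" for k
      unfolding y_def by (intro continuous_intros cx continuous_on_center)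
    show "(y k has_real_derivative y' k t) (at t)" if "0 < t" "t < 2" for k t
      unfolding y_def y'_def by (intro DERIV_diff dx DERIV_center that)
    show "\<bar>y k 0\<bar> \<le> 2 / 10 ^ 14 * wt k" for k
      unfolding y_def x0 by (rule start_error)
    show "\<bar>y' k t\<bar> \<le> (4.911 / 2 * m + 1.1445 / 10 ^ 10 / 2) * wt k"
      if t: "0 < t" "t < 2" and m: "\<And>j. \<bar>y j t\<bar> \<le> m * wt j" for k t m
    proof -
      have st: "s t = t" using t by (intro s_id) auto
      have zt: "in_tube t (center c1 c2 t)" using in_tube_center[OF c, of 0 t] by simp
      have Gt: "in_tube t (G t (x t))" using G_tube[of t "x t"] by (simp add: st)
      have "\<bar>G t (x t) $ j - center c1 c2 t $ j\<bar> \<le> m * wt j" for j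
        using clamp1_le(2)[of "x t - center c1 c2 t" j] m[of j] by (simp add: G_def st y_def)
      from field_tube_diff[OF zt Gt this, of k] center_defect[OF c, of t k]
      have "\<bar>Tr * field (G t (x t)) $ k - (track (map pder orbit) t + c1 *\<^sub>R track (map pder col_a) t
         + c2 *\<^sub>R track (map pder col_b) t) $ k\<bar> \<le> 4.911 * m * wt k + 1.1445 / 10 ^ 10 * wt k" by linarith
      moreover have "y' k t = (Tr * field (G t (x t)) $ k - (track (map pder orbit) t + c1 *\<^sub>R track (map pder col_a) t
         + c2 *\<^sub>R track (map pder col_b) t) $ k) / 2" by (simp add: y'_def diff_divide_distrib)
      ultimately show ?thesis by (simp add: distrib_right)
    qed
  qed (use t wt_pos in auto)
  have close: "\<bar>x t $ k - center c1 c2 t $ k\<bar> \<le> 3.2 / 10 ^ 9 * wt k" if t: "t \<in> {0..2}" for k t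
  proof -
    have "exp (4.911 / 2 * t) \<le> exp 4.911" using t by simp
    then have e: "exp (4.911 / 2 * t) \<le> 136" using exp_bound_4911 by linarith
    have "(2 / 10 ^ 14 + 1.1445 / 10 ^ 10 / 2 / (4.911 / 2)) * exp (4.911 / 2 * t) \<le>
        (2 / 10 ^ 14 + 1.1445 / 10 ^ 10 / 2 / (4.911 / 2)) * 136"
      by (intro mult_left_mono e) auto
    then have "(2 / 10 ^ 14 + 1.1445 / 10 ^ 10 / 2 / (4.911 / 2)) * exp (4.911 / 2 * t)
      - 1.1445 / 10 ^ 10 / 2 / (4.911 / 2) \<le> 3.2 / (10 ^ 9 :: real)" by simp
    then have "((2 / 10 ^ 14 + 1.1445 / 10 ^ 10 / 2 / (4.911 / 2)) * exp (4.911 / 2 * t)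
      - 1.1445 / 10 ^ 10 / 2 / (4.911 / 2)) * wt k \<le> 3.2 / 10 ^ 9 * wt k"
      by (rule mult_right_mono) (use wt_pos[of k] in simp)
    then show ?thesis using gr[OF t, of k] unfolding y_def by linarith
  qed
  have "G t (x t) = x t" if t: "t \<in> {0..2}" for t
  proof -
    have "\<bar>(x t - center c1 c2 t) $ k\<bar> \<le> 1 / 10 ^ 8" for k
    proof -
      have "3.2 / 10 ^ 9 * wt k \<le> 3.2 / 10 ^ 9 * 1" by (intro mult_left_mono wt_le) auto
      then show ?thesis using close[OF t, of k] by simp
    qed
    then show ?thesis unfolding G_def s_id[OF t] by (subst clamp1_id) auto
  qed
  note G_id = this
  have "solves x" unfolding solves_def
  proof
    fix t :: real assume t: "t \<in> {0..2}"
    show "(x has_vector_derivative (Tr / 2) *\<^sub>R field (x t)) (at t within {0..2})"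
      using has_vector_derivative_at_within[OF x[of t], of "{0..2}"] unfolding F_def G_id[OF t] .
  qed
  then show ?thesis using x0 close by blast
qed

definition near :: "real \<Rightarrow> real \<Rightarrow> (real \<Rightarrow> phase) \<Rightarrow> bool" where
  "near c1 c2 x \<longleftrightarrow> x 0 = start c1 c2 \<and> solves x \<and> (\<forall>t\<in>{0..2}. \<forall>k. \<bar>x t $ k - center c1 c2 t $ k\<bar> \<le> 3.2 / 10 ^ 9 * wt k)"

lemma near_tube:
  assumes "near c1 c2 x" "\<bar>c1\<bar> \<le> 2 / 10 ^ 8" "\<bar>c2\<bar> \<le> 2 / 10 ^ 8" "t \<in> {0..2}"
  shows "in_tube t (x t)"
proof -
  have "\<bar>(x t - center c1 c2 t) $ k\<bar> \<le> 1 / 10 ^ 8" for k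
  proof -
    have "3.2 / 10 ^ 9 * wt k \<le> 3.2 / 10 ^ 9 * 1" by (intro mult_left_mono wt_le) auto
    moreover have "\<bar>x t $ k - center c1 c2 t $ k\<bar> \<le> 3.2 / 10 ^ 9 * wt k" using assms unfolding near_def by blast
    ultimately show ?thesis by simp
  qed
  from in_tube_center[OF assms(2,3) this, of t] show ?thesis by simp
qed

text \<open>Gronwall without defect. In the weighted norm the starting points differ by at most the
  sum on the right divided by 0.3, and \<open>136 / 0.3 < 500\<close>.\<close>

lemma near_diff:
  assumes x: "near c1 c2 x" "\<bar>c1\<bar> \<le> 2 / 10 ^ 8" "\<bar>c2\<bar> \<le> 2 / 10 ^ 8"
    and z: "near d1 d2 z" "\<bar>d1\<bar> \<le> 2 / 10 ^ 8" "\<bar>d2\<bar> \<le> 2 / 10 ^ 8" and t: "t \<in> {0..2}"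
  shows "\<bar>x t $ k - z t $ k\<bar> \<le> 500 * (\<bar>c1 - d1\<bar> + \<bar>c2 - d2\<bar>)"
proof -
  define e where "e = (\<bar>c1 - d1\<bar> + \<bar>c2 - d2\<bar>) / 0.3"
  have e0: "e \<ge> 0" by (simp add: e_def)
  have gr: "\<bar>x t $ k - z t $ k\<bar> \<le> ((e + 0 / (4.911 / 2)) * exp (4.911 / 2 * t) - 0 / (4.911 / 2)) * wt k"
  proof (rule gronwall_weighted_sup[where y = "\<lambda>k t. x t $ k - z t $ k" and S = 2
        and y' = "\<lambda>k t. Tr / 2 * field (x t) $ k - Tr / 2 * field (z t) $ k"])
    have sx: "solves x" and sz: "solves z" using x z by (auto simp: near_def)
    show "continuous_on {0..2} (\<lambda>t. x t $ k - z t $ k)" for k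
      by (intro continuous_intros solves_continuous sx sz)
    show "((\<lambda>t. x t $ k - z t $ k) has_real_derivative Tr / 2 * field (x t) $ k - Tr / 2 * field (z t) $ k) (at t)"
      if "0 < t" "t < 2" for k t
      by (intro DERIV_diff solves_DERIV sx sz that)
    show "\<bar>Tr / 2 * field (x t) $ k - Tr / 2 * field (z t) $ k\<bar> \<le> (4.911 / 2 * m + 0) * wt k"
      if "0 < t" "t < 2" "\<And>j. \<bar>x t $ j - z t $ j\<bar> \<le> m * wt j" for k t m
    proof -
      have "\<bar>Tr * field (x t) $ k - Tr * field (z t) $ k\<bar> \<le> 4.911 * m * wt k"
        by (rule field_tube_diff[OF near_tube[OF z] near_tube[OF x]]) (use that in auto)
      moreover have eq: "Tr / 2 * field (x t) $ k - Tr / 2 * field (z t) $ k = (Tr * field (x t) $ k - Tr * field (z t) $ k) / 2"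
        by (simp add: diff_divide_distrib)
      ultimately show ?thesis unfolding eq by simp
    qed
    show "\<bar>x 0 $ k - z 0 $ k\<bar> \<le> e * wt k" for k
    proof -
      have we: "e * 0.3 \<le> e * wt k" by (intro mult_left_mono wt_ge e0)
      have "\<forall>k. \<bar>x 0 $ k - z 0 $ k\<bar> \<le> \<bar>c1 - d1\<bar> + \<bar>c2 - d2\<bar>"
        using x z unfolding near_def all_phase by (simp add: start_def)
      then have "\<bar>x 0 $ k - z 0 $ k\<bar> \<le> \<bar>c1 - d1\<bar> + \<bar>c2 - d2\<bar>" by blast
      moreover have "\<bar>c1 - d1\<bar> + \<bar>c2 - d2\<bar> = e * 0.3" by (simp add: e_def)
      ultimately show ?thesis using we by linarith
    qed
  qed (use t wt_pos in auto)
  also have "\<dots> \<le> e * 136 * 1"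
  proof -
    have "exp (4.911 / 2 * t) \<le> exp 4.911" using t by simp
    then have "exp (4.911 / 2 * t) \<le> 136" using exp_bound_4911 by linarith
    then have "(e + 0 / (4.911 / 2)) * exp (4.911 / 2 * t) - 0 / (4.911 / 2) \<le> e * 136"
      using e0 by (simp add: mult_left_mono)
    then show ?thesis using e0 wt_le[of k] wt_pos[of k] by (intro mult_mono) auto
  qed
  also have "\<dots> \<le> 500 * (\<bar>c1 - d1\<bar> + \<bar>c2 - d2\<bar>)" by (simp add: e_def)
  finally show ?thesis .
qed

section \<open>Shooting\<close>

lemma endpoint_values:
  "map altsum orbit = [182370294028234, 182370038020464, 227923171306536, 87382145947451, - 87382280576635, - 106034433]"
  "map (\<lambda>p. altsum (pder p)) orbit = [128003669714866, - 128004226308816, - 99444696, - 67314763287548, - 67314474778474, - 106034477361290]"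
  "map altsum col_a = [122755817407020, - 45898494579800, 73205864805102, - 159110828972204, - 58050968617138, - 88831529793328]"
  "map altsum col_b = [- 28843682573538, - 27783411541136, 30338140833058, - 40780951649828, - 45428677592888, 87809960228194]"
  by code_simp+

lemma endpoint_slopes:
  "list_all (\<lambda>p. pwnorm 0 (pder p) \<le> 4 * 2 ^ 46) orbit"
  "list_all (\<lambda>p. pwnorm 0 p \<le> 5 * 2 ^ 46) col_a"
  "list_all (\<lambda>p. pwnorm 0 p \<le> 5 * 2 ^ 46) col_b"
  by code_simp+

text \<open>Linearisation at \<open>t = 2\<close> in the three unknowns: the mean value theorem
  replaces \<open>cheb p (2 - h)\<close> by end value and slope, and \<open>cheb_near_2\<close>
  bounds the variation of slope and columns over the distance \<open>h\<close>. These corrections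
  stay below \<open>1 / 10 ^ 9\<close>, so the integration error \<open>3.2 / 10 ^ 9\<close>
  dominates.\<close>

lemma endpoint_component:
  assumes x: "\<bar>x - (cheb p (2 - h) + c1 * cheb a (2 - h) + c2 * cheb b (2 - h))\<bar> \<le> 3.2 / 10 ^ 9"
    and c: "\<bar>c1\<bar> \<le> 2 / 10 ^ 8" "\<bar>c2\<bar> \<le> 2 / 10 ^ 8" and h: "0 < h" "h \<le> 3 / 10 ^ 6"
    and pw: "pwnorm 0 (pder p) \<le> 4 * 2 ^ 46" "pwnorm 0 a \<le> 5 * 2 ^ 46" "pwnorm 0 b \<le> 5 * 2 ^ 46"
    and v: "\<bar>of_int (altsum p) / 2 ^ 46 - A\<bar> \<le> 1 / 10 ^ 11" "\<bar>of_int (altsum (pder p)) / 2 ^ 46 / 2 - D\<bar> \<le> 1 / 10 ^ 4"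
      "\<bar>of_int (altsum a) / 2 ^ 46 - M\<bar> \<le> 1 / 10 ^ 4" "\<bar>of_int (altsum b) / 2 ^ 46 - N\<bar> \<le> 1 / 10 ^ 4"
  shows "\<bar>x - (A + c1 * M + c2 * N - h * D)\<bar> \<le> 7 / 10 ^ 9"
proof -
  note v = v[folded cheb_2]
  obtain z where z: "2 - h < z" "z < 2" and pz: "cheb p 2 - cheb p (2 - h) = cheb (pder p) z / 2 * (2 - (2 - h))"
  proof (rule mvt[of "2 - h" 2 "cheb p" "\<lambda>z. (*) (cheb (pder p) z / 2)"])
    show "continuous_on {2 - h..2} (cheb p)" using h by (intro continuous_on_subset[OF continuous_on_cheb]) auto
    show "(cheb p has_derivative (*) (cheb (pder p) z / 2)) (at z)" if "2 - h < z" "z < 2" for z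
      using DERIV_cheb[of z p] that h by (simp add: has_field_derivative_def)
  qed (use h in auto)
  have "\<bar>cheb (pder p) z - cheb (pder p) 2\<bar> \<le> (2 - z) * (of_int (4 * 2 ^ 46) / 2 ^ 46)"
    using z h pw by (intro cheb_near_2) auto
  then have dz: "\<bar>cheb (pder p) z / 2 - D\<bar> \<le> 2 / 10 ^ 4" using v(2) z h unfolding abs_le_iff by simp
  have "\<bar>cheb a (2 - h) - cheb a 2\<bar> \<le> (2 - (2 - h)) * (of_int (5 * 2 ^ 46) / 2 ^ 46)"
    using h pw by (intro cheb_near_2) auto
  then have a: "\<bar>cheb a (2 - h) - M\<bar> \<le> 2 / 10 ^ 4" using v(3) h unfolding abs_le_iff by simp
  have "\<bar>cheb b (2 - h) - cheb b 2\<bar> \<le> (2 - (2 - h)) * (of_int (5 * 2 ^ 46) / 2 ^ 46)"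
    using h pw by (intro cheb_near_2) auto
  then have b: "\<bar>cheb b (2 - h) - N\<bar> \<le> 2 / 10 ^ 4" using v(4) h unfolding abs_le_iff by simp
  have "\<bar>h * (cheb (pder p) z / 2 - D)\<bar> \<le> 3 / 10 ^ 6 * (2 / 10 ^ 4)"
    unfolding abs_mult using h dz by (intro mult_mono) auto
  moreover have "\<bar>c1 * (cheb a (2 - h) - M)\<bar> \<le> 2 / 10 ^ 8 * (2 / 10 ^ 4)"
    unfolding abs_mult using c a by (intro mult_mono) auto
  moreover have "\<bar>c2 * (cheb b (2 - h) - N)\<bar> \<le> 2 / 10 ^ 8 * (2 / 10 ^ 4)"
    unfolding abs_mult using c b by (intro mult_mono) auto
  moreover have "x - (A + c1 * M + c2 * N - h * D) =
      (x - (cheb p (2 - h) + c1 * cheb a (2 - h) + c2 * cheb b (2 - h))) + (cheb p 2 - A)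
      + c1 * (cheb a (2 - h) - M) + c2 * (cheb b (2 - h) - N) - h * (cheb (pder p) z / 2 - D)"
    using pz by (simp add: algebra_simps)
  ultimately show ?thesis using x v(1) unfolding abs_le_iff by simp
qed

text \<open>The decimals are the entries of \<open>endpoint_values\<close> divided by
  \<open>2 ^ 46\<close>; the slopes are halved in addition, as \<open>pder\<close> is a derivative
  in \<open>t / 2\<close>.\<close>

lemma endpoint:
  assumes x: "near c1 c2 x" and c: "\<bar>c1\<bar> \<le> 2 / 10 ^ 8" "\<bar>c2\<bar> \<le> 2 / 10 ^ 8" and h: "0 < h" "h \<le> 3 / 10 ^ 6"
  shows "\<bar>x (2 - h) $ Inl 1 - (2.591637752804 + c1 * 1.74447 + c2 * - 0.40989 - h * 0.909521)\<bar> \<le> 7 / 10 ^ 9"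
    "\<bar>x (2 - h) $ Inl 2 - (2.591634114715 + c1 * - 0.65226 + c2 * - 0.39483 - h * - 0.909525)\<bar> \<le> 7 / 10 ^ 9"
    "\<bar>x (2 - h) $ Inr 1 - (1.241774980762 + c1 * - 2.2611 + c2 * - 0.57953 - h * - 0.4783)\<bar> \<le> 7 / 10 ^ 9"
    "\<bar>x (2 - h) $ Inr 2 - (- 1.241776893958 + c1 * - 0.82495 + c2 * - 0.64558 - h * - 0.4783)\<bar> \<le> 7 / 10 ^ 9"
    "\<bar>x (2 - h) $ Inr 3 - (- 0.000001506840 + c1 * - 1.26237 + c2 * 1.24785 - h * - 0.75342)\<bar> \<le> 7 / 10 ^ 9"
proof -
  have n: "\<bar>x (2 - h) $ k - center c1 c2 (2 - h) $ k\<bar> \<le> 3.2 / 10 ^ 9" for k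
  proof -
    have "\<bar>x (2 - h) $ k - center c1 c2 (2 - h) $ k\<bar> \<le> 3.2 / 10 ^ 9 * wt k"
      using x h unfolding near_def by auto
    also have "\<dots> \<le> 3.2 / 10 ^ 9 * 1" by (intro mult_left_mono wt_le) auto
    finally show ?thesis by simp
  qed
  have e: "altsum (V ! i) = map altsum V ! i" "altsum (pder (V ! i)) = map (\<lambda>p. altsum (pder p)) V ! i" if "i < length V" for V i
    using that by simp_all
  have pw: "pwnorm 0 (pder (orbit ! i)) \<le> 4 * 2 ^ 46" "pwnorm 0 (col_a ! i) \<le> 5 * 2 ^ 46" "pwnorm 0 (col_b ! i) \<le> 5 * 2 ^ 46"
    if "i < 6" for i
    using endpoint_slopes length_data that by (simp_all add: list_all_length)
  have lt: "0 < (6 :: nat)" "1 < (6 :: nat)" "3 < (6 :: nat)" "4 < (6 :: nat)" "5 < (6 :: nat)" by simp_all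
  note comp = endpoint_component[OF _ c h pw]
  have center: "center c1 c2 t $ Inl 1 = cheb (orbit ! 0) t + c1 * cheb (col_a ! 0) t + c2 * cheb (col_b ! 0) t"
    "center c1 c2 t $ Inl 2 = cheb (orbit ! 1) t + c1 * cheb (col_a ! 1) t + c2 * cheb (col_b ! 1) t"
    "center c1 c2 t $ Inr 1 = cheb (orbit ! 3) t + c1 * cheb (col_a ! 3) t + c2 * cheb (col_b ! 3) t"
    "center c1 c2 t $ Inr 2 = cheb (orbit ! 4) t + c1 * cheb (col_a ! 4) t + c2 * cheb (col_b ! 4) t"
    "center c1 c2 t $ Inr 3 = cheb (orbit ! 5) t + c1 * cheb (col_a ! 5) t + c2 * cheb (col_b ! 5) t" for t
    by (simp_all add: center_def track_def)
  show "\<bar>x (2 - h) $ Inl 1 - (2.591637752804 + c1 * 1.74447 + c2 * - 0.40989 - h * 0.909521)\<bar> \<le> 7 / 10 ^ 9"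
    by (rule comp[OF n[of "Inl 1", unfolded center] lt(1) lt(1) lt(1)]; simp add: e length_data endpoint_values)
  show "\<bar>x (2 - h) $ Inl 2 - (2.591634114715 + c1 * - 0.65226 + c2 * - 0.39483 - h * - 0.909525)\<bar> \<le> 7 / 10 ^ 9"
    by (rule comp[OF n[of "Inl 2", unfolded center] lt(2) lt(2) lt(2)]; simp add: e length_data endpoint_values)
  show "\<bar>x (2 - h) $ Inr 1 - (1.241774980762 + c1 * - 2.2611 + c2 * - 0.57953 - h * - 0.4783)\<bar> \<le> 7 / 10 ^ 9"
    by (rule comp[OF n[of "Inr 1", unfolded center] lt(3) lt(3) lt(3)]; simp add: e length_data endpoint_values)
  show "\<bar>x (2 - h) $ Inr 2 - (- 1.241776893958 + c1 * - 0.82495 + c2 * - 0.64558 - h * - 0.4783)\<bar> \<le> 7 / 10 ^ 9"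
    by (rule comp[OF n[of "Inr 2", unfolded center] lt(4) lt(4) lt(4)]; simp add: e length_data endpoint_values)
  show "\<bar>x (2 - h) $ Inr 3 - (- 0.000001506840 + c1 * - 1.26237 + c2 * 1.24785 - h * - 0.75342)\<bar> \<le> 7 / 10 ^ 9"
    by (rule comp[OF n[of "Inr 3", unfolded center] lt(5) lt(5) lt(5)]; simp add: e length_data endpoint_values)
qed

lemma linear_form_bound:
  fixes x1 :: real
  assumes "\<bar>x1\<bar> \<le> b1" "\<bar>x2\<bar> \<le> b2" "\<bar>x3\<bar> \<le> b3" "\<bar>x4\<bar> \<le> b4" "\<bar>x5\<bar> \<le> b5" "\<bar>x6\<bar> \<le> b6"
  shows "\<bar>k + a1 * x1 + a2 * x2 + a3 * x3 + a4 * x4 + a5 * x5 + a6 * x6\<bar> \<le>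
    \<bar>k\<bar> + \<bar>a1\<bar> * b1 + \<bar>a2\<bar> * b2 + \<bar>a3\<bar> * b3 + \<bar>a4\<bar> * b4 + \<bar>a5\<bar> * b5 + \<bar>a6\<bar> * b6"
proof -
  have m: "\<bar>a * x\<bar> \<le> \<bar>a\<bar> * r" if "\<bar>x\<bar> \<le> r" for a x r :: real
    unfolding abs_mult using that by (rule mult_left_mono) simp
  show ?thesis
    by (intro order_trans[OF abs_triangle_ineq] add_mono m assms order_refl)
qed

text \<open>The unknowns are the two starting parameters and the end time \<open>2 - h\<close>. The
  range of \<open>h\<close> around \<open>2 / 10 ^ 6\<close> keeps the end time inside the interval
  on which solutions are available. The three equations say that the end point is fixed by
  \<open>rh\<close>.\<close>

lemma shooting:
  "\<exists>c1 c2 h x. \<bar>c1\<bar> \<le> 2 / 10 ^ 8 \<and> \<bar>c2\<bar> \<le> 2 / 10 ^ 8 \<and> \<bar>h - 2 / 10 ^ 6\<bar> \<le> 4 / 10 ^ 8 \<and> near c1 c2 x \<and>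
    x (2 - h) $ Inl 1 = x (2 - h) $ Inl 2 \<and> x (2 - h) $ Inr 1 = - x (2 - h) $ Inr 2 \<and> x (2 - h) $ Inr 3 = 0"
proof -
  have "\<forall>c. \<exists>x. \<bar>fst c\<bar> \<le> 2 / 10 ^ 8 \<and> \<bar>snd c\<bar> \<le> 2 / 10 ^ 8 \<longrightarrow> near (fst c) (snd c) x"
    using ivp_exists unfolding near_def by blast
  then obtain X where X: "\<And>c. \<bar>fst c\<bar> \<le> 2 / 10 ^ 8 \<Longrightarrow> \<bar>snd c\<bar> \<le> 2 / 10 ^ 8 \<Longrightarrow> near (fst c) (snd c) (X c)"
    by metis
  let ?S = "cbox (- (2 / 10 ^ 8), - (2 / 10 ^ 8), 2 / 10 ^ 6 - 4 / 10 ^ 8) (2 / 10 ^ 8, 2 / 10 ^ 8, 2 / 10 ^ 6 + 4 / 10 ^ 8) :: (real \<times> real \<times> real) set"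
  have S: "v \<in> ?S \<longleftrightarrow> \<bar>fst v\<bar> \<le> 2 / 10 ^ 8 \<and> \<bar>fst (snd v)\<bar> \<le> 2 / 10 ^ 8 \<and> \<bar>snd (snd v) - 2 / 10 ^ 6\<bar> \<le> 4 / 10 ^ 8" for v
    by (cases v, unfold abs_le_iff, auto simp: cbox_Pair_eq)
  define y where "y v = X (fst v, fst (snd v)) (2 - snd (snd v))" for v :: "real \<times> real \<times> real"
  define g1 g2 g3 where "g1 v = y v $ Inl 1 - y v $ Inl 2" "g2 v = y v $ Inr 1 + y v $ Inr 2" "g3 v = y v $ Inr 3" for v
  note g_defs = this
  \<comment> \<open>The coefficients form an approximate inverse of the derivative of \<open>(g1, g2, g3)\<close>.\<close>
  define N where "N v = (fst v + 0.447674 * g1 v + 0.477671 * g2 v + 0.474371 * g3 v,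
     fst (snd v) - 0.236348 * g1 v + 0.103753 * g2 v - 0.702367 * g3 v,
     snd (snd v) + 1.141539 * g1 v + 0.628506 * g2 v + 0.630835 * g3 v)" for v
  have nr: "near (fst v) (fst (snd v)) (X (fst v, fst (snd v)))" if "v \<in> ?S" for v
    using X[of "(fst v, fst (snd v))"] that unfolding S by simp
  \<comment> \<open>\<open>X\<close> is obtained by choice, so continuity in the parameters has to
    come from the estimate \<open>near_diff\<close>; continuity in the end time is that of one fixed
    solution.\<close>
  have cont: "continuous_on ?S (\<lambda>v. y v $ k)" for k
    unfolding continuous_on_def
  proof
    fix v assume v: "v \<in> ?S"
    let ?F = "at v within ?S"
    let ?x = "X (fst v, fst (snd v))"
    have "((\<lambda>u. ?x (2 - snd (snd u)) $ k) \<longlongrightarrow> ?x (2 - snd (snd v)) $ k) ?F"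
    proof -
      have "continuous_on ?S (\<lambda>u. ?x (2 - snd (snd u)) $ k)"
        by (rule continuous_on_compose2[OF solves_continuous[of ?x k]])
          (use nr[OF v] S in \<open>auto simp: near_def abs_le_iff intro!: continuous_intros\<close>)
      then show ?thesis using v by (simp add: continuous_on_def)
    qed
    moreover have "((\<lambda>u. y u $ k - ?x (2 - snd (snd u)) $ k) \<longlongrightarrow> 0) ?F"
    proof (rule Lim_null_comparison)
      show "eventually (\<lambda>u. norm (y u $ k - ?x (2 - snd (snd u)) $ k) \<le> 500 * (\<bar>fst u - fst v\<bar> + \<bar>fst (snd u) - fst (snd v)\<bar>)) ?F"
        unfolding eventually_at_filter
      proof (rule always_eventually, intro allI impI)
        fix u assume u: "u \<in> ?S"
        have t: "2 - snd (snd u) \<in> {0..2}" using u[unfolded S] unfolding abs_le_iff by simp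
        show "norm (y u $ k - ?x (2 - snd (snd u)) $ k) \<le> 500 * (\<bar>fst u - fst v\<bar> + \<bar>fst (snd u) - fst (snd v)\<bar>)"
          unfolding y_def real_norm_def
          by (rule near_diff[OF nr[OF u] _ _ nr[OF v] _ _ t]) (use u v S in blast)+
      qed
      have "((\<lambda>u. 500 * (\<bar>fst u - fst v\<bar> + \<bar>fst (snd u) - fst (snd v)\<bar>)) \<longlongrightarrow>
          500 * (\<bar>fst v - fst v\<bar> + \<bar>fst (snd v) - fst (snd v)\<bar>)) ?F" by (intro tendsto_intros)
      then show "((\<lambda>u. 500 * (\<bar>fst u - fst v\<bar> + \<bar>fst (snd u) - fst (snd v)\<bar>)) \<longlongrightarrow> 0) ?F" by simp
    qed
    ultimately have "((\<lambda>u. ?x (2 - snd (snd u)) $ k + (y u $ k - ?x (2 - snd (snd u)) $ k)) \<longlongrightarrow> ?x (2 - snd (snd v)) $ k + 0) ?F"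
      by (intro tendsto_add)
    then show "((\<lambda>u. y u $ k) \<longlongrightarrow> y v $ k) ?F" by (simp add: y_def)
  qed
  have "\<exists>v\<in>?S. N v = v"
  proof (rule brouwer)
    show "compact ?S" by (rule compact_cbox)
    show "convex ?S" by (rule convex_box)
    have "(0, 0, 2 / 10 ^ 6) \<in> ?S" unfolding S by simp
    then show "?S \<noteq> {}" by blast
    show "continuous_on ?S N" unfolding N_def[abs_def] g_defs
      by (intro continuous_intros continuous_on_phase[OF cont])
    show "N \<in> ?S \<rightarrow> ?S"
    proof
      fix v assume "v \<in> ?S"
      then have v: "\<bar>fst v\<bar> \<le> 2 / 10 ^ 8" "\<bar>fst (snd v)\<bar> \<le> 2 / 10 ^ 8" "\<bar>snd (snd v) - 2 / 10 ^ 6\<bar> \<le> 4 / 10 ^ 8"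
        unfolding S by auto
      have h: "0 < snd (snd v)" "snd (snd v) \<le> 3 / 10 ^ 6" using v(3) unfolding abs_le_iff by simp_all
      note E = endpoint[OF nr[OF \<open>v \<in> ?S\<close>] v(1,2) h, folded y_def]
      \<comment> \<open>\<open>e1\<close>, \<open>e2\<close>, \<open>e3\<close> are the deviations
        from the affine model of \<open>endpoint\<close>; all analytic errors are collected in
        them.\<close>
      define e1 where "e1 = g1 v - (0.000003638089 + 2.39673 * fst v - 0.01506 * fst (snd v) - 1.819046 * snd (snd v))"
      define e2 where "e2 = g2 v - (- 0.000001913196 - 3.08605 * fst v - 1.22511 * fst (snd v) + 0.9566 * snd (snd v))"
      define e3 where "e3 = g3 v - (- 0.000001506840 - 1.26237 * fst v + 1.24785 * fst (snd v) + 0.75342 * snd (snd v))"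
      have e: "\<bar>e1\<bar> \<le> 14 / 10 ^ 9" "\<bar>e2\<bar> \<le> 14 / 10 ^ 9" "\<bar>e3\<bar> \<le> 7 / 10 ^ 9"
        using E unfolding e1_def e2_def e3_def g_defs abs_le_iff
        by (elim conjE, intro conjI; simp)+
      have g: "g1 v = e1 + (0.000003638089 + 2.39673 * fst v - 0.01506 * fst (snd v) - 1.819046 * snd (snd v))"
        "g2 v = e2 + (- 0.000001913196 - 3.08605 * fst v - 1.22511 * fst (snd v) + 0.9566 * snd (snd v))"
        "g3 v = e3 + (- 0.000001506840 - 1.26237 * fst v + 1.24785 * fst (snd v) + 0.75342 * snd (snd v))"
        by (simp_all add: e1_def e2_def e3_def)
      \<comment> \<open>Centred at \<open>2 / 10 ^ 6\<close>, the Newton map has a tiny constant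
        term, and the coefficients of the unknowns measure how far its matrix is from an exact
        inverse. The images are then governed by \<open>e1\<close>, \<open>e2\<close>,
        \<open>e3\<close>.\<close>
      define u where "u = snd (snd v) - 2 / 10 ^ 6"
      have u: "\<bar>u\<bar> \<le> 4 / 10 ^ 8" using v(3) by (simp add: u_def)
      have sv: "snd (snd v) = u + 2 / 10 ^ 6" by (simp add: u_def)
      have "\<bar>(0.000000000000567662) + (0.0000053972) * fst v + (0.0000023631) * fst (snd v) + (0.000001078416) * u + (0.447674) * e1 + (0.477671) * e2 + (0.474371) * e3\<bar> \<le> 2 / 10 ^ 8"
        by (rule order_trans[OF linear_form_bound[OF v(1,2) u e]]) simp
      moreover have "fst (N v) = (0.000000000000567662) + (0.0000053972) * fst v + (0.0000023631) * fst (snd v) + (0.000001078416) * u + (0.447674) * e1 + (0.477671) * e2 + (0.474371) * e3"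
        unfolding N_def fst_conv snd_conv g sv
          by (simp add: algebra_simps add_divide_distrib diff_divide_distrib)
      ultimately have N1: "\<bar>fst (N v)\<bar> \<le> 2 / 10 ^ 8" by (simp only:)
      have "\<bar>(0.000000000001124056) + (- 0.0000022579) * fst v + (0.0000019021) * fst (snd v) + (0.000000658668) * u + (- 0.236348) * e1 + (0.103753) * e2 + (- 0.702367) * e3\<bar> \<le> 2 / 10 ^ 8"
        by (rule order_trans[OF linear_form_bound[OF v(1,2) u e]]) simp
      moreover have "fst (snd (N v)) = (0.000000000001124056) + (- 0.0000022579) * fst v + (0.0000019021) * fst (snd v) + (0.000000658668) * u + (- 0.236348) * e1 + (0.103753) * e2 + (- 0.702367) * e3"
        unfolding N_def fst_conv snd_conv g sv
          by (simp add: algebra_simps add_divide_distrib diff_divide_distrib)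
      ultimately have N2: "\<bar>fst (snd (N v))\<bar> \<le> 2 / 10 ^ 8" by (simp only:)
      have "\<bar>(- 0.000000000000910593) + (0.00001264722) * fst v + (0.00000689175) * fst (snd v) + (0.000000593506) * u + (1.141539) * e1 + (0.628506) * e2 + (0.630835) * e3\<bar> \<le> 4 / 10 ^ 8"
        by (rule order_trans[OF linear_form_bound[OF v(1,2) u e]]) simp
      moreover have "snd (snd (N v)) - 2 / 10 ^ 6 = (- 0.000000000000910593) + (0.00001264722) * fst v + (0.00000689175) * fst (snd v) + (0.000000593506) * u + (1.141539) * e1 + (0.628506) * e2 + (0.630835) * e3"
        unfolding N_def fst_conv snd_conv g sv
          by (simp add: algebra_simps add_divide_distrib diff_divide_distrib)
      ultimately have N3: "\<bar>snd (snd (N v)) - 2 / 10 ^ 6\<bar> \<le> 4 / 10 ^ 8" by (simp only:)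
      show "N v \<in> ?S" unfolding S using N1 N2 N3 by blast
    qed
  qed blast
  then obtain v where v: "v \<in> ?S" and N: "N v = v" by blast
  have "0.447674 * g1 v + 0.477671 * g2 v + 0.474371 * g3 v = 0" "- 0.236348 * g1 v + 0.103753 * g2 v - 0.702367 * g3 v = 0"
      "1.141539 * g1 v + 0.628506 * g2 v + 0.630835 * g3 v = 0"
    using N by (auto simp: N_def prod_eq_iff)
  \<comment> \<open>The matrix of the Newton map is invertible.\<close>
  then have "g1 v = 0 \<and> g2 v = 0 \<and> g3 v = 0" by simp
  then show ?thesis
    using v nr[OF v] unfolding S g_defs y_def
    by (intro exI[of _ "fst v"] exI[of _ "fst (snd v)"] exI[of _ "snd (snd v)"] exI[of _ "X (fst v, fst (snd v))"]) auto
qed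

section \<open>Enclosing the pairings\<close>

lemma state_ph: "state (vector [a, b, c]) (vector [d, e, f]) = ph a b c d e f"
  by (simp add: phase_eq_iff state_def)

lemma endpoint_values_conjugate:
  "map altsum col_c = [16952304712422, 89439393744322, - 67552270618840, 1147001700, - 7922749294, - 25804923165456]"
  "map altsum col_d = [22846596613588, 18155110992292, 31278583022244, - 4481881318022, 42990138050646, 67744469065936]"
  by code_simp+

lemma endpoint_slopes_conjugate:
  "list_all (\<lambda>p. pwnorm 0 p \<le> 5 * 2 ^ 46) col_c"
  "list_all (\<lambda>p. pwnorm 0 p \<le> 5 * 2 ^ 46) col_d"
  by code_simp+

lemma abs_sum_6:
  fixes x1 :: real
  assumes "\<bar>x1\<bar> \<le> y1" "\<bar>x2\<bar> \<le> y2" "\<bar>x3\<bar> \<le> y3" "\<bar>x4\<bar> \<le> y4" "\<bar>x5\<bar> \<le> y5" "\<bar>x6\<bar> \<le> y6"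
  shows "\<bar>x1 + x2 + x3 + x4 + x5 + x6\<bar> \<le> y1 + y2 + y3 + y4 + y5 + y6"
  by (intro order_trans[OF abs_triangle_ineq] add_mono assms)

lemma om_rh_ph: "om (rh (ph a1 a2 a3 a4 a5 a6)) (ph b1 b2 b3 b4 b5 b6) =
    a2 * b4 + a1 * b5 + a3 * b6 + a5 * b1 + a4 * b2 + a6 * b3"
  by (simp add: om_def rh_def)

text \<open>The form is a sum of six products, each joining one coordinate of \<open>A\<close> with
  one of \<open>B\<close>, so the sums of absolute values control the error to first order.\<close>

lemma om_rh_error:
  assumes A: "\<And>k. \<bar>A $ k - a $ k\<bar> \<le> e" and B: "\<And>k. \<bar>B $ k - b $ k\<bar> \<le> d"
  shows "\<bar>om (rh A) B - om (rh a) b\<bar> \<le>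
    e * (\<bar>b $ Inl 1\<bar> + \<bar>b $ Inl 2\<bar> + \<bar>b $ Inl 3\<bar> + \<bar>b $ Inr 1\<bar> + \<bar>b $ Inr 2\<bar> + \<bar>b $ Inr 3\<bar>) +
    (\<bar>a $ Inl 1\<bar> + \<bar>a $ Inl 2\<bar> + \<bar>a $ Inl 3\<bar> + \<bar>a $ Inr 1\<bar> + \<bar>a $ Inr 2\<bar> + \<bar>a $ Inr 3\<bar>) * d + 6 * (e * d)"
proof -
  have p: "\<bar>A $ i * B $ j - a $ i * b $ j\<bar> \<le> e * \<bar>b $ j\<bar> + \<bar>a $ i\<bar> * d + e * d" for i j
  proof -
    have e: "0 \<le> e" using A[of i] by simp
    have "\<bar>(A $ i - a $ i) * b $ j\<bar> \<le> e * \<bar>b $ j\<bar>" "\<bar>a $ i * (B $ j - b $ j)\<bar> \<le> \<bar>a $ i\<bar> * d"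
      "\<bar>(A $ i - a $ i) * (B $ j - b $ j)\<bar> \<le> e * d"
      unfolding abs_mult by (intro mult_mono A B e order_refl abs_ge_zero)+
    from abs3[OF this] show ?thesis by (simp add: algebra_simps)
  qed
  have collect: "e * b4 + a2 * d + e * d + (e * b5 + a1 * d + e * d) + (e * b6 + a3 * d + e * d) +
      (e * b1 + a5 * d + e * d) + (e * b2 + a4 * d + e * d) + (e * b3 + a6 * d + e * d) =
      e * (b1 + b2 + b3 + b4 + b5 + b6) + (a1 + a2 + a3 + a4 + a5 + a6) * d + 6 * (e * d)"
    for a1 a2 a3 a4 a5 a6 b1 b2 b3 b4 b5 b6 :: real
    unfolding distrib_left distrib_right by linarith
  have eq: "om (rh A) B - om (rh a) b =
      (A $ Inl 2 * B $ Inr 1 - a $ Inl 2 * b $ Inr 1) + (A $ Inl 1 * B $ Inr 2 - a $ Inl 1 * b $ Inr 2) +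
      (A $ Inl 3 * B $ Inr 3 - a $ Inl 3 * b $ Inr 3) + (A $ Inr 2 * B $ Inl 1 - a $ Inr 2 * b $ Inl 1) +
      (A $ Inr 1 * B $ Inl 2 - a $ Inr 1 * b $ Inl 2) + (A $ Inr 3 * B $ Inl 3 - a $ Inr 3 * b $ Inl 3)"
    by (simp add: om_def rh_def)
  show ?thesis
    unfolding eq by (rule order_trans[OF abs_sum_6[OF p p p p p p] eq_refl[OF collect]])
qed

context variational
begin

text \<open>Gronwall for the linearised equation along the true orbit, with the column defect as
  inhomogeneity; 27.7 is \<open>136 / 4.911\<close> rounded up. The last term is the passage from
  time \<open>2 - h\<close> to 2 with slope at most 5.\<close>

lemma column_error:
  assumes h: "0 < h" "h \<le> 3 / 10 ^ 6" and \<tau>_eq: "\<tau> = Tr / 2 * (2 - h)"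
    and tube: "\<And>t. t \<in> {0..2 - h} \<Longrightarrow> in_tube t (\<gamma> (Tr / 2 * t))"
    and V: "wbound c (tdefect (tcol 16 jacs (exact V)) V)" "length V = 6" "list_all (\<lambda>p. pwnorm 0 p \<le> 5 * 2 ^ 46) V"
    and c: "0 \<le> c" and v: "track V 0 = v"
  shows "\<bar>\<Phi> \<tau> v $ k - track V 2 $ k\<bar> \<le> of_int c / 2 ^ 46 * 27.7 + 15 / 10 ^ 6"
proof -
  define d :: real where "d = of_int c / 2 ^ 46 / 2"
  have d0: "d \<ge> 0" using c by (simp add: d_def)
  have "\<bar>\<Phi> (Tr / 2 * (2 - h)) v $ k - track V (2 - h) $ k\<bar> \<le>
    ((0 + d / (4.911 / 2)) * exp (4.911 / 2 * (2 - h)) - d / (4.911 / 2)) * wt k"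
  proof (rule gronwall_weighted_sup[where y = "\<lambda>k t. \<Phi> (Tr / 2 * t) v $ k - track V t $ k" and S = "2 - h"
        and y' = "\<lambda>k t. Tr / 2 * dfield (\<gamma> (Tr / 2 * t)) (\<Phi> (Tr / 2 * t) v) $ k - track (map pder V) t $ k / 2"])
    have D: "((\<lambda>t. \<Phi> (Tr / 2 * t) v $ k) has_real_derivative Tr / 2 * dfield (\<gamma> (Tr / 2 * t)) (\<Phi> (Tr / 2 * t) v) $ k) (at t)" for k t
    proof -
      have "((\<lambda>s. \<Phi> s v $ k) has_real_derivative dfield (\<gamma> (Tr / 2 * t)) (\<Phi> (Tr / 2 * t) v) $ k) (at (Tr / 2 * t))"
        using \<Phi>[of v "Tr / 2 * t" UNIV] unfolding has_real_derivative_phase_iff[symmetric] by blast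
      moreover have "((\<lambda>t. Tr / 2 * t) has_real_derivative Tr / 2) (at t)" by (auto intro!: derivative_eq_intros)
      ultimately show ?thesis unfolding mult.commute[of "Tr / 2" "dfield _ _ $ _"] by (rule DERIV_chain2)
    qed
    have "continuous_on {0..2 - h} (track V)" using h by (intro continuous_on_subset[OF continuous_on_track]) auto
    then have "continuous_on {0..2 - h} (\<lambda>t. track V t $ k)" for k by (intro continuous_intros)
    moreover have "continuous_on {0..2 - h} (\<lambda>t. \<Phi> (Tr / 2 * t) v $ k)" for k
      by (rule DERIV_continuous_on) (rule has_field_derivative_at_within[OF D])
    ultimately show "continuous_on {0..2 - h} (\<lambda>t. \<Phi> (Tr / 2 * t) v $ k - track V t $ k)" for k
      by (rule continuous_on_diff[rotated])
    show "((\<lambda>t. \<Phi> (Tr / 2 * t) v $ k - track V t $ k) has_real_derivative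
        Tr / 2 * dfield (\<gamma> (Tr / 2 * t)) (\<Phi> (Tr / 2 * t) v) $ k - track (map pder V) t $ k / 2) (at t)"
      if "0 < t" "t < 2 - h" for k t
      by (intro DERIV_diff D DERIV_track V) (use that h in auto)
    show "\<bar>Tr / 2 * dfield (\<gamma> (Tr / 2 * t)) (\<Phi> (Tr / 2 * t) v) $ k - track (map pder V) t $ k / 2\<bar> \<le> (4.911 / 2 * m + d) * wt k"
      if t: "0 < t" "t < 2 - h" and m: "\<And>j. \<bar>\<Phi> (Tr / 2 * t) v $ j - track V t $ j\<bar> \<le> m * wt j" for k t m
    proof -
      let ?x = "\<gamma> (Tr / 2 * t)" and ?u = "\<Phi> (Tr / 2 * t) v"
      have mean: "\<bar>(x + y) / 2\<bar> \<le> (a + b) / 2" if "\<bar>x\<bar> \<le> a" "\<bar>y\<bar> \<le> b" for x y a b :: real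
      proof -
        have "\<bar>x + y\<bar> \<le> a + b" by (rule order_trans[OF abs_triangle_ineq add_mono[OF that]])
        from divide_right_mono[OF this, of 2] show ?thesis unfolding abs_divide by simp
      qed
      have tb: "in_tube t ?x" using t by (intro tube) simp
      have "\<bar>Tr * dfield ?x (?u - track V t) $ k\<bar> \<le> 4.911 * m * wt k"
        by (rule dfield_bound[OF tb]) (use m in simp)
      moreover have "\<bar>Tr * dfield ?x (track V t) $ k - track (map pder V) t $ k\<bar> \<le> of_int c / 2 ^ 46 * wt k"
        by (rule col_bound[OF tb V(1,2)])
      ultimately have "\<bar>(Tr * dfield ?x (?u - track V t) $ k + (Tr * dfield ?x (track V t) $ k - track (map pder V) t $ k)) / 2\<bar>
          \<le> (4.911 * m * wt k + of_int c / 2 ^ 46 * wt k) / 2" by (rule mean)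
      moreover have "Tr / 2 * dfield ?x ?u $ k - track (map pder V) t $ k / 2 =
        (Tr * dfield ?x (?u - track V t) $ k + (Tr * dfield ?x (track V t) $ k - track (map pder V) t $ k)) / 2"
        using linear_dfield by (simp add: linear_diff right_diff_distrib diff_divide_distrib)
      moreover have "(4.911 / 2 * m + d) * wt k = (4.911 * m * wt k + of_int c / 2 ^ 46 * wt k) / 2"
        by (simp add: d_def algebra_simps)
      ultimately show ?thesis by (simp only:)
    qed
  qed (use h wt_pos v in auto)
  also have "\<dots> \<le> of_int c / 2 ^ 46 * 27.7 * 1"
  proof (intro mult_mono)
    have "exp (4.911 / 2 * (2 - h)) \<le> exp 4.911" using h by simp
    then have "exp (4.911 / 2 * (2 - h)) \<le> 136" using exp_bound_4911 by (rule order_trans)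
    then have "d / (4.911 / 2) * exp (4.911 / 2 * (2 - h)) \<le> d / (4.911 / 2) * 136"
      using d0 by (intro mult_left_mono) auto
    then show "(0 + d / (4.911 / 2)) * exp (4.911 / 2 * (2 - h)) - d / (4.911 / 2) \<le> of_int c / 2 ^ 46 * 27.7"
      using d0 by (simp add: d_def)
  qed (use c wt_le wt_pos[of k] in auto)
  finally have "\<bar>\<Phi> \<tau> v $ k - track V (2 - h) $ k\<bar> \<le> of_int c / 2 ^ 46 * 27.7" unfolding \<tau>_eq by simp
  moreover have "\<bar>track V (2 - h) $ k - track V 2 $ k\<bar> \<le> 15 / 10 ^ 6"
  proof -
    have "\<bar>cheb (V ! i) (2 - h) - cheb (V ! i) 2\<bar> \<le> 15 / 10 ^ 6" if "i < 6" for i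
    proof -
      have "\<bar>cheb (V ! i) (2 - h) - cheb (V ! i) 2\<bar> \<le> (2 - (2 - h)) * (of_int (5 * 2 ^ 46) / 2 ^ 46)"
        using h V that by (intro cheb_near_2) (auto simp: list_all_length)
      also have "\<dots> \<le> 15 / 10 ^ 6" using h by simp
      finally show ?thesis .
    qed
    then have "\<forall>k. \<bar>track V (2 - h) $ k - track V 2 $ k\<bar> \<le> 15 / 10 ^ 6" unfolding all_phase track_def by simp
    then show ?thesis ..
  qed
  ultimately show ?thesis
    using abs_triangle_ineq[of "\<Phi> \<tau> v $ k - track V (2 - h) $ k" "track V (2 - h) $ k - track V 2 $ k"]
    by linarith
qed

lemma cubic_stable:
  assumes h: "0 < h" "h \<le> 3 / 10 ^ 6" and \<tau>_eq: "\<tau> = Tr / 2 * (2 - h)"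
    and tube: "\<And>t. t \<in> {0..2 - h} \<Longrightarrow> in_tube t (\<gamma> (Tr / 2 * t))"
    and field: "field (\<gamma> 0) = c *\<^sub>R e1" "c \<noteq> 0"
  shows "linearly_stable (- 1) \<gamma> (12 * \<tau>)"
proof -
  have alt: "cheb (V ! i) 2 = of_int (map altsum V ! i) / 2 ^ 46" if "length V = 6" "i < 6" for V i
    using that by (simp add: cheb_2)
  have init: "track col_a 0 = ua" "track col_b 0 = ub" "track col_c 0 = v1" "track col_d 0 = v2"
    by (simp_all add: phase_eq_iff track_def cheb_0 col_a_def col_b_def col_c_def col_d_def)
  note err = column_error[OF h \<tau>_eq tube]
  have tri: "\<bar>x - z\<bar> \<le> e" if "\<bar>x - y\<bar> \<le> e'" "\<bar>y - z\<bar> \<le> 1 / 10 ^ 8" "e' + 1 / 10 ^ 8 \<le> e" for x y z e e' :: real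
    using that by linarith
  \<comment> \<open>The end values of the four columns, from \<open>endpoint_values\<close> and
    \<open>endpoint_values_conjugate\<close>, rounded to eight decimals.\<close>
  let ?a = "ph 1.74446509 (- 0.65225684) 1.04031791 (- 2.26110087) (- 0.82495388) (- 1.26237196)"
  let ?b = "ph (- 0.40989338) (- 0.39482602) 0.43113091 (- 0.57953218) (- 0.64558034) 1.24785459"
  let ?c = "ph 0.24090674 1.27101023 (- 0.95997550) 0.00001630 (- 0.00011259) (- 0.36671001)"
  let ?d = "ph 0.32466967 0.25799964 0.44449540 (- 0.06369136) 0.61092661 0.96270681"
  have half: "\<bar>y / 2 - z\<bar> \<le> t - e / 2 \<Longrightarrow> \<bar>x / 2 - z\<bar> \<le> t" "\<bar>y / 2 + z\<bar> \<le> t - e / 2 \<Longrightarrow> \<bar>x / 2 + z\<bar> \<le> t"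
    if "\<bar>x - y\<bar> \<le> e" for x y z e t :: real
    using that unfolding abs_le_iff by simp_all
  have "\<forall>k. \<bar>track col_a 2 $ k - ?a $ k\<bar> \<le> 1 / 10 ^ 8" "\<forall>k. \<bar>track col_b 2 $ k - ?b $ k\<bar> \<le> 1 / 10 ^ 8"
    "\<forall>k. \<bar>track col_c 2 $ k - ?c $ k\<bar> \<le> 1 / 10 ^ 8" "\<forall>k. \<bar>track col_d 2 $ k - ?d $ k\<bar> \<le> 1 / 10 ^ 8"
    unfolding all_phase track_def ph_nth
    by (simp_all add: alt length_data endpoint_values endpoint_values_conjugate)
  \<comment> \<open>The bound of \<open>column_error\<close> for each column plus the rounding
    \<open>1 / 10 ^ 8\<close>.\<close>
  then have a: "\<bar>\<Phi> \<tau> ua $ k - ?a $ k\<bar> \<le> 0.00143" and b: "\<bar>\<Phi> \<tau> ub $ k - ?b $ k\<bar> \<le> 0.00033"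
    and c: "\<bar>\<Phi> \<tau> v1 $ k - ?c $ k\<bar> \<le> 0.00057" and d: "\<bar>\<Phi> \<tau> v2 $ k - ?d $ k\<bar> \<le> 0.00032" for k
    by - (rule tri[OF err[OF _ col_a_defect length_data(2) endpoint_slopes(2) _ init(1)] spec[of _ k]]
        tri[OF err[OF _ col_b_defect length_data(3) endpoint_slopes(3) _ init(2)] spec[of _ k]]
        tri[OF err[OF _ col_c_defect length_data(4) endpoint_slopes_conjugate(1) _ init(3)] spec[of _ k]]
        tri[OF err[OF _ col_d_defect length_data(5) endpoint_slopes_conjugate(2) _ init(4)] spec[of _ k]];
        (assumption | simp))+
  show ?thesis
  proof (rule stable_from_pairings[OF field])
    show "\<bar>pairing v1 ub + 1.12404\<bar> \<le> 0.0016"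
      unfolding pairing_def by (rule half(2)[OF om_rh_error[OF c b]]) (simp add: om_rh_ph)
    show "\<bar>pairing v2 ub - 0.19267\<bar> \<le> 0.0011"
      unfolding pairing_def by (rule half(1)[OF om_rh_error[OF d b]]) (simp add: om_rh_ph)
    show "\<bar>pairing v1 ua + 1.12124\<bar> \<le> 0.0045"
      unfolding pairing_def by (rule half(2)[OF om_rh_error[OF c a]]) (simp add: om_rh_ph)
    show "\<bar>pairing v2 ua - 0.34824\<bar> \<le> 0.0032"
      unfolding pairing_def by (rule half(1)[OF om_rh_error[OF d a]]) (simp add: om_rh_ph)
  qed
qed

end

theorem theorem1:
  shows "\<exists>\<alpha> \<beta> \<tau> :: real. \<exists>\<gamma> :: real \<Rightarrow> phase.
    \<tau> > 0 \<and>
    \<bar>\<alpha> - 3.100685\<bar> \<le> 5 / 10 ^ 4 \<and> \<bar>\<beta> - 0.668162\<bar> \<le> 5 / 10 ^ 4 \<and>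
    \<bar>12 * \<tau> - 0.124736\<bar> \<le> 5 / 10 ^ 6 \<and>
    Gam_solution (- 1) \<gamma> \<and>
    \<gamma> 0 = state (vector [0, \<alpha>, \<alpha>]) (vector [sqrt 2, - \<beta>, \<beta>]) \<and>
    \<gamma> (2 * \<tau>) = state (vector [\<alpha>, 0, \<alpha>]) (vector [\<beta>, - sqrt 2, - \<beta>]) \<and>
    (\<forall>s. \<gamma> (s + 12 * \<tau>) = \<gamma> s) \<and>
    linearly_stable (- 1) \<gamma> (12 * \<tau>)"
proof -
  obtain c1 c2 h x where c: "\<bar>c1\<bar> \<le> 2 / 10 ^ 8" "\<bar>c2\<bar> \<le> 2 / 10 ^ 8" and h: "\<bar>h - 2 / 10 ^ 6\<bar> \<le> 4 / 10 ^ 8"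
    and x: "near c1 c2 x"
    and fin: "x (2 - h) $ Inl 1 = x (2 - h) $ Inl 2" "x (2 - h) $ Inr 1 = - x (2 - h) $ Inr 2" "x (2 - h) $ Inr 3 = 0"
    using shooting by blast
  have h: "1 / 10 ^ 6 \<le> h" "h \<le> 3 / 10 ^ 6" using h unfolding abs_le_iff by simp_all
  have h0: "0 < h" using h(1) by (rule less_le_trans[rotated]) simp
  have Tr: "Tr = 731450239209 / 2 ^ 46" by (simp add: Tr_def Tn_def)
  \<comment> \<open>\<open>r\<close> converts the parameter \<open>t\<close> of the series into the
    time \<open>s = r * t\<close> of the flow.\<close>
  define r where "r = Tr / 2"
  have r: "r > 0" by (simp add: r_def Tr)
  define \<tau> where "\<tau> = r * (2 - h)"
  have \<tau>: "\<tau> > 0" using r h by (simp add: \<tau>_def)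
  define g where "g s = x (s / r)" for s
  have sr: "s / r \<in> {0..2}" if "s \<in> {0..\<tau>}" for s
  proof -
    have "r * (2 - h) \<le> r * 2" using r h0 by (intro mult_left_mono) auto
    then have "s \<le> r * 2" using that by (simp add: \<tau>_def)
    then show ?thesis using that r by (simp add: field_simps)
  qed
  have x0: "x 0 = start c1 c2" and sol: "solves x" using x by (auto simp: near_def)
  have "\<exists>\<gamma>. (\<forall>s. \<gamma> s \<in> Gam_domain \<and> (\<gamma> has_vector_derivative field (\<gamma> s)) (at s)) \<and>
    (\<forall>s\<in>{0..\<tau>}. \<gamma> s = g s) \<and> (\<forall>s. \<gamma> (s + 2 * \<tau>) = turn (\<gamma> s)) \<and> (\<forall>s\<in>{0..2 * \<tau>}. \<gamma> (2 * \<tau> - s) = rh (\<gamma> s))"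
  proof (rule symmetric_extension[OF \<tau>])
    fix s assume s: "s \<in> {0..\<tau>}"
    have "((\<lambda>s. s / r) has_vector_derivative 1 / r) (at s within {0..\<tau>})"
      unfolding has_real_derivative_iff_has_vector_derivative[symmetric] using r by (auto intro!: derivative_eq_intros)
    moreover have "(x has_vector_derivative r *\<^sub>R field (x (s / r))) (at (s / r) within (\<lambda>s. s / r) ` {0..\<tau>})"
      by (rule has_vector_derivative_within_subset[OF bspec[OF sol[unfolded solves_def, folded r_def] sr[OF s]]])
        (use sr in blast)
    ultimately have "((x \<circ> (\<lambda>s. s / r)) has_vector_derivative (1 / r) *\<^sub>R r *\<^sub>R field (x (s / r))) (at s within {0..\<tau>})"
      by (rule vector_diff_chain_within)
    then show "(g has_vector_derivative field (g s)) (at s within {0..\<tau>})"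
      using r by (simp add: o_def g_def[abs_def])
    show "g s \<in> Gam_domain"
      unfolding g_def by (rule in_tube_jac(1)[OF near_tube[OF x c sr[OF s]]])
  next
    show "sg (g 0) = g 0" by (simp add: g_def x0 start_def sg_def phase_eq_iff)
    have "g \<tau> = x (2 - h)" using r by (simp add: g_def \<tau>_def)
    then show "rh (g \<tau>) = g \<tau>" using fin by (simp add: rh_def phase_eq_iff)
  qed
  then obtain \<gamma> where \<gamma>: "\<And>s. \<gamma> s \<in> Gam_domain" "\<And>s. (\<gamma> has_vector_derivative field (\<gamma> s)) (at s)"
    and \<gamma>g: "\<And>s. s \<in> {0..\<tau>} \<Longrightarrow> \<gamma> s = g s" and turn: "\<And>s. \<gamma> (s + 2 * \<tau>) = turn (\<gamma> s)"
    and rev: "\<And>s. s \<in> {0..2 * \<tau>} \<Longrightarrow> \<gamma> (2 * \<tau> - s) = rh (\<gamma> s)"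
    by blast
  interpret variational \<gamma> \<tau>
    by (rule variational.intro[OF \<tau> \<gamma> turn rev])
  define \<alpha> \<beta> where "\<alpha> = alpha0 + c1" and "\<beta> = beta0 + c2"
  have \<gamma>0: "\<gamma> 0 = ph 0 \<alpha> \<alpha> (sqrt 2) (- \<beta>) \<beta>"
    using \<gamma>g[of 0] \<tau> by (simp add: g_def x0 start_def \<alpha>_def \<beta>_def)
  have \<alpha>: "\<bar>\<alpha> - 3.100685\<bar> \<le> 5 / 10 ^ 4" using c unfolding \<alpha>_def alpha0_def abs_le_iff by simp
  have "linearly_stable (- 1) \<gamma> (12 * \<tau>)"
  proof (rule cubic_stable[OF h0 h(2)])
    show "\<tau> = Tr / 2 * (2 - h)" by (simp add: \<tau>_def r_def)
    show "in_tube t (\<gamma> (Tr / 2 * t))" if "t \<in> {0..2 - h}" for t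
    proof -
      have "\<gamma> (r * t) = g (r * t)" using that r by (intro \<gamma>g) (simp add: \<tau>_def)
      then have "\<gamma> (r * t) = x t" using r by (simp add: g_def)
      then show ?thesis using near_tube[OF x c, of t] that h0 by (simp add: r_def)
    qed
    \<comment> \<open>At the start \<open>Q1 = 0\<close> and \<open>P1 ^ 2 = 2\<close>, so
      \<open>pp\<close> vanishes for the first index and only \<open>Q1\<close> has a nonzero
      velocity.\<close>
    show "field (\<gamma> 0) = (128 * (sqrt 2 * (\<alpha>\<^sup>2 / 8 * (\<alpha>\<^sup>2 / 8)))) *\<^sub>R ph 1 0 0 0 0 0"
      by (simp add: \<gamma>0 field_def slope_def phase_eq_iff)
    show "128 * (sqrt 2 * (\<alpha>\<^sup>2 / 8 * (\<alpha>\<^sup>2 / 8))) \<noteq> 0" using \<alpha> unfolding abs_le_iff by simp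
  qed
  moreover have "\<gamma> (2 * \<tau>) = ph \<alpha> 0 \<alpha> \<beta> (- sqrt 2) (- \<beta>)"
    using turn[of 0] by (simp add: \<gamma>0 turn_def rh_def sg_def)
  moreover have "\<bar>\<beta> - 0.668162\<bar> \<le> 5 / 10 ^ 4" using c unfolding \<beta>_def beta0_def abs_le_iff by simp
  moreover have "\<bar>12 * \<tau> - 0.124736\<bar> \<le> 5 / 10 ^ 6"
    using h unfolding \<tau>_def r_def Tr abs_le_iff by (simp add: field_simps)
  moreover have "Gam_solution (- 1) \<gamma>" unfolding Gam_solution_iff using \<gamma> by blast
  ultimately show ?thesis
    using \<tau> \<alpha> \<gamma>0 period unfolding state_ph by blast
qed

end
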